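(* Let $m\ge 0$ and $n\ge 1$ be integers and let $\Lambda=H_1\cup\cdots\cup H_n\subset\mathbb{CP}^{m+2}$ be a union of $n$ hyperplanes. Then the fundamental group $\pi_1(\mathbb{CP}^{m+2}\setminus\Lambda)$ is a free group if and only if $\dim(H_1\cap\cdots\cap H_n)\ge m$.
   Context: $\mathbb{CP}^{m+2}$ is complex projective space of complex dimension $m+2$, and a hyperplane is a projective linear subspace of complex dimension $m+1$. Here $\dim$ denotes the complex dimension of a projective linear subspace; if $H_1\cap\cdots\cap H_n=\emptyset$, the condition $\dim(H_1\cap\cdots\cap H_n)\ge m$ is regarded as false. The fundamental group is that of the complement with its topology induced from $\mathbb{CP}^{m+2}$ (the complement is path connected, so the base point is irrelevant). The trivial group counts as a free group (of rank $0$). *)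

theory Defs
  imports "HOL-Analysis.Analysis" "HOL-Algebra.Group"
begin

section \<open>Complex projective space\<close>

definition proportional :: "complex ^ 'n \<Rightarrow> complex ^ 'n \<Rightarrow> bool" where
  "proportional v w \<longleftrightarrow> v \<noteq> 0 \<and> w \<noteq> 0 \<and> (\<exists>c. w = c *s v)"

text \<open>The index type \<open>'n\<close> numbers the homogeneous coordinates, so the complex dimension of
  \<open>'n cproj\<close> is one less than the cardinality of \<open>'n\<close>.\<close>

quotient_type (overloaded) 'n cproj = "complex ^ 'n::finite" / partial: proportional
  morphisms rep_cproj abs_cproj
proof (rule part_equivpI)
  show "\<exists>v :: complex ^ 'n. proportional v v"
  proof (rule exI[of _ "vec 1"])
    have "vec 1 \<noteq> (0 :: complex ^ 'n)"
      by (simp add: vec_eq_iff)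
    then show "proportional (vec 1) (vec 1 :: complex ^ 'n)"
      unfolding proportional_def by (metis vec.scale_one)
  qed
  show "symp (proportional :: complex ^ 'n \<Rightarrow> _)"
  proof (rule sympI)
    fix v w :: "complex ^ 'n"
    assume "proportional v w"
    then obtain c where "v \<noteq> 0" "w \<noteq> 0" and c: "w = c *s v"
      unfolding proportional_def by blast
    moreover from this have "c \<noteq> 0"
      by (metis vec.scale_zero_left)
    then have "v = inverse c *s w"
      by (simp add: c)
    ultimately show "proportional w v"
      unfolding proportional_def by blast
  qed
  show "transp (proportional :: complex ^ 'n \<Rightarrow> _)"
    unfolding proportional_def by (rule transpI) (metis vec.scale_scale)
qed

text \<open>The quotient topology. Since the nonzero vectors form an open set, openness of the preimage
  in the punctured space and in the whole vector space agree. The value of \<open>abs_cproj 0\<close> is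
  unspecified, hence the explicit exclusion of \<open>0\<close>.\<close>

instantiation cproj :: (finite) topological_space
begin

definition open_cproj :: "'a cproj set \<Rightarrow> bool" where
  "open_cproj U \<longleftrightarrow> open {v. v \<noteq> 0 \<and> abs_cproj v \<in> U}"

instance
proof
  show "open (UNIV :: 'a cproj set)"
    by (auto simp: open_cproj_def intro!: open_Collect_neq continuous_intros)
next
  fix S T :: "'a cproj set"
  assume "open S" "open T"
  moreover have "{v. v \<noteq> 0 \<and> abs_cproj v \<in> S \<inter> T}
      = {v. v \<noteq> 0 \<and> abs_cproj v \<in> S} \<inter> {v. v \<noteq> 0 \<and> abs_cproj v \<in> T}"
    by auto
  ultimately show "open (S \<inter> T)"
    unfolding open_cproj_def by (simp only: open_Int)
next
  fix K :: "'a cproj set set"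
  assume K: "\<forall>S\<in>K. open S"
  have "{v. v \<noteq> 0 \<and> abs_cproj v \<in> \<Union>K} = (\<Union>S\<in>K. {v. v \<noteq> 0 \<and> abs_cproj v \<in> S})"
    by auto
  moreover have "open (\<Union>S\<in>K. {v. v \<noteq> 0 \<and> abs_cproj v \<in> S})"
    using K by (intro open_UN) (simp add: open_cproj_def)
  ultimately show "open (\<Union>K)"
    by (simp add: open_cproj_def)
qed

end

definition proj_cone :: "'n::finite cproj set \<Rightarrow> (complex ^ 'n) set" where
  "proj_cone P = {v. v = 0 \<or> abs_cproj v \<in> P}"

text \<open>The prefix \<open>vec\<close> selects the notions of linear subspace and dimension over the field of
  scalars, here the complex numbers; the unprefixed constants are the real ones.\<close>

definition projective_subspace :: "'n::finite cproj set \<Rightarrow> bool" where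
  "projective_subspace P \<longleftrightarrow> P \<noteq> {} \<and> vec.subspace (proj_cone P)"

definition proj_dim :: "'n::finite cproj set \<Rightarrow> nat" where
  "proj_dim P = vec.dim (proj_cone P) - 1"

lemma abs_cproj_eq_iff:
  assumes "v \<noteq> 0" "w \<noteq> 0"
  shows "abs_cproj v = abs_cproj w \<longleftrightarrow> (\<exists>c. w = c *s v)"
proof -
  have refl: "proportional u u" if "u \<noteq> 0" for u :: "complex ^ 'a"
    unfolding proportional_def using that by (metis vec.scale_one)
  have "proportional v w \<longleftrightarrow> abs_cproj v = abs_cproj w"
    using Quotient3_rel[OF Quotient3_cproj, of v w] refl assms by blast
  then show ?thesis
    using assms by (simp add: proportional_def)
qed

lemma abs_cproj_cases:
  obtains v where "v \<noteq> 0" "p = abs_cproj v"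
  using Quotient3_abs_rep[OF Quotient3_cproj, of p] Quotient3_rep_reflp[OF Quotient3_cproj, of p]
  unfolding proportional_def by metis

lemma proj_cone_image:
  assumes W: "vec.subspace W"
  shows "proj_cone (abs_cproj ` (W - {0})) = W"
proof (rule Set.set_eqI)
  fix v
  show "v \<in> proj_cone (abs_cproj ` (W - {0})) \<longleftrightarrow> v \<in> W"
  proof (cases "v = 0")
    case True
    then show ?thesis
      using vec.subspace_0[OF W] by (simp add: proj_cone_def)
  next
    case False
    have "v \<in> W" if w: "w \<in> W" "w \<noteq> 0" "abs_cproj v = abs_cproj w" for w
    proof -
      obtain c where "v = c *s w"
        using abs_cproj_eq_iff[of w v] w(2,3) False by auto
      then show ?thesis
        using vec.subspace_scale[OF W w(1)] by simp
    qed
    then show ?thesis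
      using False unfolding proj_cone_def by (auto simp: image_iff)
  qed
qed


section \<open>The fundamental group\<close>

definition loops_at :: "'a::topological_space set \<Rightarrow> 'a \<Rightarrow> (real \<Rightarrow> 'a) set" where
  "loops_at S x = {p. path p \<and> path_image p \<subseteq> S \<and> pathstart p = x \<and> pathfinish p = x}"

definition loop_homotopy ::
    "'a::topological_space set \<Rightarrow> 'a \<Rightarrow> ((real \<Rightarrow> 'a) \<times> (real \<Rightarrow> 'a)) set" where
  "loop_homotopy S x = {(p, q). p \<in> loops_at S x \<and> q \<in> loops_at S x \<and> homotopic_paths S p q}"

definition fundamental_group ::
    "'a::topological_space set \<Rightarrow> 'a \<Rightarrow> (real \<Rightarrow> 'a) set monoid" where
  "fundamental_group S x =
     \<lparr> carrier = loops_at S x // loop_homotopy S x,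
       monoid.mult = (\<lambda>A B. \<Union>p\<in>A. \<Union>q\<in>B. loop_homotopy S x `` {p +++ q}),
       one = loop_homotopy S x `` {\<lambda>_. x} \<rparr>"


lemma equiv_loop_homotopy: "equiv (loops_at S x) (loop_homotopy S x)"
  by (rule equivI)
     (auto simp: loop_homotopy_def loops_at_def refl_on_def sym_def trans_def
       intro: homotopic_paths_sym homotopic_paths_trans)

lemma join_loops: "p \<in> loops_at S x \<Longrightarrow> q \<in> loops_at S x \<Longrightarrow> p +++ q \<in> loops_at S x"
  by (auto simp: loops_at_def subset_path_image_join path_image_join)

lemma loop_homotopy_join:
  "(p, p') \<in> loop_homotopy S x \<Longrightarrow> (q, q') \<in> loop_homotopy S x \<Longrightarrow>
     (p +++ q, p' +++ q') \<in> loop_homotopy S x"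
  unfolding loop_homotopy_def
  by (auto simp: join_loops) (auto simp: loops_at_def intro: homotopic_paths_join)

lemma fundamental_group_mult:
  assumes "p \<in> loops_at S x" "q \<in> loops_at S x"
  shows "loop_homotopy S x `` {p} \<otimes>\<^bsub>fundamental_group S x\<^esub> loop_homotopy S x `` {q}
           = loop_homotopy S x `` {p +++ q}"
proof -
  have "loop_homotopy S x `` {p' +++ q'} = loop_homotopy S x `` {p +++ q}"
    if "(p, p') \<in> loop_homotopy S x" "(q, q') \<in> loop_homotopy S x" for p' q'
    using loop_homotopy_join[OF that] by (metis equiv_class_eq equiv_loop_homotopy)
  then have "(\<Union>p'\<in>loop_homotopy S x `` {p}. \<Union>q'\<in>loop_homotopy S x `` {q}.
        loop_homotopy S x `` {p' +++ q'})
      = (\<Union>p'\<in>loop_homotopy S x `` {p}. \<Union>q'\<in>loop_homotopy S x `` {q}.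
        loop_homotopy S x `` {p +++ q})"
    by (intro SUP_cong refl) simp
  moreover have "p \<in> loop_homotopy S x `` {p}" "q \<in> loop_homotopy S x `` {q}"
    using assms by (simp_all add: loop_homotopy_def loops_at_def)
  then have "loop_homotopy S x `` {p} \<noteq> {}" "loop_homotopy S x `` {q} \<noteq> {}"
    by force+
  ultimately show ?thesis
    by (simp add: fundamental_group_def)
qed

lemma const_loop: "x \<in> S \<Longrightarrow> (\<lambda>_. x) \<in> loops_at S x"
  by (auto simp: loops_at_def path_def path_image_def pathstart_def pathfinish_def)

lemma loop_homotopy_const_join:
  assumes "p \<in> loops_at S x"
  shows "((\<lambda>_. x) +++ p, p) \<in> loop_homotopy S x"
proof -
  have x: "x \<in> S"
    using assms by (force simp: loops_at_def path_image_def pathstart_def)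
  have "homotopic_paths S p ((\<lambda>_. x) +++ p)"
  proof (rule homotopic_paths_reparametrize)
    show "continuous_on {0..1} (\<lambda>t :: real. max 0 (2 * t - 1))"
      by (intro continuous_intros)
    show "((\<lambda>_. x) +++ p) t = p (max 0 (2 * t - 1))" for t
      using assms by (cases "2 * t \<le> 1") (auto simp: loops_at_def joinpaths_def pathstart_def)
  qed (use assms in \<open>auto simp: loops_at_def\<close>)
  then show ?thesis
    using assms join_loops[OF const_loop[OF x] assms]
    by (auto simp: loop_homotopy_def homotopic_paths_sym)
qed

lemma loop_homotopy_reverse_join:
  assumes p: "p \<in> loops_at S x"
  shows "(reversepath p +++ p, \<lambda>_. x) \<in> loop_homotopy S x"
proof -
  have x: "x \<in> S"
    using assms by (force simp: loops_at_def path_image_def pathstart_def)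
  have p': "continuous_on {0..1} p" "p ` {0..1} \<subseteq> S" "p 0 = x" "p 1 = x"
    using p by (auto simp: loops_at_def path_def path_image_def pathstart_def pathfinish_def)
  define k where "k = (\<lambda>y :: real \<times> real. max (fst y) \<bar>2 * snd y - 1\<bar>)"
  have k: "k ` ({0..1} \<times> {0..1}) \<subseteq> {0..1}"
    by (auto simp: k_def)
  have "homotopic_paths S (reversepath p +++ p) (\<lambda>_. x)"
    unfolding homotopic_paths
  proof (intro exI[of _ "p \<circ> k"] conjI ballI)
    show "continuous_on ({0..1} \<times> {0..1}) (p \<circ> k)"
      by (rule continuous_on_compose[OF _ continuous_on_subset[OF p'(1) k]])
         (auto simp: k_def intro!: continuous_intros)
    show "(p \<circ> k) (1, t) = x" if "t \<in> {0..1}" for t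
    proof -
      have "max 1 \<bar>2 * t - 1\<bar> = 1"
        using that by (auto simp: max_def abs_if)
      then show ?thesis
        using p' by (simp add: k_def)
    qed
    show "(p \<circ> k) (0, t) = (reversepath p +++ p) t" if "t \<in> {0..1}" for t
      using that by (auto simp: k_def joinpaths_def reversepath_def max_def abs_if field_simps)
  qed (use k p' in \<open>auto simp: k_def joinpaths_def reversepath_def pathstart_def pathfinish_def max_def image_subset_iff field_simps\<close>)
  moreover have "reversepath p \<in> loops_at S x"
    using p by (auto simp: loops_at_def)
  ultimately show ?thesis
    using p const_loop[OF x] by (auto simp: loop_homotopy_def join_loops)
qed

lemma group_fundamental_group:
  assumes "x \<in> S"
  shows "group (fundamental_group S x)"
proof -
  let ?G = "fundamental_group S x" and ?c = "\<lambda>p. loop_homotopy S x `` {p}"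
  have class_eq: "?c p = ?c q" if "(p, q) \<in> loop_homotopy S x" for p q
    using that equiv_class_eq[OF equiv_loop_homotopy] by blast
  have carrier: "A \<in> carrier ?G \<longleftrightarrow> (\<exists>p\<in>loops_at S x. A = ?c p)" for A
    by (auto simp: fundamental_group_def quotient_def)
  have one: "\<one>\<^bsub>?G\<^esub> = ?c (\<lambda>_. x)"
    by (simp add: fundamental_group_def)
  show ?thesis
  proof (rule groupI)
    show "\<one>\<^bsub>?G\<^esub> \<in> carrier ?G"
      using const_loop[OF assms] carrier one by blast
  next
    fix A B assume "A \<in> carrier ?G" "B \<in> carrier ?G"
    then show "A \<otimes>\<^bsub>?G\<^esub> B \<in> carrier ?G"
      unfolding carrier using fundamental_group_mult join_loops by metis
  next
    fix A B C assume "A \<in> carrier ?G" "B \<in> carrier ?G" "C \<in> carrier ?G"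
    then obtain p q r where pqr: "p \<in> loops_at S x" "q \<in> loops_at S x" "r \<in> loops_at S x"
      and eq: "A = ?c p" "B = ?c q" "C = ?c r"
      unfolding carrier by blast
    have "homotopic_paths S ((p +++ q) +++ r) (p +++ (q +++ r))"
      using pqr by (intro homotopic_paths_sym[OF homotopic_paths_assoc]) (auto simp: loops_at_def)
    then have "((p +++ q) +++ r, p +++ (q +++ r)) \<in> loop_homotopy S x"
      using pqr by (simp add: loop_homotopy_def join_loops)
    then show "A \<otimes>\<^bsub>?G\<^esub> B \<otimes>\<^bsub>?G\<^esub> C = A \<otimes>\<^bsub>?G\<^esub> (B \<otimes>\<^bsub>?G\<^esub> C)"
      using pqr by (simp add: eq fundamental_group_mult join_loops class_eq)
  next
    fix A assume "A \<in> carrier ?G"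
    then obtain p where p: "p \<in> loops_at S x" "A = ?c p"
      unfolding carrier by blast
    show "\<one>\<^bsub>?G\<^esub> \<otimes>\<^bsub>?G\<^esub> A = A"
      using p const_loop[OF assms]
      by (simp add: one fundamental_group_mult class_eq[OF loop_homotopy_const_join])
    have r: "reversepath p \<in> loops_at S x"
      using p by (auto simp: loops_at_def)
    then have "?c (reversepath p) \<otimes>\<^bsub>?G\<^esub> A = \<one>\<^bsub>?G\<^esub>"
      using p by (simp add: one fundamental_group_mult class_eq[OF loop_homotopy_reverse_join])
    then show "\<exists>B\<in>carrier ?G. B \<otimes>\<^bsub>?G\<^esub> A = \<one>\<^bsub>?G\<^esub>"
      using r carrier by blast
  qed
qed


section \<open>Free groups\<close>

text \<open>A letter \<open>(x, True)\<close> stands for the generator \<open>x\<close>, and \<open>(x, False)\<close> for its inverse.\<close>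

definition inv_letter :: "'x \<times> bool \<Rightarrow> 'x \<times> bool" where
  "inv_letter a = (fst a, \<not> snd a)"

definition reduced :: "('x \<times> bool) list \<Rightarrow> bool" where
  "reduced w \<longleftrightarrow> successively (\<lambda>a b. b \<noteq> inv_letter a) w"

fun reduced_Cons :: "'x \<times> bool \<Rightarrow> ('x \<times> bool) list \<Rightarrow> ('x \<times> bool) list" where
  "reduced_Cons a [] = [a]"
| "reduced_Cons a (b # w) = (if b = inv_letter a then w else a # b # w)"

definition free_group :: "'x set \<Rightarrow> ('x \<times> bool) list monoid" where
  "free_group X =
     \<lparr> carrier = {w. set w \<subseteq> X \<times> UNIV \<and> reduced w},
       monoid.mult = (\<lambda>u v. foldr reduced_Cons u v),
       one = [] \<rparr>"

lemma inv_letter_inv_letter [simp]: "inv_letter (inv_letter a) = a"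
  by (simp add: inv_letter_def)

lemma reduced_Cons_reduced: "reduced w \<Longrightarrow> reduced (reduced_Cons a w)"
  by (cases "(a, w)" rule: reduced_Cons.cases)
     (auto simp: reduced_def successively_Cons)

lemma set_reduced_Cons: "set (reduced_Cons a w) \<subseteq> insert a (set w)"
  by (cases "(a, w)" rule: reduced_Cons.cases) auto

lemma reduced_Cons_cancel: "reduced w \<Longrightarrow> reduced_Cons a (reduced_Cons (inv_letter a) w) = w"
proof (cases w)
  case (Cons b v)
  assume "reduced w"
  with Cons show ?thesis
    by (cases v) (auto simp: reduced_def)
qed simp

lemma reduced_foldr: "reduced v \<Longrightarrow> reduced (foldr reduced_Cons u v)"
  by (induction u) (auto intro: reduced_Cons_reduced)

lemma set_foldr: "set (foldr reduced_Cons u v) \<subseteq> set u \<union> set v"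
  using set_reduced_Cons by (induction u) fastforce+

lemma foldr_reduced_Cons:
  assumes "reduced w"
  shows "foldr reduced_Cons (reduced_Cons a v) w = reduced_Cons a (foldr reduced_Cons v w)"
proof (cases v)
  case (Cons b u)
  then show ?thesis
    using reduced_Cons_cancel[OF reduced_foldr[OF assms], of a u] by auto
qed simp

lemma group_free_group: "group (free_group X)"
proof (rule groupI)
  fix u v w
  assume w: "w \<in> carrier (free_group X)"
  have "foldr reduced_Cons (foldr reduced_Cons u v) w
      = foldr reduced_Cons u (foldr reduced_Cons v w)"
    using w by (induction u) (auto simp: free_group_def foldr_reduced_Cons)
  then show "u \<otimes>\<^bsub>free_group X\<^esub> v \<otimes>\<^bsub>free_group X\<^esub> w = u \<otimes>\<^bsub>free_group X\<^esub> (v \<otimes>\<^bsub>free_group X\<^esub> w)"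
    by (simp add: free_group_def)
next
  fix u v
  assume "u \<in> carrier (free_group X)" "v \<in> carrier (free_group X)"
  then show "u \<otimes>\<^bsub>free_group X\<^esub> v \<in> carrier (free_group X)"
    using set_foldr[of u v] by (auto simp: free_group_def intro: reduced_foldr)
next
  fix w assume "w \<in> carrier (free_group X)"
  then have w: "set w \<subseteq> X \<times> UNIV" "reduced w"
    by (auto simp: free_group_def)
  have "reduced (foldr reduced_Cons (rev (map inv_letter w)) [])"
    by (rule reduced_foldr) (simp add: reduced_def)
  moreover have "foldr reduced_Cons (foldr reduced_Cons v []) w = foldr reduced_Cons v w" for v
    by (induction v) (simp_all add: foldr_reduced_Cons w)
  moreover have "foldr reduced_Cons (rev (map inv_letter w)) w = []"
    using w(2)
  proof (induction w)
    case (Cons a w)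
    then show ?case
      by (auto simp: reduced_def successively_Cons)
  qed simp
  moreover have "set (foldr reduced_Cons (rev (map inv_letter w)) []) \<subseteq> X \<times> UNIV"
    using set_foldr[of "rev (map inv_letter w)" "[]"] w by (fastforce simp: inv_letter_def)
  ultimately show "\<exists>v\<in>carrier (free_group X). v \<otimes>\<^bsub>free_group X\<^esub> w = \<one>\<^bsub>free_group X\<^esub>"
    by (intro bexI[of _ "foldr reduced_Cons (rev (map inv_letter w)) []"])
       (simp_all add: free_group_def)
qed (auto simp: free_group_def reduced_def)

text \<open>Drawing the generators from the type of group elements loses nothing: a set of free
  generators of \<open>G\<close> is in bijection with a subset of \<open>G\<close>.\<close>

definition is_free_group :: "('g, 'b) monoid_scheme \<Rightarrow> bool" where
  "is_free_group G \<longleftrightarrow> group G \<and> (\<exists>X :: 'g set. G \<cong> free_group X)"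

end

theory Submission
  imports Defs "HOL-Complex_Analysis.Complex_Analysis"
begin

text \<open>
  If the common zero set of the linear forms has codimension at most two, all forms are combinations
  of two linear functions, and the quotient of these retracts the complement onto the complex plane
  with finitely many punctures. Cutting that plane along rays that emanate from a generic centre
  leaves a starlike set; recording the crossings of the rays glues copies of the pieces to the
  universal cover, whose sheets are indexed by reduced words, and the holonomy of this cover is an
  isomorphism onto the free group on the punctures.

  If the codimension is at least three, a torus near a generic point of the intersection of two of
  the hyperplanes provides two commuting loops. Two integral characters, given by winding numbers,
  separate them in the sense that their determinant on this pair is nonzero, which is impossible for
  a commuting pair in a free group.
\<close>

section \<open>Local systems of sets\<close>

text \<open>With \<open>CARD('k) = m + 3\<close> the dimension condition says that the common kernel
  of the forms has codimension at most two. The threshold lies there because a form becomes a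
  function on the complement only after division by another form. Two independent forms give two
  independent quotients near a common zero if a third form does not vanish on their common kernel,
  and such a form exists exactly beyond codimension two. Up to codimension two, one form serves as
  denominator, its hyperplane moves to infinity, and every other hyperplane becomes one puncture.

  The main work is to show that word loops exhaust the fundamental group of the punctured plane and
  that distinct reduced words stay distinct. One device serves both: lift a loop so that the lift
  ends in the empty word. Its value at time \<open>t\<close> is a word whose loop, preceded by a
  path from the point at time \<open>t\<close> to the centre, is homotopic to the rest of the given
  loop. The value at time \<open>0\<close> is the wanted word, and uniqueness of lifts makes it an
  invariant. The centre must be generic because two punctures in the same direction would have
  overlapping cuts.\<close>

text \<open>A sheet \<open>(V, \<sigma>)\<close> is a flat section over \<open>V\<close> of a covering whose fibres are all identified, not
  continuously, with the set \<open>M\<close>. This avoids constructing the total space as a topological space.\<close>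

locale local_system =
  fixes Sheets :: "('a::topological_space set \<times> ('a \<Rightarrow> 'm)) set"
    and S :: "'a set" and M :: "'m set"
  assumes open_sheet: "(V, \<sigma>) \<in> Sheets \<Longrightarrow> open V"
    and sheet_value: "(V, \<sigma>) \<in> Sheets \<Longrightarrow> z \<in> V \<Longrightarrow> \<sigma> z \<in> M"
    and sheets_cover: "z \<in> S \<Longrightarrow> \<exists>V. open V \<and> z \<in> V \<and> (\<forall>z'\<in>V. \<forall>m\<in>M. \<exists>\<sigma>. (V, \<sigma>) \<in> Sheets \<and> \<sigma> z' = m)"
    and sheets_agree: "(V, \<sigma>) \<in> Sheets \<Longrightarrow> (V', \<sigma>') \<in> Sheets \<Longrightarrow> connected C \<Longrightarrow> C \<subseteq> V \<inter> V' \<Longrightarrow>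
      y \<in> C \<Longrightarrow> z \<in> C \<Longrightarrow> \<sigma> y = \<sigma>' y \<Longrightarrow> \<sigma> z = \<sigma>' z"
begin

text \<open>Continuity of \<open>g\<close> as a map over \<open>q\<close> into the would-be total
  space, expressed without that space: near each parameter \<open>g\<close> follows a single
  sheet.\<close>

definition lift :: "('b::real_normed_vector \<Rightarrow> 'a) \<Rightarrow> 'b set \<Rightarrow> ('b \<Rightarrow> 'm) \<Rightarrow> bool" where
  "lift q T g \<longleftrightarrow> (\<forall>t\<in>T. \<exists>V \<sigma> e. (V, \<sigma>) \<in> Sheets \<and> e > 0 \<and> (\<forall>s\<in>T \<inter> ball t e. q s \<in> V \<and> g s = \<sigma> (q s)))"

lemma lift_value: "lift q T g \<Longrightarrow> t \<in> T \<Longrightarrow> g t \<in> M"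
  unfolding lift_def by (metis IntI centre_in_ball sheet_value)

lemma lift_cong: "lift q T g \<Longrightarrow> (\<And>t. t \<in> T \<Longrightarrow> q t = q' t) \<Longrightarrow> (\<And>t. t \<in> T \<Longrightarrow> g t = g' t) \<Longrightarrow> lift q' T g'"
  unfolding lift_def by (metis IntD1)

lemma lift_compose:
  assumes "lift q T g" "continuous_on T' f" "f ` T' \<subseteq> T"
  shows "lift (q \<circ> f) T' (g \<circ> f)"
  unfolding lift_def
proof
  fix t assume t: "t \<in> T'"
  then have "f t \<in> T" using assms(3) by blast
  then obtain V \<sigma> e where V: "(V, \<sigma>) \<in> Sheets" "e > 0"
      and g: "\<And>s. s \<in> T \<inter> ball (f t) e \<Longrightarrow> q s \<in> V \<and> g s = \<sigma> (q s)"
    using assms(1) unfolding lift_def by meson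
  obtain d where "d > 0" "\<And>s. s \<in> T' \<Longrightarrow> dist s t < d \<Longrightarrow> dist (f s) (f t) < e"
    using assms(2) V(2) t unfolding continuous_on_iff by blast
  then have "f s \<in> T \<inter> ball (f t) e" if "s \<in> T' \<inter> ball t d" for s
    using assms(3) that by (simp add: dist_commute image_subset_iff)
  then have "\<forall>s\<in>T' \<inter> ball t d. (q \<circ> f) s \<in> V \<and> (g \<circ> f) s = \<sigma> ((q \<circ> f) s)"
    using g by simp
  then show "\<exists>V \<sigma> e. (V, \<sigma>) \<in> Sheets \<and> e > 0 \<and> (\<forall>s\<in>T' \<inter> ball t e. (q \<circ> f) s \<in> V \<and> (g \<circ> f) s = \<sigma> ((q \<circ> f) s))"
    using V \<open>d > 0\<close> by blast
qed

text \<open>The map \<open>q\<close> sends the convex set \<open>T \<inter> ball t d\<close> onto a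
  connected set inside \<open>V \<inter> V'\<close>, and on such a set \<open>sheets_agree\<close>
  allows agreement only everywhere or nowhere.\<close>

lemma sheets_agree_near:
  fixes T :: "'b::real_normed_vector set"
  assumes "convex T" "continuous_on T q" "t \<in> T" "(V, \<sigma>) \<in> Sheets" "(V', \<sigma>') \<in> Sheets" "q t \<in> V" "q t \<in> V'"
  obtains d where "d > 0" "\<And>s. s \<in> T \<inter> ball t d \<Longrightarrow> q s \<in> V \<inter> V'"
    "\<And>s s'. s \<in> T \<inter> ball t d \<Longrightarrow> s' \<in> T \<inter> ball t d \<Longrightarrow> \<sigma> (q s) = \<sigma>' (q s) \<longleftrightarrow> \<sigma> (q s') = \<sigma>' (q s')"
proof -
  have "open (V \<inter> V')" using assms open_sheet by blast
  then obtain W where W: "open W" "W \<inter> T = q -` (V \<inter> V') \<inter> T"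
    using assms(2) unfolding continuous_on_open_invariant by metis
  moreover have "t \<in> W" using W assms by blast
  ultimately obtain d where d: "d > 0" "ball t d \<subseteq> W" by (meson openE)
  have "connected (T \<inter> ball t d)"
    using assms(1) by (intro convex_connected convex_Int convex_ball)
  then have conn: "connected (q ` (T \<inter> ball t d))"
    by (intro connected_continuous_image continuous_on_subset[OF assms(2)]) auto
  have sub: "q ` (T \<inter> ball t d) \<subseteq> V \<inter> V'" using d W by blast
  show thesis
  proof (rule that[OF d(1)])
    show "q s \<in> V \<inter> V'" if "s \<in> T \<inter> ball t d" for s using sub that by blast
    show "\<sigma> (q s) = \<sigma>' (q s) \<longleftrightarrow> \<sigma> (q s') = \<sigma>' (q s')" if "s \<in> T \<inter> ball t d" "s' \<in> T \<inter> ball t d" for s s'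
      using sheets_agree[OF assms(4,5) conn sub] that by blast
  qed
qed

text \<open>Agreement of the two lifts is a locally constant truth value by
  \<open>sheets_agree_near\<close>, hence constant on the connected set \<open>T\<close>.\<close>

lemma lift_unique:
  assumes T: "convex T" "continuous_on T q" and g: "lift q T g" "lift q T g'"
    and "t \<in> T" "g t = g' t" "u \<in> T"
  shows "g u = g' u"
proof -
  have "(g t = g' t) = (g u = g' u)"
  proof (rule connected_local_const[where f = "\<lambda>s. g s = g' s" and A = T])
    show "\<forall>a\<in>T. eventually (\<lambda>b. (g a = g' a) = (g b = g' b)) (at a within T)"
    proof
      fix a assume a: "a \<in> T"
      obtain V \<sigma> e where V: "(V, \<sigma>) \<in> Sheets" "e > 0" "\<And>s. s \<in> T \<inter> ball a e \<Longrightarrow> q s \<in> V \<and> g s = \<sigma> (q s)"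
        using g(1) a unfolding lift_def by meson
      obtain V' \<sigma>' e' where V': "(V', \<sigma>') \<in> Sheets" "e' > 0" "\<And>s. s \<in> T \<inter> ball a e' \<Longrightarrow> q s \<in> V' \<and> g' s = \<sigma>' (q s)"
        using g(2) a unfolding lift_def by meson
      have "q a \<in> V" "q a \<in> V'" using V V' a by auto
      then obtain d where d: "d > 0"
        "\<And>s s'. s \<in> T \<inter> ball a d \<Longrightarrow> s' \<in> T \<inter> ball a d \<Longrightarrow> \<sigma> (q s) = \<sigma>' (q s) \<longleftrightarrow> \<sigma> (q s') = \<sigma>' (q s')"
        using sheets_agree_near[OF T a V(1) V'(1)] by metis
      show "eventually (\<lambda>b. (g a = g' a) = (g b = g' b)) (at a within T)"
        unfolding eventually_at
      proof (intro exI[of _ "min d (min e e')"] conjI ballI impI)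
        fix b assume "b \<in> T" "b \<noteq> a \<and> dist b a < min d (min e e')"
        then show "(g a = g' a) = (g b = g' b)"
          using d(2)[of a b] V(3)[of a] V(3)[of b] V'(3)[of a] V'(3)[of b] a d(1) V(2) V'(2)
          by (simp add: dist_commute)
      qed (use d V V' in auto)
    qed
  qed (use assms convex_connected in auto)
  then show ?thesis using assms by simp
qed

text \<open>Agreement at the single point \<open>a\<close> spreads over the convex set
  \<open>A \<inter> B\<close> by \<open>lift_unique\<close>. Two sheets compete only at points of
  \<open>A \<inter> B\<close>, and there convexity of \<open>A \<union> B\<close> lets one of them
  serve both pieces.\<close>

lemma lift_glue:
  assumes A: "closed A" "convex A" "lift q A g" and B: "closed B" "convex B" "lift q B g'"
    and T: "convex (A \<union> B)" "continuous_on (A \<union> B) q" and a: "a \<in> A" "a \<in> B" "g a = g' a"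
  shows "lift q (A \<union> B) (\<lambda>t. if t \<in> A then g t else g' t)" (is "lift q _ ?h")
  unfolding lift_def
proof
  have eq: "g t = g' t" if "t \<in> A" "t \<in> B" for t
  proof (rule lift_unique[where T = "A \<inter> B" and q = q and t = a])
    show "lift q (A \<inter> B) g" "lift q (A \<inter> B) g'"
      using lift_compose[OF A(3), of "A \<inter> B" id] lift_compose[OF B(3), of "A \<inter> B" id] by simp_all
    show "continuous_on (A \<inter> B) q" using T(2) by (rule continuous_on_subset) auto
  qed (use that a A B convex_Int in auto)
  fix t assume t: "t \<in> A \<union> B"
  \<comment> \<open>Closedness of the other piece leaves a ball around \<open>t\<close> in which
    only one of the two lifts is seen.\<close>
  have far: "\<exists>V \<sigma> e. (V, \<sigma>) \<in> Sheets \<and> e > 0 \<and> (\<forall>s\<in>(X \<union> Y) \<inter> ball t e. q s \<in> V \<and> h s = \<sigma> (q s))"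
    if XY: "closed Y" "lift q X h" "t \<in> X" "t \<notin> Y" for X Y h
  proof -
    obtain V \<sigma> e where V: "(V, \<sigma>) \<in> Sheets" "e > 0" "\<And>s. s \<in> X \<inter> ball t e \<Longrightarrow> q s \<in> V \<and> h s = \<sigma> (q s)"
      using XY(2,3) unfolding lift_def by meson
    have "open (- Y)" "t \<in> - Y" using XY by auto
    then obtain d where "d > 0" "ball t d \<subseteq> - Y" by (meson openE)
    then have d: "d > 0" "ball t d \<inter> Y = {}" by auto
    show ?thesis
      by (rule exI[of _ V], rule exI[of _ \<sigma>], rule exI[of _ "min e d"]) (use V d in auto)
  qed
  consider "t \<in> A" "t \<notin> B" | "t \<in> B" "t \<notin> A" | "t \<in> A" "t \<in> B" using t by blast
  then show "\<exists>V \<sigma> e. (V, \<sigma>) \<in> Sheets \<and> e > 0 \<and> (\<forall>s\<in>(A \<union> B) \<inter> ball t e. q s \<in> V \<and> ?h s = \<sigma> (q s))"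
  proof cases
    case 1
    have "lift q A ?h" by (rule lift_cong[OF A(3)]) auto
    from far[OF B(1) this 1] show ?thesis .
  next
    case 2
    have "lift q B ?h" by (rule lift_cong[OF B(3)]) (auto simp: eq)
    from far[OF A(1) this 2] show ?thesis by (simp add: Un_commute)
  next
    case 3
    obtain V \<sigma> e where V: "(V, \<sigma>) \<in> Sheets" "e > 0" "\<And>s. s \<in> A \<inter> ball t e \<Longrightarrow> q s \<in> V \<and> g s = \<sigma> (q s)"
      using A 3 unfolding lift_def by meson
    obtain V' \<sigma>' e' where V': "(V', \<sigma>') \<in> Sheets" "e' > 0" "\<And>s. s \<in> B \<inter> ball t e' \<Longrightarrow> q s \<in> V' \<and> g' s = \<sigma>' (q s)"
      using B 3 unfolding lift_def by meson
    have q: "q t \<in> V" "q t \<in> V'" and gt: "\<sigma> (q t) = \<sigma>' (q t)"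
      using V(2) V(3)[of t] V'(2) V'(3)[of t] 3 eq by auto
    obtain d where d: "d > 0" "\<And>s. s \<in> (A \<union> B) \<inter> ball t d \<Longrightarrow> q s \<in> V \<inter> V'"
        "\<And>s s'. s \<in> (A \<union> B) \<inter> ball t d \<Longrightarrow> s' \<in> (A \<union> B) \<inter> ball t d \<Longrightarrow> \<sigma> (q s) = \<sigma>' (q s) \<longleftrightarrow> \<sigma> (q s') = \<sigma>' (q s')"
      using sheets_agree_near[OF T t V(1) V'(1) q] by metis
    show ?thesis
    proof (rule exI[of _ V], rule exI[of _ \<sigma>], rule exI[of _ "min d (min e e')"], intro conjI ballI)
      fix s assume s: "s \<in> (A \<union> B) \<inter> ball t (min d (min e e'))"
      then have "\<sigma> (q s) = \<sigma>' (q s)" using d(3)[of t s] gt t d(1) by simp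
      then show "?h s = \<sigma> (q s)" using s V(3)[of s] V'(3)[of s] by auto
      show "q s \<in> V" using s d(2)[of s] by auto
    qed (use d V V' in auto)
  qed
qed

lemma lift_within_sheet:
  assumes "(V, \<sigma>) \<in> Sheets" "\<And>t. t \<in> T \<Longrightarrow> q t \<in> V"
  shows "lift q T (\<sigma> \<circ> q)"
  unfolding lift_def using assms by (auto intro!: exI[of _ V] exI[of _ \<sigma>] exI[of _ "1::real"])

text \<open>The value may be prescribed at any point of \<open>T\<close>, not just at a fixed one,
  so that an extension can start in either piece of a union.\<close>

definition liftable :: "('b::real_normed_vector \<Rightarrow> 'a) \<Rightarrow> 'b set \<Rightarrow> bool" where
  "liftable q T \<longleftrightarrow> (\<forall>t\<in>T. \<forall>m\<in>M. \<exists>g. lift q T g \<and> g t = m)"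

lemma liftable_Un:
  assumes A: "closed A" "convex A" "liftable q A" and B: "closed B" "convex B" "liftable q B"
    and T: "convex (A \<union> B)" "continuous_on (A \<union> B) q" and a: "a \<in> A" "a \<in> B"
  shows "liftable q (A \<union> B)"
  unfolding liftable_def
proof (intro ballI)
  fix t m assume t: "t \<in> A \<union> B" and m: "m \<in> M"
  have ext: "\<exists>h. lift q (X \<union> Y) h \<and> h t = m"
    if X: "closed X" "convex X" "liftable q X" and Y: "closed Y" "convex Y" "liftable q Y"
      and XY: "convex (X \<union> Y)" "continuous_on (X \<union> Y) q" "a \<in> X" "a \<in> Y" "t \<in> X" for X Y
  proof -
    obtain g where g: "lift q X g" "g t = m" using X XY m unfolding liftable_def by blast
    obtain g' where g': "lift q Y g'" "g' a = g a"
      using Y XY lift_value[OF g(1)] unfolding liftable_def by blast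
    show ?thesis
      using lift_glue[OF X(1,2) g(1) Y(1,2) g'(1) XY(1-4)] g g' XY(5) by auto
  qed
  from t show "\<exists>h. lift q (A \<union> B) h \<and> h t = m"
  proof
    assume "t \<in> A"
    then show ?thesis using ext[OF A B T a] by blast
  next
    assume "t \<in> B"
    moreover have "convex (B \<union> A)" "continuous_on (B \<union> A) q" using T by (simp_all add: Un_commute)
    ultimately show ?thesis using ext[OF B A _ _ a(2,1)] by (simp add: Un_commute)
  qed
qed

text \<open>Two nested bisections replace a grid: the first, in the second coordinate, makes thin
  strips of full height liftable, and the second joins the strips. Adjacent pieces share a point, as
  \<open>liftable_Un\<close> requires.\<close>

lemma liftable_rectangle:
  fixes q :: "real \<times> real \<Rightarrow> 'a"
  assumes q: "continuous_on ({a..b} \<times> {c..d}) q" "q ` ({a..b} \<times> {c..d}) \<subseteq> S" and "a \<le> b" "c \<le> d"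
  shows "liftable q ({a..b} \<times> {c..d})"
proof -
  have small: "\<exists>e>0. \<forall>a' b' c' d'. a \<le> a' \<and> b' \<le> b \<and> c \<le> c' \<and> d' \<le> d \<and> a' \<le> x \<and> x \<le> b' \<and> c' \<le> y \<and> y \<le> d'
      \<and> b' - a' < e \<and> d' - c' < e \<longrightarrow> liftable q ({a'..b'} \<times> {c'..d'})"
    if xy: "x \<in> {a..b}" "y \<in> {c..d}" for x y
  proof -
    have "q (x, y) \<in> S" using q xy by blast
    then obtain V where V: "open V" "q (x, y) \<in> V" "\<And>z m. z \<in> V \<Longrightarrow> m \<in> M \<Longrightarrow> \<exists>\<sigma>. (V, \<sigma>) \<in> Sheets \<and> \<sigma> z = m"
      using sheets_cover by meson
    obtain W where W: "open W" "W \<inter> ({a..b} \<times> {c..d}) = q -` V \<inter> ({a..b} \<times> {c..d})"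
      using q(1) V(1) unfolding continuous_on_open_invariant by metis
    have "(x, y) \<in> W" using W V xy by blast
    then obtain e where e: "e > 0" "ball (x, y) e \<subseteq> W" using W(1) by (meson openE)
    show ?thesis
    proof (intro exI[of _ "e/2"] conjI allI impI)
      fix a' b' c' d'
      assume bd: "a \<le> a' \<and> b' \<le> b \<and> c \<le> c' \<and> d' \<le> d \<and> a' \<le> x \<and> x \<le> b' \<and> c' \<le> y \<and> y \<le> d'
        \<and> b' - a' < e/2 \<and> d' - c' < e/2"
      have in_V: "q t \<in> V" if t: "t \<in> {a'..b'} \<times> {c'..d'}" for t
      proof -
        have "dist (x, y) t \<le> \<bar>x - fst t\<bar> + \<bar>y - snd t\<bar>"
          by (cases t) (simp add: dist_Pair_Pair dist_real_def sqrt_sum_squares_le_sum_abs)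
        also have "\<dots> < e" using bd t by auto
        finally have "t \<in> W" using e by auto
        then show ?thesis using W bd t by auto
      qed
      show "liftable q ({a'..b'} \<times> {c'..d'})"
        unfolding liftable_def
      proof (intro ballI)
        fix t m assume t: "t \<in> {a'..b'} \<times> {c'..d'}" "m \<in> M"
        then obtain \<sigma> where "(V, \<sigma>) \<in> Sheets" "\<sigma> (q t) = m" using V(3) in_V by blast
        then show "\<exists>g. lift q ({a'..b'} \<times> {c'..d'}) g \<and> g t = m"
          using lift_within_sheet[of V \<sigma> _ q] in_V by (intro exI[of _ "\<sigma> \<circ> q"]) auto
      qed
    qed (use e in auto)
  qed
  have column: "\<exists>e>0. \<forall>a' b'. a \<le> a' \<and> b' \<le> b \<and> a' \<le> x \<and> x \<le> b' \<and> b' - a' < e \<longrightarrow> liftable q ({a'..b'} \<times> {c..d})"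
    if x: "x \<in> {a..b}" for x
  proof -
    \<comment> \<open>The bound on the width is quantified inside \<open>P\<close>, so that it may
      shrink whenever two intervals are joined.\<close>
    define P where "P = (\<lambda>c' d'. c \<le> c' \<and> d' \<le> d \<longrightarrow> (\<exists>e>0. \<forall>a' b'. a \<le> a' \<and> b' \<le> b \<and> a' \<le> x \<and> x \<le> b' \<and> b' - a' < e
      \<longrightarrow> liftable q ({a'..b'} \<times> {c'..d'})))"
    have "P c d"
      using \<open>c \<le> d\<close>
    proof (induct rule: Bolzano)
      case (trans u v w)
      show ?case unfolding P_def
      proof
        assume uw: "c \<le> u \<and> w \<le> d"
        then have "c \<le> u \<and> v \<le> d" "c \<le> v \<and> w \<le> d" using trans by auto
        then obtain e e' where e: "e > 0" "\<forall>a' b'. a \<le> a' \<and> b' \<le> b \<and> a' \<le> x \<and> x \<le> b' \<and> b' - a' < e \<longrightarrow> liftable q ({a'..b'} \<times> {u..v})"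
            and e': "e' > 0" "\<forall>a' b'. a \<le> a' \<and> b' \<le> b \<and> a' \<le> x \<and> x \<le> b' \<and> b' - a' < e' \<longrightarrow> liftable q ({a'..b'} \<times> {v..w})"
          using trans(1,2) unfolding P_def by blast
        show "\<exists>e>0. \<forall>a' b'. a \<le> a' \<and> b' \<le> b \<and> a' \<le> x \<and> x \<le> b' \<and> b' - a' < e \<longrightarrow> liftable q ({a'..b'} \<times> {u..w})"
        proof (intro exI[of _ "min e e'"] conjI allI impI)
          fix a' b' assume *: "a \<le> a' \<and> b' \<le> b \<and> a' \<le> x \<and> x \<le> b' \<and> b' - a' < min e e'"
          have un: "{a'..b'} \<times> {u..w} = {a'..b'} \<times> {u..v} \<union> {a'..b'} \<times> {v..w}"
            using trans by auto
          show "liftable q ({a'..b'} \<times> {u..w})"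
            unfolding un
          proof (rule liftable_Un)
            show "convex ({a'..b'} \<times> {u..v} \<union> {a'..b'} \<times> {v..w})"
              unfolding un[symmetric] by (intro convex_Times) auto
            show "continuous_on ({a'..b'} \<times> {u..v} \<union> {a'..b'} \<times> {v..w}) q"
              unfolding un[symmetric] by (rule continuous_on_subset[OF q(1)]) (use * uw in auto)
            show "liftable q ({a'..b'} \<times> {u..v})" "liftable q ({a'..b'} \<times> {v..w})"
              using e e' * by auto
            show "(x, v) \<in> {a'..b'} \<times> {u..v}" "(x, v) \<in> {a'..b'} \<times> {v..w}"
              using * trans by auto
          qed (auto intro!: closed_Times convex_Times)
        qed (use e e' in auto)
      qed
    next
      case (local y)
      then obtain e where "e > 0" "\<And>a' b' c' d'. a \<le> a' \<and> b' \<le> b \<and> c \<le> c' \<and> d' \<le> d \<and> a' \<le> x \<and> x \<le> b' \<and> c' \<le> y \<and> y \<le> d'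
          \<and> b' - a' < e \<and> d' - c' < e \<Longrightarrow> liftable q ({a'..b'} \<times> {c'..d'})"
        using small[OF x, of y] by auto
      then show ?case unfolding P_def by (intro exI[of _ e]) auto
    qed
    then show ?thesis unfolding P_def by simp
  qed
  define P where "P = (\<lambda>a' b'. a \<le> a' \<and> b' \<le> b \<longrightarrow> liftable q ({a'..b'} \<times> {c..d}))"
  have "P a b"
    using \<open>a \<le> b\<close>
  proof (induct rule: Bolzano)
    case (trans u v w)
    have un: "{u..w} \<times> {c..d} = {u..v} \<times> {c..d} \<union> {v..w} \<times> {c..d}"
      using trans by auto
    show ?case unfolding P_def
    proof
      assume uw: "a \<le> u \<and> w \<le> b"
      show "liftable q ({u..w} \<times> {c..d})"
        unfolding un
      proof (rule liftable_Un)
        show "convex ({u..v} \<times> {c..d} \<union> {v..w} \<times> {c..d})"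
          unfolding un[symmetric] by (intro convex_Times) auto
        show "continuous_on ({u..v} \<times> {c..d} \<union> {v..w} \<times> {c..d}) q"
          unfolding un[symmetric] by (rule continuous_on_subset[OF q(1)]) (use uw in auto)
        show "liftable q ({u..v} \<times> {c..d})" "liftable q ({v..w} \<times> {c..d})"
          using uw trans by (auto simp: P_def)
        show "(v, c) \<in> {u..v} \<times> {c..d}" "(v, c) \<in> {v..w} \<times> {c..d}"
          using \<open>c \<le> d\<close> trans by auto
      qed (auto intro!: closed_Times convex_Times)
    qed
  next
    case (local x)
    then show ?case using column[of x] unfolding P_def by auto
  qed
  then show ?thesis unfolding P_def by simp
qed

text \<open>Transport runs from the end of the path to its start, so that with left multiplication on words
  the holonomy of a concatenation is the product in the same order.\<close>

definition holonomy :: "(real \<Rightarrow> 'a) \<Rightarrow> 'm \<Rightarrow> 'm \<Rightarrow> bool" where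
  "holonomy p v u \<longleftrightarrow> (\<exists>g. lift p {0..1} g \<and> g 0 = u \<and> g 1 = v)"

lemma holonomy_unique: "path p \<Longrightarrow> holonomy p v u \<Longrightarrow> holonomy p v u' \<Longrightarrow> u = u'"
  unfolding holonomy_def path_def using lift_unique[of "{0..1}" p _ _ 1 0] by fastforce

text \<open>The path is regarded as a map on the square that ignores the first coordinate, which
  reduces the claim to \<open>liftable_rectangle\<close>.\<close>

lemma path_lift:
  assumes "path p" "path_image p \<subseteq> S" "v \<in> M"
  obtains g where "lift p {0..1} g" "g 1 = v"
proof -
  have "liftable (p \<circ> snd) ({0..1::real} \<times> {0..1})"
    using assms by (intro liftable_rectangle continuous_on_compose[OF continuous_on_snd[OF continuous_on_id]])
      (auto simp: path_def path_image_def)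
  then obtain g where g: "lift (p \<circ> snd) ({0..1} \<times> {0..1}) g" "g (0::real, 1) = v"
    using assms(3) unfolding liftable_def by fastforce
  have "lift ((p \<circ> snd) \<circ> (\<lambda>t. (0::real, t))) {0..1} (g \<circ> (\<lambda>t. (0::real, t)))"
    by (rule lift_compose[OF g(1)]) (auto intro!: continuous_intros)
  moreover have "(p \<circ> snd) \<circ> (\<lambda>t. (0::real, t)) = p" by auto
  ultimately have "lift p {0..1} (g \<circ> (\<lambda>t. (0::real, t)))" by simp
  then show thesis by (rule that) (simp add: g)
qed

lemma holonomy_sheet:
  assumes "(V, \<sigma>) \<in> Sheets" "path_image p \<subseteq> V"
  shows "holonomy p (\<sigma> (pathfinish p)) (\<sigma> (pathstart p))"
proof -
  have "lift p {0..1} (\<sigma> \<circ> p)"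
    by (rule lift_within_sheet[OF assms(1)]) (use assms(2) in \<open>auto simp: path_image_def\<close>)
  then show ?thesis
    unfolding holonomy_def by (intro exI[of _ "\<sigma> \<circ> p"]) (simp add: pathfinish_def pathstart_def)
qed

lemma holonomy_reversepath:
  assumes "holonomy p v u"
  shows "holonomy (reversepath p) u v"
proof -
  obtain g where g: "lift p {0..1} g" "g 0 = u" "g 1 = v" using assms unfolding holonomy_def by blast
  have "lift (p \<circ> (-) 1) {0..1} (g \<circ> (-) 1)"
    by (rule lift_compose[OF g(1)]) (auto intro!: continuous_intros)
  moreover have "p \<circ> (-) 1 = reversepath p" by (auto simp: reversepath_def)
  ultimately show ?thesis unfolding holonomy_def using g by (intro exI[of _ "g \<circ> (-) 1"]) simp
qed

lemma holonomy_join: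
  assumes "path p" "path q" "pathfinish p = pathstart q" "holonomy q w v" "holonomy p v u"
  shows "holonomy (p +++ q) w u"
proof -
  obtain g where g: "lift p {0..1} g" "g 0 = u" "g 1 = v" using assms unfolding holonomy_def by blast
  obtain h where h: "lift q {0..1} h" "h 0 = v" "h 1 = w" using assms unfolding holonomy_def by blast
  define k where "k = (\<lambda>t::real. if t \<le> 1/2 then g (2 * t) else h (2 * t - 1))"
  have gh: "k t = g (2 * t)" if "t \<le> 1/2" for t using that by (simp add: k_def)
  have gh': "k t = h (2 * t - 1)" if "t \<ge> 1/2" for t
  proof (cases "t = 1/2")
    case True
    show ?thesis unfolding True using g h by (simp add: k_def)
  qed (use that in \<open>simp add: k_def\<close>)
  have pq: "(p +++ q) t = p (2 * t)" if "t \<le> 1/2" for t using that by (simp add: joinpaths_def)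
  have pq': "(p +++ q) t = q (2 * t - 1)" if "t \<ge> 1/2" for t
  proof (cases "t = 1/2")
    case True
    show ?thesis unfolding True using assms(3) by (simp add: joinpaths_def pathstart_def pathfinish_def)
  qed (use that in \<open>simp add: joinpaths_def\<close>)
  have 1: "lift (p +++ q) {0..1/2} k"
    by (rule lift_cong[OF lift_compose[OF g(1), of _ "\<lambda>t. 2 * t"]]) (auto simp: gh pq intro!: continuous_intros)
  have 2: "lift (p +++ q) {1/2..1} k"
    by (rule lift_cong[OF lift_compose[OF h(1), of _ "\<lambda>t. 2 * t - 1"]]) (auto simp: gh' pq' intro!: continuous_intros)
  have un: "{0..1/2} \<union> {1/2..1} = {0..1::real}" by auto
  have "path (p +++ q)" using assms by simp
  then have "continuous_on ({0..1/2} \<union> {1/2..1}) (p +++ q)" unfolding un path_def .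
  from lift_glue[OF _ _ 1 _ _ 2 _ this, of "1/2"] have "lift (p +++ q) {0..1} k"
    unfolding un by simp
  then show ?thesis unfolding holonomy_def using g h by (intro exI[of _ "k"]) (simp add: k_def)
qed

text \<open>The homotopy is lifted over the whole square. Along its two constant sides the lift is
  constant, so the lifts over both paths have the same initial and the same final value.\<close>

lemma holonomy_homotopic:
  assumes hom: "homotopic_paths S p q" and v: "holonomy p v u"
  shows "holonomy q v u"
proof -
  obtain h where h: "continuous_on ({0..1::real} \<times> {0..1::real}) h" "h ` ({0..1} \<times> {0..1}) \<subseteq> S"
      "\<And>x. x \<in> {0..1} \<Longrightarrow> h (0, x) = p x" "\<And>x. x \<in> {0..1} \<Longrightarrow> h (1, x) = q x"
      "\<And>t. t \<in> {0..1} \<Longrightarrow> h (t, 0) = p 0" "\<And>t. t \<in> {0..1} \<Longrightarrow> h (t, 1) = p 1"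
    using hom unfolding homotopic_paths by (auto simp: pathstart_def pathfinish_def image_subset_iff Pi_iff) 
  have v: "v \<in> M" "holonomy p v u" using v lift_value[of p "{0..1}" _ 1] unfolding holonomy_def by auto
  have "liftable h ({0..1} \<times> {0..1})"
    using h by (intro liftable_rectangle) auto
  then obtain g where g: "lift h ({0..1} \<times> {0..1}) g" "g (0::real, 1) = v"
    using v(1) unfolding liftable_def by fastforce
  have edge: "lift k {0..1} (\<lambda>t. g (f t))" if "continuous_on {0..1} f" "f ` {0..1} \<subseteq> {0..1} \<times> {0..1}"
      "\<And>t. t \<in> {0..1} \<Longrightarrow> h (f t) = k t" for f :: "real \<Rightarrow> real \<times> real" and k
    by (rule lift_cong[OF lift_compose[OF g(1) that(1,2)]]) (use that in auto)
  have const: "g (1, i) = g (0, i)" if i: "i \<in> {0, 1}" for i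
  proof -
    have k: "lift (\<lambda>_. p i) {0..1} (\<lambda>t. g (t, i))"
      by (rule edge) (use h i in \<open>auto intro!: continuous_intros\<close>)
    then obtain V \<sigma> where V: "(V, \<sigma>) \<in> Sheets" "p i \<in> V" "g (0, i) = \<sigma> (p i)"
      unfolding lift_def by (meson IntI atLeastAtMost_iff centre_in_ball order_refl zero_le_one)
    have "lift (\<lambda>_. p i) {0..1::real} (\<sigma> \<circ> (\<lambda>_. p i))"
      by (rule lift_within_sheet[OF V(1)]) (use V in auto)
    from lift_unique[OF _ _ k this, of 0 1] V show ?thesis by auto
  qed
  have "lift p {0..1} (\<lambda>t. g (0, t))"
    by (rule edge) (use h in \<open>auto intro!: continuous_intros\<close>)
  then have "holonomy p v (g (0, 0))" unfolding holonomy_def using g by (intro exI[of _ "\<lambda>t. g (0, t)"]) simp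
  then have u: "g (0, 0) = u" using holonomy_unique[OF _ _ v(2)] homotopic_paths_imp_path[OF hom] by blast
  have "lift q {0..1} (\<lambda>t. g (1, t))"
    by (rule edge) (use h in \<open>auto intro!: continuous_intros\<close>)
  then show ?thesis unfolding holonomy_def using g const[of 0] const[of 1] u by (intro exI[of _ "\<lambda>t. g (1, t)"]) simp
qed

end

section \<open>Free groups and fundamental groups\<close>

lemma free_group_carrier: "w \<in> carrier (free_group X) \<longleftrightarrow> set w \<subseteq> X \<times> UNIV \<and> reduced w"
  by (simp add: free_group_def)

lemma free_group_mult: "u \<otimes>\<^bsub>free_group X\<^esub> v = foldr reduced_Cons u v"
  by (simp add: free_group_def)

lemma free_group_iso_image:
  fixes X :: "'a set"
  assumes f: "inj_on f X"
  shows "free_group X \<cong> free_group (f ` X)"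
proof (rule is_isoI)
  define g where "g = (\<lambda>a :: 'a \<times> bool. (f (fst a), snd a))"
  have g: "inj_on g (X \<times> UNIV)" using f by (auto simp: inj_on_def g_def)
  have image: "g ` (X \<times> UNIV) = f ` X \<times> UNIV" by (force simp: g_def)
  have inv: "g (inv_letter a) = inv_letter (g a)" for a by (simp add: inv_letter_def g_def)
  have iff: "g b = inv_letter (g a) \<longleftrightarrow> b = inv_letter a" if "a \<in> X \<times> UNIV" "b \<in> X \<times> UNIV" for a b
    using inj_on_eq_iff[OF g that(2), of "inv_letter a"] that(1) inv by (auto simp: inv_letter_def)
  have red: "reduced (map g w) \<longleftrightarrow> reduced w" if "set w \<subseteq> X \<times> UNIV" for w
    unfolding reduced_def successively_map
    by (rule successively_cong) (use that iff in blast)+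
  have reduced_Cons: "reduced_Cons (g a) (map g w) = map g (reduced_Cons a w)"
    if "a \<in> X \<times> UNIV" "set w \<subseteq> X \<times> UNIV" for a w
    using that iff[of a] by (cases w) auto
  have mult: "foldr reduced_Cons (map g u) (map g v) = map g (foldr reduced_Cons u v)"
    if "set u \<subseteq> X \<times> UNIV" "set v \<subseteq> X \<times> UNIV" for u v
    using that
  proof (induction u)
    case (Cons a u)
    moreover have "set (foldr reduced_Cons u v) \<subseteq> X \<times> UNIV" using set_foldr[of u v] Cons.prems by auto
    ultimately show ?case using reduced_Cons[of a] by simp
  qed simp
  show "map g \<in> iso (free_group X) (free_group (f ` X))"
    unfolding iso_def
  proof (intro CollectI conjI homI bij_betw_imageI)
    show "map g w \<in> carrier (free_group (f ` X))" if "w \<in> carrier (free_group X)" for w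
      using that red image by (fastforce simp: free_group_carrier)
    show "map g (u \<otimes>\<^bsub>free_group X\<^esub> v) = map g u \<otimes>\<^bsub>free_group (f ` X)\<^esub> map g v"
      if "u \<in> carrier (free_group X)" "v \<in> carrier (free_group X)" for u v
      using that mult by (simp add: free_group_carrier free_group_mult)
    show "inj_on (map g) (carrier (free_group X))"
    proof (rule inj_onI)
      fix u v assume uv: "u \<in> carrier (free_group X)" "v \<in> carrier (free_group X)" "map g u = map g v"
      then have "inj_on g (set u \<union> set v)"
        using g by (auto simp: free_group_carrier intro: inj_on_subset)
      then show "u = v" using uv(3) by (simp add: inj_on_map_eq_map)
    qed
    show "map g ` carrier (free_group X) = carrier (free_group (f ` X))"
    proof (intro equalityI subsetI)
      fix w assume w: "w \<in> carrier (free_group (f ` X))"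
      then have "w \<in> lists (g ` (X \<times> UNIV))" unfolding image free_group_carrier by (auto simp: in_lists_conv_set)
      then obtain v where v: "set v \<subseteq> X \<times> UNIV" "w = map g v" unfolding lists_image by (auto simp: in_lists_conv_set subset_iff)
      then show "w \<in> map g ` carrier (free_group X)"
        using w red[OF v(1)] by (auto simp: free_group_carrier)
    qed (use red image in \<open>fastforce simp: free_group_carrier\<close>)
  qed
qed

text \<open>\<open>is_free_group\<close> wants generators in the type of the group elements, so each
  generator is replaced by its image under the isomorphism, which is injective on one-letter
  words.\<close>

lemma is_free_groupI:
  fixes X :: "'x set"
  assumes "group G" and iso: "free_group X \<cong> G"
  shows "is_free_group G"
proof -
  obtain h where h: "h \<in> iso (free_group X) G" using iso by (auto simp: is_iso_def)
  have "[(x, True)] \<in> carrier (free_group X)" if "x \<in> X" for x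
    using that by (simp add: free_group_carrier reduced_def)
  then have "inj_on (\<lambda>x. h [(x, True)]) X"
    using h unfolding iso_def bij_betw_def inj_on_def by blast
  then have "free_group X \<cong> free_group ((\<lambda>x. h [(x, True)]) ` X)" by (rule free_group_iso_image)
  then have "G \<cong> free_group ((\<lambda>x. h [(x, True)]) ` X)"
    using group.iso_sym[OF group_free_group iso] iso_trans by blast
  then show ?thesis using assms unfolding is_free_group_def by blast
qed

lemma is_free_group_iso:
  fixes G :: "('g, 'b) monoid_scheme"
  assumes "is_free_group G" "G \<cong> H" "group H"
  shows "is_free_group H"
proof -
  obtain X :: "'g set" where X: "group G" "G \<cong> free_group X" using assms(1) unfolding is_free_group_def by blast
  then have "free_group X \<cong> H" using group.iso_sym assms(2) iso_trans by blast
  then show ?thesis by (rule is_free_groupI[OF assms(3)])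
qed

text \<open>The cup product of two homomorphisms to the additive group of a field is the coboundary of a
  function \<open>\<theta>\<close>, because a free group has no second cohomology; being symmetric on commuting pairs is
  then immediate.\<close>

lemma free_group_commuting:
  fixes \<phi> \<psi> :: "('x \<times> bool) list \<Rightarrow> 'f::field"
  assumes \<phi>: "\<And>u v. u \<in> carrier (free_group X) \<Longrightarrow> v \<in> carrier (free_group X) \<Longrightarrow> \<phi> (u \<otimes>\<^bsub>free_group X\<^esub> v) = \<phi> u + \<phi> v"
    and \<psi>: "\<And>u v. u \<in> carrier (free_group X) \<Longrightarrow> v \<in> carrier (free_group X) \<Longrightarrow> \<psi> (u \<otimes>\<^bsub>free_group X\<^esub> v) = \<psi> u + \<psi> v"
    and uv: "u \<in> carrier (free_group X)" "v \<in> carrier (free_group X)" "u \<otimes>\<^bsub>free_group X\<^esub> v = v \<otimes>\<^bsub>free_group X\<^esub> u"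
  shows "\<phi> u * \<psi> v = \<phi> v * \<psi> u"
proof -
  let ?F = "carrier (free_group X)"
  \<comment> \<open>Cancelling a letter against its inverse must not change \<open>\<theta>\<close>.
    This forces \<open>e a + e (inv_letter a) = \<phi> [a] * \<psi> [a]\<close>; the value
    \<open>0\<close> on generators is a normalisation.\<close>
  define e where "e = (\<lambda>a. if snd a then 0 else \<phi> [(fst a, True)] * \<psi> [(fst a, True)])"
  define \<theta> where "\<theta> = rec_list 0 (\<lambda>a w t. t + e a + \<phi> [a] * \<psi> w)"
  have \<theta>: "\<theta> [] = 0" "\<And>a w. \<theta> (a # w) = \<theta> w + e a + \<phi> [a] * \<psi> w" by (simp_all add: \<theta>_def)
  have Nil: "[] \<in> ?F" by (simp add: free_group_carrier reduced_def)
  have zero: "\<phi> [] = 0" "\<psi> [] = 0"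
    using \<phi>[OF Nil Nil] \<psi>[OF Nil Nil] unfolding free_group_mult foldr.simps id_apply
    by (metis add_cancel_right_right)+
  have letter: "[a] \<in> ?F" if "fst a \<in> X" for a
    using that by (auto simp: free_group_carrier reduced_def mem_Times_iff)
  have ConsD: "fst a \<in> X" "w \<in> ?F" if "a # w \<in> ?F" for a w
    using that by (auto simp: free_group_carrier reduced_def successively_Cons)
  have red_Cons: "\<phi> (reduced_Cons a w) = \<phi> [a] + \<phi> w" "\<psi> (reduced_Cons a w) = \<psi> [a] + \<psi> w"
    if "fst a \<in> X" "w \<in> ?F" for a w
    using \<phi>[OF letter[OF that(1)] that(2)] \<psi>[OF letter[OF that(1)] that(2)] by (simp_all add: free_group_mult)
  have Cons: "\<phi> (a # w) = \<phi> [a] + \<phi> w" "\<psi> (a # w) = \<psi> [a] + \<psi> w" if "a # w \<in> ?F" for a w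
  proof -
    have "reduced_Cons a w = a # w"
      using that by (cases w) (auto simp: free_group_carrier reduced_def)
    then show "\<phi> (a # w) = \<phi> [a] + \<phi> w" "\<psi> (a # w) = \<psi> [a] + \<psi> w"
      using red_Cons[OF ConsD[OF that]] by simp_all
  qed
  have inv: "\<phi> [inv_letter a] = - \<phi> [a]" "\<psi> [inv_letter a] = - \<psi> [a]" if "fst a \<in> X" for a
    using red_Cons[OF that letter[of "inv_letter a"]] that zero
    by (simp_all add: inv_letter_def add_eq_0_iff)
  have e: "e a + e (inv_letter a) = \<phi> [a] * \<psi> [a]" if "fst a \<in> X" for a
  proof -
    obtain x b where a: "a = (x, b)" by (cases a)
    show ?thesis
      using inv[of "(x, True)"] that unfolding a by (cases b) (simp_all add: e_def inv_letter_def)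
  qed
  \<comment> \<open>The recursion for \<open>\<theta>\<close> survives reduction: without
    cancellation it is the definition, and with cancellation it is the identity
    \<open>e\<close>.\<close>
  have \<theta>_reduced_Cons: "\<theta> (reduced_Cons a w) = \<theta> w + e a + \<phi> [a] * \<psi> w" if a: "fst a \<in> X" and w: "w \<in> ?F" for a w
  proof (cases "\<exists>v. w = inv_letter a # v")
    case True
    then obtain v where v: "w = inv_letter a # v" by blast
    have "\<psi> w = \<psi> v - \<psi> [a]" using Cons(2)[of "inv_letter a" v] w inv[OF a] by (simp add: v)
    then have "\<theta> w + e a + \<phi> [a] * \<psi> w = \<theta> v + e a + e (inv_letter a) - \<phi> [a] * \<psi> [a]"
      using \<theta>(2)[of "inv_letter a" v] inv[OF a] by (simp only: v[symmetric]) (simp add: algebra_simps)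
    then show ?thesis using e[OF a] by (simp add: v add.assoc)
  next
    case False
    then have "reduced_Cons a w = a # w" by (cases w) auto
    then show ?thesis by (simp add: \<theta>)
  qed
  have mult: "\<theta> (u \<otimes>\<^bsub>free_group X\<^esub> v) = \<theta> u + \<theta> v + \<phi> u * \<psi> v" if "u \<in> ?F" "v \<in> ?F" for u v
    using that(1)
  proof (induction u)
    case Nil
    then show ?case by (simp add: free_group_mult zero \<theta>)
  next
    case (Cons a u)
    note au = ConsD[OF Cons.prems]
    have uv: "u \<otimes>\<^bsub>free_group X\<^esub> v \<in> ?F"
      using au that(2) by (simp add: group.is_monoid[OF group_free_group] monoid.m_closed)
    have "\<theta> ((a # u) \<otimes>\<^bsub>free_group X\<^esub> v) = \<theta> (u \<otimes>\<^bsub>free_group X\<^esub> v) + e a + \<phi> [a] * \<psi> (u \<otimes>\<^bsub>free_group X\<^esub> v)"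
      using \<theta>_reduced_Cons[OF au(1) uv] by (simp add: free_group_mult)
    then show ?case
      using Cons.IH[OF au(2)] \<psi>[OF au(2) that(2)] \<open>\<And>w a. a # w \<in> ?F \<Longrightarrow> \<phi> (a # w) = \<phi> [a] + \<phi> w\<close>[OF Cons.prems]
      by (simp add: \<theta> algebra_simps)
  qed
  \<comment> \<open>Both products have the same \<open>\<theta>\<close>; the symmetric part
    \<open>\<theta> u + \<theta> v\<close> cancels and the cross terms remain.\<close>
  show ?thesis using mult[OF uv(1,2)] mult[OF uv(2,1)] uv(3) by simp
qed

lemma is_free_group_commuting:
  fixes \<phi> \<psi> :: "'g \<Rightarrow> 'f::field"
  assumes free: "is_free_group G"
    and \<phi>: "\<And>u v. u \<in> carrier G \<Longrightarrow> v \<in> carrier G \<Longrightarrow> \<phi> (u \<otimes>\<^bsub>G\<^esub> v) = \<phi> u + \<phi> v"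
    and \<psi>: "\<And>u v. u \<in> carrier G \<Longrightarrow> v \<in> carrier G \<Longrightarrow> \<psi> (u \<otimes>\<^bsub>G\<^esub> v) = \<psi> u + \<psi> v"
    and uv: "u \<in> carrier G" "v \<in> carrier G" "u \<otimes>\<^bsub>G\<^esub> v = v \<otimes>\<^bsub>G\<^esub> u"
  shows "\<phi> u * \<psi> v = \<phi> v * \<psi> u"
proof -
  obtain X :: "'g set" where X: "group G" "G \<cong> free_group X" using free unfolding is_free_group_def by blast
  obtain h where h: "h \<in> iso (free_group X) G"
    using group.iso_sym[OF X] by (auto simp: is_iso_def)
  have hom: "h w \<in> carrier G" "h (w \<otimes>\<^bsub>free_group X\<^esub> w') = h w \<otimes>\<^bsub>G\<^esub> h w'" 
    if "w \<in> carrier (free_group X)" "w' \<in> carrier (free_group X)" for w w'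
    using h that by (auto simp: iso_def hom_def)
  obtain a b where ab: "a \<in> carrier (free_group X)" "h a = u" "b \<in> carrier (free_group X)" "h b = v"
  proof -
    have "u \<in> h ` carrier (free_group X)" "v \<in> h ` carrier (free_group X)"
      using h uv(1,2) by (auto simp: iso_def bij_betw_def)
    then show thesis using that by blast
  qed
  have "h (a \<otimes>\<^bsub>free_group X\<^esub> b) = h (b \<otimes>\<^bsub>free_group X\<^esub> a)" using hom ab uv(3) by simp
  moreover have "a \<otimes>\<^bsub>free_group X\<^esub> b \<in> carrier (free_group X)" "b \<otimes>\<^bsub>free_group X\<^esub> a \<in> carrier (free_group X)"
    using ab by (simp_all add: group.is_monoid[OF group_free_group] monoid.m_closed)
  ultimately have "a \<otimes>\<^bsub>free_group X\<^esub> b = b \<otimes>\<^bsub>free_group X\<^esub> a"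
    using h unfolding iso_def bij_betw_def inj_on_def by blast
  with ab have "(\<phi> \<circ> h) a * (\<psi> \<circ> h) b = (\<phi> \<circ> h) b * (\<psi> \<circ> h) a"
    by (intro free_group_commuting[where X = X]) (simp_all add: hom \<phi> \<psi>)
  then show ?thesis using ab by simp
qed

section \<open>Calculus of paths and isomorphisms of fundamental groups\<close>

lemma pathstart_finish_const [simp]: "pathstart (\<lambda>_. x) = x" "pathfinish (\<lambda>_. x) = x"
  by (simp_all add: pathstart_def pathfinish_def)

lemma homotopic_join_left:
  "homotopic_paths S p q \<Longrightarrow> path r \<Longrightarrow> path_image r \<subseteq> S \<Longrightarrow> pathfinish p = pathstart r \<Longrightarrow>
    homotopic_paths S (p +++ r) (q +++ r)"
  by (rule homotopic_paths_join) auto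

lemma homotopic_join_right:
  "homotopic_paths S p q \<Longrightarrow> path r \<Longrightarrow> path_image r \<subseteq> S \<Longrightarrow> pathfinish r = pathstart p \<Longrightarrow>
    homotopic_paths S (r +++ p) (r +++ q)"
  by (rule homotopic_paths_join) auto

lemma homotopic_join_assoc_left:
  "homotopic_paths S (p +++ q) u \<Longrightarrow> path p \<Longrightarrow> path q \<Longrightarrow> path_image p \<subseteq> S \<Longrightarrow> path_image q \<subseteq> S \<Longrightarrow>
    pathfinish p = pathstart q \<Longrightarrow> path r \<Longrightarrow> path_image r \<subseteq> S \<Longrightarrow> pathfinish q = pathstart r \<Longrightarrow>
    homotopic_paths S (p +++ (q +++ r)) (u +++ r)"
  by (rule homotopic_paths_trans[OF homotopic_paths_assoc homotopic_join_left]) auto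

text \<open>Reduces the unit and inverse laws to the unit interval: there two parameter paths are
  homotopic as soon as their ends agree, and \<open>p\<close> carries the homotopy into an arbitrary
  space.\<close>

lemma homotopic_paths_reparametrizations:
  assumes p: "path p" "path_image p \<subseteq> S" and ab: "homotopic_paths {0..1} a b"
  shows "homotopic_paths S (p \<circ> a) (p \<circ> b)"
  using p by (intro homotopic_paths_continuous_image[OF ab]) (auto simp: path_def path_image_def)

lemma compose_linepath:
  fixes p :: "real \<Rightarrow> 'a::topological_space"
  shows "p \<circ> linepath 0 1 = p" "p \<circ> linepath 1 0 = reversepath p" "p \<circ> linepath a a = (\<lambda>_. p a)"
  by (auto simp: linepath_def reversepath_def fun_eq_iff algebra_simps)

lemma homotopic_unit_interval:
  fixes a b :: "real \<Rightarrow> real"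
  assumes "path a" "path b" "path_image a \<subseteq> {0..1}" "path_image b \<subseteq> {0..1}" "pathstart a = pathstart b" "pathfinish a = pathfinish b"
  shows "homotopic_paths {0..1} a b"
  using assms convex_imp_simply_connected[of "{0..1::real}"] by (simp add: simply_connected_eq_homotopic_paths)

lemma homotopic_join_const_left:
  assumes "path p" "path_image p \<subseteq> S" "x = pathstart p"
  shows "homotopic_paths S ((\<lambda>_. x) +++ p) p"
proof -
  have "homotopic_paths S (p \<circ> (linepath 0 0 +++ linepath 0 1)) (p \<circ> linepath 0 1)"
    by (intro homotopic_paths_reparametrizations homotopic_unit_interval assms)
       (auto simp: path_image_join closed_segment_eq_real_ivl)
  then show ?thesis using assms(3) by (simp add: path_compose_join compose_linepath pathstart_def)
qed

lemma homotopic_join_const_right: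
  assumes "path p" "path_image p \<subseteq> S" "x = pathfinish p"
  shows "homotopic_paths S (p +++ (\<lambda>_. x)) p"
proof -
  have "homotopic_paths S (p \<circ> (linepath 0 1 +++ linepath 1 1)) (p \<circ> linepath 0 1)"
    by (intro homotopic_paths_reparametrizations homotopic_unit_interval assms)
       (auto simp: path_image_join closed_segment_eq_real_ivl)
  then show ?thesis using assms(3) by (simp add: path_compose_join compose_linepath pathfinish_def)
qed

lemma homotopic_join_reversepath:
  assumes "path p" "path_image p \<subseteq> S" "x = pathstart p"
  shows "homotopic_paths S (p +++ reversepath p) (\<lambda>_. x)"
proof -
  have "homotopic_paths S (p \<circ> (linepath 0 1 +++ linepath 1 0)) (p \<circ> linepath 0 0)"
    by (intro homotopic_paths_reparametrizations homotopic_unit_interval assms)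
       (auto simp: path_image_join closed_segment_eq_real_ivl)
  then show ?thesis using assms(3) by (simp add: path_compose_join compose_linepath pathstart_def)
qed

lemma loop_class_eq_iff:
  assumes "p \<in> loops_at S x" "q \<in> loops_at S x"
  shows "loop_homotopy S x `` {p} = loop_homotopy S x `` {q} \<longleftrightarrow> homotopic_paths S p q"
  using eq_equiv_class_iff[OF equiv_loop_homotopy assms] assms by (simp add: loop_homotopy_def)

lemma fundamental_group_carrier:
  "A \<in> carrier (fundamental_group S x) \<longleftrightarrow> (\<exists>p\<in>loops_at S x. A = loop_homotopy S x `` {p})"
  by (auto simp: fundamental_group_def quotient_def)

text \<open>Loops are mapped instead of classes, and \<open>f\<close> has to respect concatenation
  and exhaust the target only up to homotopy. Conjugation by a path and composition with a
  retraction both have this form.\<close>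

lemma fundamental_group_isoI:
  assumes loops: "\<And>p. p \<in> loops_at S x \<Longrightarrow> f p \<in> loops_at T y"
    and homotopic: "\<And>p q. p \<in> loops_at S x \<Longrightarrow> q \<in> loops_at S x \<Longrightarrow> homotopic_paths S p q \<longleftrightarrow> homotopic_paths T (f p) (f q)"
    and join: "\<And>p q. p \<in> loops_at S x \<Longrightarrow> q \<in> loops_at S x \<Longrightarrow> homotopic_paths T (f (p +++ q)) (f p +++ f q)"
    and surj: "\<And>q. q \<in> loops_at T y \<Longrightarrow> \<exists>p\<in>loops_at S x. homotopic_paths T (f p) q"
  shows "fundamental_group S x \<cong> fundamental_group T y"
proof (rule is_isoI)
  let ?c = "\<lambda>p. loop_homotopy S x `` {p}" and ?d = "\<lambda>p. loop_homotopy T y `` {p}"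
  \<comment> \<open>On a homotopy class all members of this union coincide, because \<open>f\<close>
    respects homotopy.\<close>
  define F where "F = (\<lambda>A. \<Union>p\<in>A. ?d (f p))"
  have F: "F (?c p) = ?d (f p)" if p: "p \<in> loops_at S x" for p
  proof -
    have "?d (f q) = ?d (f p)" if "q \<in> ?c p" for q
    proof -
      have "q \<in> loops_at S x" "homotopic_paths S q p"
        using that by (auto simp: loop_homotopy_def homotopic_paths_sym)
      then show ?thesis using p by (simp add: loop_class_eq_iff[OF loops loops] homotopic)
    qed
    then have "F (?c p) = (\<Union>q\<in>?c p. ?d (f p))" unfolding F_def by (intro SUP_cong refl)
    moreover have "p \<in> ?c p" using p by (simp add: loop_homotopy_def loops_at_def)
    then have "?c p \<noteq> {}" by blast
    ultimately show ?thesis by (simp only: UN_constant if_False)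
  qed
  show "F \<in> iso (fundamental_group S x) (fundamental_group T y)"
    unfolding iso_def
  proof (intro CollectI conjI homI bij_betw_imageI)
    fix A assume "A \<in> carrier (fundamental_group S x)"
    then show "F A \<in> carrier (fundamental_group T y)"
      unfolding fundamental_group_carrier using F loops by blast
  next
    fix A B assume "A \<in> carrier (fundamental_group S x)" "B \<in> carrier (fundamental_group S x)"
    then obtain p q where "p \<in> loops_at S x" "A = ?c p" "q \<in> loops_at S x" "B = ?c q"
      unfolding fundamental_group_carrier by blast
    then show "F (A \<otimes>\<^bsub>fundamental_group S x\<^esub> B) = F A \<otimes>\<^bsub>fundamental_group T y\<^esub> F B"
    proof -
      assume *: "p \<in> loops_at S x" "A = ?c p" "q \<in> loops_at S x" "B = ?c q"
      have "?d (f (p +++ q)) = ?d (f p +++ f q)"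
        using join[OF *(1,3)] loop_class_eq_iff[OF loops[OF join_loops[OF *(1,3)]] join_loops[OF loops[OF *(1)] loops[OF *(3)]]]
        by blast
      then show ?thesis
        by (simp only: *(2,4) fundamental_group_mult[OF *(1,3)] F[OF *(1)] F[OF *(3)] F[OF join_loops[OF *(1,3)]]
            fundamental_group_mult[OF loops[OF *(1)] loops[OF *(3)]])
    qed
  next
    show "inj_on F (carrier (fundamental_group S x))"
    proof (rule inj_onI)
      fix A B assume "A \<in> carrier (fundamental_group S x)" "B \<in> carrier (fundamental_group S x)" and FAB: "F A = F B"
      then obtain p q where pq: "p \<in> loops_at S x" "A = ?c p" "q \<in> loops_at S x" "B = ?c q"
        unfolding fundamental_group_carrier by blast
      then show "A = B" using FAB by (simp add: F loops loop_class_eq_iff homotopic)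
    qed
  next
    show "F ` carrier (fundamental_group S x) = carrier (fundamental_group T y)"
    proof (intro equalityI subsetI)
      fix B assume "B \<in> F ` carrier (fundamental_group S x)"
      then obtain A where "A \<in> carrier (fundamental_group S x)" "B = F A" by blast
      then show "B \<in> carrier (fundamental_group T y)"
        unfolding fundamental_group_carrier using F loops by blast
    next
      fix B assume "B \<in> carrier (fundamental_group T y)"
      then obtain q where q: "q \<in> loops_at T y" "B = ?d q" unfolding fundamental_group_carrier by blast
      then obtain p where p: "p \<in> loops_at S x" "homotopic_paths T (f p) q" using surj by blast
      then have "F (?c p) = B" using q by (simp add: F loop_class_eq_iff loops)
      moreover have "?c p \<in> carrier (fundamental_group S x)" using p fundamental_group_carrier by blast
      ultimately show "B \<in> F ` carrier (fundamental_group S x)" by blast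
    qed
  qed
qed

text \<open>Conjugating by \<open>k\<close> and then back changes a loop only by a homotopy. For the
  change of base point this yields injectivity and, with \<open>reversepath k\<close> in place of
  \<open>k\<close>, surjectivity.\<close>

lemma homotopic_conjugate_cancel:
  assumes k: "path k" "path_image k \<subseteq> S" "pathstart k = x" "pathfinish k = y" and p: "p \<in> loops_at S x"
  shows "homotopic_paths S (k +++ ((reversepath k +++ (p +++ k)) +++ reversepath k)) p"
proof -
  have p': "path p" "path_image p \<subseteq> S" "pathstart p = x" "pathfinish p = x" using p by (auto simp: loops_at_def)
  note [simp] = k p'
  have kk: "homotopic_paths S (k +++ reversepath k) (\<lambda>_. x)" by (rule homotopic_join_reversepath) simp_all
  have "homotopic_paths S ((reversepath k +++ (p +++ k)) +++ reversepath k) (reversepath k +++ ((p +++ k) +++ reversepath k))"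
    by (intro homotopic_paths_sym[OF homotopic_paths_assoc]) (auto simp: subset_path_image_join)
  also have "homotopic_paths S \<dots> (reversepath k +++ (p +++ (k +++ reversepath k)))"
    by (intro homotopic_join_right homotopic_paths_sym[OF homotopic_paths_assoc]) (auto simp: subset_path_image_join)
  also have "homotopic_paths S \<dots> (reversepath k +++ (p +++ (\<lambda>_. x)))"
    by (intro homotopic_join_right kk) (auto simp: subset_path_image_join)
  also have "homotopic_paths S \<dots> (reversepath k +++ p)"
    by (intro homotopic_join_right homotopic_join_const_right) auto
  finally have "homotopic_paths S (k +++ ((reversepath k +++ (p +++ k)) +++ reversepath k)) (k +++ (reversepath k +++ p))"
    by (rule homotopic_join_right) auto
  also have "homotopic_paths S \<dots> ((k +++ reversepath k) +++ p)"
    by (intro homotopic_paths_assoc) auto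
  also have "homotopic_paths S \<dots> ((\<lambda>_. x) +++ p)"
    by (intro homotopic_join_left kk) auto
  also have "homotopic_paths S \<dots> p" by (intro homotopic_join_const_left) auto
  finally show ?thesis .
qed

lemma fundamental_group_change_base:
  assumes k: "path k" "path_image k \<subseteq> S" "pathstart k = x" "pathfinish k = y"
  shows "fundamental_group S x \<cong> fundamental_group S y"
proof (rule fundamental_group_isoI[where f = "\<lambda>p. reversepath k +++ (p +++ k)"])
  let ?f = "\<lambda>p. reversepath k +++ (p +++ k)"
  note [simp] = k
  have D: "path p" "path_image p \<subseteq> S" "pathstart p = x" "pathfinish p = x" if "p \<in> loops_at S x" for p
    using that by (auto simp: loops_at_def)
  show loops: "?f p \<in> loops_at S y" if "p \<in> loops_at S x" for p
    using D[OF that] by (simp add: loops_at_def subset_path_image_join)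
  show "homotopic_paths S p q \<longleftrightarrow> homotopic_paths S (?f p) (?f q)" if p: "p \<in> loops_at S x" and q: "q \<in> loops_at S x" for p q
  proof
    assume "homotopic_paths S p q"
    then show "homotopic_paths S (?f p) (?f q)"
      using D[OF p] D[OF q] by (intro homotopic_join_right homotopic_join_left) auto
  next
    assume "homotopic_paths S (?f p) (?f q)"
    then have "homotopic_paths S (?f p +++ reversepath k) (?f q +++ reversepath k)"
      by (rule homotopic_join_left) simp_all
    then have "homotopic_paths S (k +++ (?f p +++ reversepath k)) (k +++ (?f q +++ reversepath k))"
      by (rule homotopic_join_right) simp_all
    then show "homotopic_paths S p q"
      by (rule homotopic_paths_trans[OF homotopic_paths_sym[OF homotopic_conjugate_cancel[OF k p]]
            homotopic_paths_trans[OF _ homotopic_conjugate_cancel[OF k q]]])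
  qed
  show "homotopic_paths S (?f (p +++ q)) (?f p +++ ?f q)" if p: "p \<in> loops_at S x" and q: "q \<in> loops_at S x" for p q
  proof -
    note [simp] = D[OF p] D[OF q]
    have kk: "homotopic_paths S (k +++ reversepath k) (\<lambda>_. x)" by (rule homotopic_join_reversepath) simp_all
    have "homotopic_paths S (?f p +++ ?f q) (reversepath k +++ ((p +++ k) +++ ?f q))"
      by (intro homotopic_paths_sym[OF homotopic_paths_assoc]) (auto simp: subset_path_image_join)
    also have "homotopic_paths S \<dots> (reversepath k +++ (p +++ (k +++ ?f q)))"
      by (intro homotopic_join_right homotopic_paths_sym[OF homotopic_paths_assoc]) (auto simp: subset_path_image_join)
    also have "homotopic_paths S \<dots> (reversepath k +++ (p +++ ((k +++ reversepath k) +++ (q +++ k))))"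
      by (intro homotopic_join_right homotopic_paths_assoc) (auto simp: subset_path_image_join)
    also have "homotopic_paths S \<dots> (reversepath k +++ (p +++ ((\<lambda>_. x) +++ (q +++ k))))"
      by (intro homotopic_join_right homotopic_join_left kk) (auto simp: subset_path_image_join)
    also have "homotopic_paths S \<dots> (reversepath k +++ (p +++ (q +++ k)))"
      by (intro homotopic_join_right homotopic_join_const_left) (auto simp: subset_path_image_join)
    also have "homotopic_paths S \<dots> (reversepath k +++ ((p +++ q) +++ k))"
      by (intro homotopic_join_right homotopic_paths_assoc) auto
    finally show ?thesis by (rule homotopic_paths_sym)
  qed
  show "\<exists>p\<in>loops_at S x. homotopic_paths S (?f p) q" if q: "q \<in> loops_at S y" for q
  proof
    have q': "path q" "path_image q \<subseteq> S" "pathstart q = y" "pathfinish q = y" using q by (auto simp: loops_at_def)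
    let ?p = "k +++ (q +++ reversepath k)"
    show "?p \<in> loops_at S x" using q' by (simp add: loops_at_def subset_path_image_join)
    show "homotopic_paths S (?f ?p) q"
      using homotopic_conjugate_cancel[of "reversepath k" S y x q] q by simp
  qed
qed

text \<open>\<open>T\<close> is embedded through \<open>s\<close> and need not lie in the same type
  as \<open>S\<close>. Fixing the single point \<open>s y\<close> under \<open>H\<close> suffices,
  since this keeps the ends of every loop in place while it is deformed to
  \<open>s \<circ> r \<circ> p\<close>.\<close>

lemma fundamental_group_deformation_retract:
  assumes r: "continuous_on S r" "r ` S \<subseteq> T" and s: "continuous_on T s" "s ` T \<subseteq> S"
    and rs: "\<And>y. y \<in> T \<Longrightarrow> r (s y) = y"
    and H: "continuous_on ({0..1::real} \<times> S) H" "H ` ({0..1} \<times> S) \<subseteq> S"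
      "\<And>z. z \<in> S \<Longrightarrow> H (0, z) = z" "\<And>z. z \<in> S \<Longrightarrow> H (1, z) = s (r z)" "\<And>t. t \<in> {0..1} \<Longrightarrow> H (t, s y) = s y"
    and y: "y \<in> T"
  shows "fundamental_group S (s y) \<cong> fundamental_group T y"
proof (rule fundamental_group_isoI[where f = "\<lambda>p. r \<circ> p"])
  have loops_image: "h \<circ> p \<in> loops_at B (h a)" if "p \<in> loops_at A a" "continuous_on A h" "h ` A \<subseteq> B"
    for A a p B and h :: "'x::topological_space \<Rightarrow> 'y::topological_space"
    using that by (auto simp: loops_at_def path_image_compose pathstart_compose pathfinish_compose
        intro!: path_continuous_image continuous_on_subset[OF that(2)])
  have retract: "homotopic_paths S p (s \<circ> (r \<circ> p))" if p: "p \<in> loops_at S (s y)" for p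
    unfolding homotopic_paths
  proof (intro exI[of _ "\<lambda>z. H (fst z, p (snd z))"] conjI ballI)
    have p': "continuous_on {0..1} p" "p ` {0..1} \<subseteq> S" "p 0 = s y" "p 1 = s y"
      using p by (auto simp: loops_at_def path_def path_image_def pathstart_def pathfinish_def)
    have "continuous_on ({0..1} \<times> {0..1}) (\<lambda>z::real \<times> real. (fst z, p (snd z)))"
      by (intro continuous_intros continuous_on_compose2[OF p'(1)]) auto
    then show "continuous_on ({0..1} \<times> {0..1}) (\<lambda>z::real \<times> real. H (fst z, p (snd z)))"
      by (rule continuous_on_compose2[OF H(1)]) (use p' in auto)
    show "(\<lambda>z. H (fst z, p (snd z))) \<in> {0..1} \<times> {0..1} \<rightarrow> S" using H(2) p' by fastforce
    show "H (fst (0, t), p (snd (0, t))) = p t" "H (fst (1, t), p (snd (1, t))) = (s \<circ> (r \<circ> p)) t" if "t \<in> {0..1}" for t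
      using H(3,4)[of "p t"] p'(2) that by (auto simp: image_subset_iff)
    show "pathstart ((\<lambda>z. H (fst z, p (snd z))) \<circ> Pair t) = pathstart p"
      "pathfinish ((\<lambda>z. H (fst z, p (snd z))) \<circ> Pair t) = pathfinish p" if "t \<in> {0..1}" for t
      using that p' H(5) by (simp_all add: pathstart_def pathfinish_def)
  qed
  show "r \<circ> p \<in> loops_at T y" if "p \<in> loops_at S (s y)" for p
    using loops_image[OF that r] rs y by simp
  show "homotopic_paths S p q \<longleftrightarrow> homotopic_paths T (r \<circ> p) (r \<circ> q)"
    if p: "p \<in> loops_at S (s y)" and q: "q \<in> loops_at S (s y)" for p q
  proof
    assume "homotopic_paths S p q"
    then show "homotopic_paths T (r \<circ> p) (r \<circ> q)"
      using r by (intro homotopic_paths_continuous_image) auto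
  next
    assume "homotopic_paths T (r \<circ> p) (r \<circ> q)"
    then have "homotopic_paths S (s \<circ> (r \<circ> p)) (s \<circ> (r \<circ> q))"
      by (rule homotopic_paths_continuous_image) (use s in auto)
    then show "homotopic_paths S p q"
      by (rule homotopic_paths_trans[OF retract[OF p]
            homotopic_paths_trans[OF _ homotopic_paths_sym[OF retract[OF q]]]])
  qed
  show "homotopic_paths T (r \<circ> (p +++ q)) ((r \<circ> p) +++ (r \<circ> q))"
    if p: "p \<in> loops_at S (s y)" and q: "q \<in> loops_at S (s y)" for p q
    using loops_image[OF join_loops[OF p q] r] by (simp add: path_compose_join[symmetric] loops_at_def)
  show "\<exists>p\<in>loops_at S (s y). homotopic_paths T (r \<circ> p) q" if q: "q \<in> loops_at T y" for q
  proof (intro bexI[of _ "s \<circ> q"])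
    show "s \<circ> q \<in> loops_at S (s y)" by (rule loops_image[OF q s])
    show "homotopic_paths T (r \<circ> (s \<circ> q)) q"
    proof (rule homotopic_paths_sym, rule homotopic_paths_eq)
      show "q t = (r \<circ> (s \<circ> q)) t" if "t \<in> {0..1}" for t
      proof -
        have "q t \<in> T" using q that by (auto simp: loops_at_def path_image_def)
        then show ?thesis using rs by simp
      qed
    qed (use q in \<open>auto simp: loops_at_def\<close>)
  qed
qed

text \<open>The two ways along the boundary of the square from one corner to the opposite one are
  homotopic in the square. Periodicity identifies opposite sides and turns them into the two
  concatenations.\<close>

lemma torus_loops_commute:
  assumes F: "continuous_on ({0..1} \<times> {0..1}) F" "F ` ({0..1} \<times> {0..1}) \<subseteq> S"
    and per: "\<And>t. F (1::real, t) = F (0, t)" "\<And>t. F (t, 1::real) = F (t, 0)"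
  shows "homotopic_paths S ((\<lambda>t. F (t, 0)) +++ (\<lambda>t. F (0, t))) ((\<lambda>t. F (0, t)) +++ (\<lambda>t. F (t, 0)))"
proof -
  let ?Q = "{0..1::real} \<times> {0..1::real}"
  have seg: "closed_segment u v \<subseteq> ?Q" if "u \<in> ?Q" "v \<in> ?Q" for u v
    by (intro closed_segment_subset that convex_Times) auto
  have "simply_connected ?Q" by (intro convex_imp_simply_connected convex_Times) auto
  then have "homotopic_paths ?Q (linepath (0, 0) (1, 0) +++ linepath (1, 0) (1, 1)) (linepath (0, 0) (0, 1) +++ linepath (0, 1) (1, 1))"
    unfolding simply_connected_eq_homotopic_paths using seg by (auto simp: subset_path_image_join)
  then have "homotopic_paths S (F \<circ> (linepath (0, 0) (1, 0) +++ linepath (1, 0) (1, 1))) (F \<circ> (linepath (0, 0) (0, 1) +++ linepath (0, 1) (1, 1)))"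
    by (rule homotopic_paths_continuous_image) (use F in auto)
  moreover have "F \<circ> linepath (0, 0) (1, 0) = (\<lambda>t. F (t, 0))" "F \<circ> linepath (1, 0) (1, 1) = (\<lambda>t. F (0, t))"
    "F \<circ> linepath (0, 0) (0, 1) = (\<lambda>t. F (0, t))" "F \<circ> linepath (0, 1) (1, 1) = (\<lambda>t. F (t, 0))"
    using per by (auto simp: linepath_def)
  ultimately show ?thesis by (simp add: path_compose_join)
qed

section \<open>Winding numbers as additive characters of the fundamental group\<close>

definition winding_hom :: "('a::topological_space \<Rightarrow> complex) \<Rightarrow> (real \<Rightarrow> 'a) set \<Rightarrow> complex" where
  "winding_hom f A = winding_number (f \<circ> (SOME p. p \<in> A)) 0"

context
  fixes f :: "'a::topological_space \<Rightarrow> complex" and S and x :: 'a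
  assumes f: "continuous_on S f" "0 \<notin> f ` S"
begin

text \<open>Justifies the choice of a representative in \<open>winding_hom\<close>: \<open>f\<close>
  has no zeros on \<open>S\<close>, so it maps homotopic loops to loops that are homotopic in the
  plane without \<open>0\<close>.\<close>

lemma winding_hom_class:
  assumes p: "p \<in> loops_at S x"
  shows "winding_hom f (loop_homotopy S x `` {p}) = winding_number (f \<circ> p) 0"
proof -
  have "p \<in> loop_homotopy S x `` {p}" using p by (simp add: loop_homotopy_def loops_at_def)
  then have "(SOME q. q \<in> loop_homotopy S x `` {p}) \<in> loop_homotopy S x `` {p}" by (metis someI)
  moreover have "homotopic_paths S p q" if "q \<in> loop_homotopy S x `` {p}" for q
    using that by (simp add: loop_homotopy_def)
  ultimately have "homotopic_paths S p (SOME q. q \<in> loop_homotopy S x `` {p})" by blast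
  then have "homotopic_paths (- {0}) (f \<circ> p) (f \<circ> (SOME q. q \<in> loop_homotopy S x `` {p}))"
    by (rule homotopic_paths_continuous_image) (use f in auto)
  then show ?thesis unfolding winding_hom_def by (simp add: winding_number_homotopic_paths)
qed

lemma winding_hom_mult:
  assumes "A \<in> carrier (fundamental_group S x)" "B \<in> carrier (fundamental_group S x)"
  shows "winding_hom f (A \<otimes>\<^bsub>fundamental_group S x\<^esub> B) = winding_hom f A + winding_hom f B"
proof -
  obtain p q where pq: "p \<in> loops_at S x" "A = loop_homotopy S x `` {p}" "q \<in> loops_at S x" "B = loop_homotopy S x `` {q}"
    using assms unfolding fundamental_group_carrier by blast
  have "path (f \<circ> r)" "0 \<notin> path_image (f \<circ> r)" "pathstart (f \<circ> r) = f x" "pathfinish (f \<circ> r) = f x" if "r \<in> loops_at S x" for r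
    using that f by (auto simp: loops_at_def path_image_compose pathstart_compose pathfinish_compose
        intro!: path_continuous_image intro: continuous_on_subset)
  then have "winding_number ((f \<circ> p) +++ (f \<circ> q)) 0 = winding_number (f \<circ> p) 0 + winding_number (f \<circ> q) 0"
    using pq by (intro winding_number_join) auto
  then show ?thesis using pq by (simp add: fundamental_group_mult winding_hom_class join_loops path_compose_join)
qed

end

section \<open>The plane with finitely many punctures\<close>

lemma simply_connected_homotopic_paths:
  fixes S :: "'a::real_normed_vector set"
  assumes "simply_connected U" "U \<subseteq> S" "path p" "path q" "path_image p \<subseteq> U" "path_image q \<subseteq> U"
    "pathstart p = pathstart q" "pathfinish p = pathfinish q"
  shows "homotopic_paths S p q"
proof (rule homotopic_paths_subset[OF _ assms(2)])
  show "homotopic_paths U p q"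
    using assms unfolding simply_connected_eq_homotopic_paths by auto
qed

lemma foldr_reduced_Cons_Nil: "reduced w \<Longrightarrow> foldr reduced_Cons w [] = w"
proof (induction w)
  case (Cons a w)
  then show ?case by (cases w) (auto simp: reduced_def)
qed simp

text \<open>The assumption \<open>directions\<close> keeps the cuts disjoint: it excludes two
  punctures on a common half-line from \<open>c\<close>.\<close>

locale punctured_plane =
  fixes Z :: "complex set" and c :: complex
  assumes finite_Z: "finite Z" and centre: "c \<notin> Z"
    and directions: "z \<in> Z \<Longrightarrow> w \<in> Z \<Longrightarrow> t > 0 \<Longrightarrow> w - c = of_real t * (z - c) \<Longrightarrow> w = z"
begin

declare linepath_trivial [simp del]

text \<open>For \<open>z\<close> other than \<open>c\<close> this is the orientation-preserving
  similarity taking the centre to \<open>0\<close> and the puncture to \<open>1\<close>, so that the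
  cut becomes the real half-line from \<open>1\<close> on.\<close>

definition coord :: "complex \<Rightarrow> complex \<Rightarrow> complex" where
  "coord z p = (p - c) / (z - c)"

definition ray :: "complex \<Rightarrow> complex set" where
  "ray z = {p. Im (coord z p) = 0 \<and> Re (coord z p) \<ge> 1}"

text \<open>The minimum of \<open>1\<close> and the tangents of the acute angles at \<open>c\<close>
  between directions to distinct punctures. The inserted \<open>1\<close> keeps the set nonempty
  when no such angle is acute.\<close>

definition slope :: real where
  "slope = Min (insert 1 ((\<lambda>(z, w). \<bar>Im (coord z w)\<bar> / Re (coord z w)) ` {(z, w). z \<in> Z \<and> w \<in> Z \<and> z \<noteq> w \<and> Re (coord z w) > 0}))"

text \<open>The slope is so small that the wedge around a ray, with apex at the puncture, meets no other ray.\<close>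

definition wedge :: "complex \<Rightarrow> complex set" where
  "wedge z = {p. Re (coord z p) > 1 \<and> \<bar>Im (coord z p)\<bar> < slope * (Re (coord z p) - 1)}"

definition slit_plane :: "complex set" where
  "slit_plane = - (\<Union>z\<in>Z. ray z)"

lemma coord_self: "z \<in> Z \<Longrightarrow> coord z z = 1"
  using centre by (auto simp: coord_def)

lemma finite_pairs: "finite {(z, w). z \<in> Z \<and> w \<in> Z \<and> z \<noteq> w \<and> Re (coord z w) > 0}"
  by (rule finite_subset[of _ "Z \<times> Z"]) (use finite_Z in auto)

lemma coord_not_pos_real:
  assumes "z \<in> Z" "w \<in> Z" "z \<noteq> w" "Re (coord z w) > 0"
  shows "Im (coord z w) \<noteq> 0"
proof
  assume "Im (coord z w) = 0"
  then have "coord z w = of_real (Re (coord z w))" by (simp add: complex_eq_iff)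
  moreover have "w - c = coord z w * (z - c)"
    using assms centre by (auto simp: coord_def)
  ultimately have "w - c = of_real (Re (coord z w)) * (z - c)" by metis
  then show False using directions assms by blast
qed

lemma slope_pos: "slope > 0"
  unfolding slope_def using finite_pairs coord_not_pos_real by (subst Min_gr_iff) auto

lemma slope_le:
  assumes "z \<in> Z" "w \<in> Z" "z \<noteq> w" "Re (coord z w) > 0"
  shows "slope * Re (coord z w) \<le> \<bar>Im (coord z w)\<bar>"
proof -
  have "slope \<le> \<bar>Im (coord z w)\<bar> / Re (coord z w)"
    unfolding slope_def using finite_pairs assms by (intro Min_le) auto
  then show ?thesis using assms by (simp add: pos_le_divide_eq)
qed

lemma coord_mult: "z \<in> Z \<Longrightarrow> w \<in> Z \<Longrightarrow> coord z p = coord w p * coord z w"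
  using centre by (auto simp: coord_def)

text \<open>Seen from the centre, a point of the ray of \<open>w\<close> has the same direction as
  \<open>w\<close>, hence steepness at least \<open>slope\<close> relative to \<open>z\<close>. A
  point of the wedge is less steep, because the apex of the wedge lies at the puncture and not at
  the centre.\<close>

lemma wedge_Int_ray:
  assumes "z \<in> Z" "w \<in> Z" "z \<noteq> w"
  shows "wedge z \<inter> ray w = {}"
proof (rule ccontr)
  assume "wedge z \<inter> ray w \<noteq> {}"
  then obtain p where p: "p \<in> wedge z" "p \<in> ray w" by blast
  define t where "t = Re (coord w p)"
  have t: "t \<ge> 1" "coord w p = of_real t" using p by (auto simp: ray_def t_def complex_eq_iff)
  have "coord z p = of_real t * coord z w" using coord_mult assms t by metis
  then have ReIm: "Re (coord z p) = t * Re (coord z w)" "Im (coord z p) = t * Im (coord z w)" by auto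
  have *: "t * Re (coord z w) > 1" "\<bar>t * Im (coord z w)\<bar> < slope * (t * Re (coord z w) - 1)"
    using p(1) by (simp_all add: wedge_def flip: ReIm)
  have pos: "Re (coord z w) > 0" using zero_less_mult_pos[of t "Re (coord z w)"] *(1) t(1) by linarith
  have "\<bar>t * Im (coord z w)\<bar> < slope * (t * Re (coord z w))"
    using * slope_pos by (simp add: algebra_simps)
  also have "\<dots> = t * (slope * Re (coord z w))" by simp
  also have "\<dots> \<le> t * \<bar>Im (coord z w)\<bar>"
    using slope_le[OF assms pos] t by (intro mult_left_mono) auto
  finally show False using t by (simp add: abs_mult)
qed

lemma wedge_subset: "z \<in> Z \<Longrightarrow> wedge z \<subseteq> - Z"
proof
  fix p assume z: "z \<in> Z" and p: "p \<in> wedge z"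
  show "p \<in> - Z"
  proof
    assume "p \<in> Z"
    then have "p \<in> ray p" by (simp add: ray_def coord_self)
    moreover have "p \<noteq> z" using p z coord_self[of z] by (auto simp: wedge_def)
    ultimately show False using wedge_Int_ray[of z p] z p \<open>p \<in> Z\<close> by blast
  qed
qed

lemma slit_plane_subset: "slit_plane \<subseteq> - Z"
  using coord_self by (fastforce simp: slit_plane_def ray_def)

text \<open>The only cut that meets the wedge is its own, and inside the wedge this cut is the real
  axis of \<open>coord z\<close>.\<close>

lemma wedge_Int_slit_plane: "z \<in> Z \<Longrightarrow> p \<in> wedge z \<Longrightarrow> p \<in> slit_plane \<longleftrightarrow> Im (coord z p) \<noteq> 0"
  using wedge_Int_ray[of z] unfolding slit_plane_def ray_def wedge_def by fastforce

lemma ray_wedge: "z \<in> Z \<Longrightarrow> p \<in> ray z \<Longrightarrow> p \<notin> Z \<Longrightarrow> p \<in> wedge z"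
proof -
  assume z: "z \<in> Z" and p: "p \<in> ray z" "p \<notin> Z"
  have "z - c \<noteq> 0" "p \<noteq> z" using z p centre by auto
  then have "coord z p \<noteq> 1" by (simp add: coord_def divide_eq_1_iff)
  then have "Re (coord z p) \<noteq> 1" using p by (auto simp: ray_def complex_eq_iff)
  then show "p \<in> wedge z" using p slope_pos by (auto simp: ray_def wedge_def)
qed

lemma continuous_coord: "continuous_on T (coord z)"
proof (cases "z = c")
  case True
  then have "coord z = (\<lambda>_. 0)" by (auto simp: coord_def)
  then show ?thesis by simp
next
  case False
  then show ?thesis unfolding coord_def by (intro continuous_intros) auto
qed

lemma open_slit_plane: "open slit_plane"
  unfolding slit_plane_def ray_def
  by (intro open_Compl closed_UN finite_Z closed_Collect_conj closed_Collect_eq closed_Collect_le ballI continuous_intros continuous_coord)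

lemma open_wedge: "open (wedge z)"
  unfolding wedge_def
  by (intro open_Collect_conj open_Collect_less continuous_intros continuous_coord)

lemma coord_convex_comb:
  assumes "u + v = 1"
  shows "coord z (u *\<^sub>R p + v *\<^sub>R q) = u *\<^sub>R coord z p + v *\<^sub>R coord z q"
proof -
  have "u *\<^sub>R p + v *\<^sub>R q - c = u *\<^sub>R (p - c) + v *\<^sub>R (q - c) + (u + v) *\<^sub>R c - c"
    by (simp add: algebra_simps)
  then have "u *\<^sub>R p + v *\<^sub>R q - c = u *\<^sub>R (p - c) + v *\<^sub>R (q - c)" using assms by simp
  then show ?thesis by (simp add: coord_def add_divide_distrib scaleR_conv_of_real)
qed

lemma convex_coord_vimage: "convex A \<Longrightarrow> convex (coord z -` A)"
  unfolding convex_def by (simp add: coord_convex_comb)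

lemma convex_wedge_coords:
  "convex {q. Re q > 1 \<and> \<bar>Im q\<bar> < slope * (Re q - 1)}"
proof -
  have *: "{q. Re q > 1 \<and> \<bar>Im q\<bar> < slope * (Re q - 1)} =
      {q. Re q > 1} \<inter> ({q. Complex slope (-1) \<bullet> q > slope} \<inter> {q. Complex slope 1 \<bullet> q > slope})"
    unfolding abs_less_iff inner_complex_def right_diff_distrib by auto
  show ?thesis unfolding * by (intro convex_Int convex_halfspace_gt convex_halfspace_Re_gt)
qed

lemma convex_wedge: "convex (wedge z)"
  using convex_coord_vimage[OF convex_wedge_coords, of z] unfolding wedge_def by (simp add: vimage_def)

lemma convex_upper: "convex (wedge z \<inter> {p. Im (coord z p) > 0})"
  using convex_Int[OF convex_wedge convex_coord_vimage[OF convex_halfspace_Im_gt[of 0]]]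
  by (simp add: vimage_def)

lemma convex_lower: "convex (wedge z \<inter> {p. Im (coord z p) < 0})"
  using convex_Int[OF convex_wedge convex_coord_vimage[OF convex_halfspace_Im_lt[of 0]]]
  by (simp add: vimage_def)

lemma centre_slit_plane: "c \<in> slit_plane"
  by (simp add: slit_plane_def ray_def coord_def)

text \<open>The cuts run away from the centre: once a point of the segment lies on a cut, so does
  everything beyond it, including \<open>p\<close>.\<close>

lemma segment_slit_plane: "p \<in> slit_plane \<Longrightarrow> closed_segment c p \<subseteq> slit_plane"
proof
  fix q assume p: "p \<in> slit_plane" and q: "q \<in> closed_segment c p"
  then obtain u where u: "0 \<le> u" "u \<le> 1" "q = (1 - u) *\<^sub>R c + u *\<^sub>R p" by (auto simp: closed_segment_def)
  have cq: "coord z q = u *\<^sub>R coord z p" for z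
    unfolding u(3) by (subst coord_convex_comb) (auto simp: coord_def)
  show "q \<in> slit_plane"
    unfolding slit_plane_def
  proof clarify
    fix z assume z: "z \<in> Z" "q \<in> ray z"
    then have *: "u * Im (coord z p) = 0" "u * Re (coord z p) \<ge> 1" by (auto simp: ray_def cq)
    have "u \<noteq> 0" using * by auto
    have "0 < Re (coord z p)" using zero_less_mult_pos[of u "Re (coord z p)"] *(2) u \<open>u \<noteq> 0\<close> by linarith
    then have "u * Re (coord z p) \<le> 1 * Re (coord z p)" using u by (intro mult_right_mono) auto
    then have "p \<in> ray z" using * \<open>u \<noteq> 0\<close> by (auto simp: ray_def)
    then show False using p z by (auto simp: slit_plane_def)
  qed
qed

lemma segment_slit_plane': "p \<in> slit_plane \<Longrightarrow> closed_segment p c \<subseteq> slit_plane"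
  using segment_slit_plane closed_segment_commute by blast

lemma simply_connected_slit_plane: "simply_connected slit_plane"
  by (rule starlike_imp_simply_connected)
     (use centre_slit_plane segment_slit_plane in \<open>auto simp: starlike_def\<close>)

lemma simply_connected_wedge: "simply_connected (wedge z)"
  by (rule convex_imp_simply_connected[OF convex_wedge])

section \<open>The covering with sheets indexed by reduced words\<close>

definition cross :: "complex \<Rightarrow> (complex \<times> bool) list \<Rightarrow> complex \<Rightarrow> (complex \<times> bool) list" where
  "cross z k p = (if Im (coord z p) \<ge> 0 then k else reduced_Cons (z, True) k)"

abbreviation reduced_words :: "(complex \<times> bool) list set" where
  "reduced_words \<equiv> carrier (free_group Z)"

text \<open>The gluing rule is contained in \<open>cross\<close>: a sheet over a wedge carries the
  word \<open>k\<close> above the cut and on it, and the word with the generator prepended below it.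
  Over the slit plane sheets are constant.\<close>

definition Sheets :: "(complex set \<times> (complex \<Rightarrow> (complex \<times> bool) list)) set" where
  "Sheets = {(slit_plane, \<lambda>_. k) |k. k \<in> reduced_words} \<union> {(wedge z, cross z k) |z k. z \<in> Z \<and> k \<in> reduced_words}"

lemma reduced_words_iff: "w \<in> reduced_words \<longleftrightarrow> set w \<subseteq> Z \<times> UNIV \<and> reduced w"
  by (simp add: free_group_def)

lemma reduced_Cons_words: "z \<in> Z \<Longrightarrow> w \<in> reduced_words \<Longrightarrow> reduced_Cons (z, e) w \<in> reduced_words"
  using set_reduced_Cons[of "(z, e)" w] unfolding reduced_words_iff by (auto simp: reduced_Cons_reduced)

lemma reduced_Cons_cancel_words:
  "w \<in> reduced_words \<Longrightarrow> reduced_Cons (z, e) (reduced_Cons (z, \<not> e) w) = w"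
  using reduced_Cons_cancel[of w "(z, e)"] by (simp add: inv_letter_def reduced_words_iff)

lemma cross_words: "z \<in> Z \<Longrightarrow> k \<in> reduced_words \<Longrightarrow> cross z k p \<in> reduced_words"
  by (simp add: cross_def reduced_Cons_words)

lemma cross_inj: "k \<in> reduced_words \<Longrightarrow> k' \<in> reduced_words \<Longrightarrow> cross z k p = cross z k' p \<Longrightarrow> k = k'"
  using reduced_Cons_cancel_words[of k z False] reduced_Cons_cancel_words[of k' z False]
  unfolding cross_def by (metis (full_types))

text \<open>Away from the cut the imaginary part of \<open>coord z\<close> has no zero, so it cannot
  change sign on a connected set.\<close>

lemma cross_const:
  assumes "connected C" "C \<subseteq> slit_plane \<inter> wedge z" "z \<in> Z" "y \<in> C" "p \<in> C"
  shows "cross z k y = cross z k p"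
proof -
  have conn: "connected ((\<lambda>p. Im (coord z p)) ` C)"
    by (intro connected_continuous_image continuous_on_Im continuous_coord assms(1))
  have nz: "Im (coord z q) \<noteq> 0" if "q \<in> C" for q
    using wedge_Int_slit_plane[of z q] assms(2,3) that by blast
  have "Im (coord z y) \<ge> 0 \<longleftrightarrow> Im (coord z p) \<ge> 0"
  proof (rule ccontr)
    assume "\<not> ?thesis"
    then have "Im (coord z y) \<le> 0 \<and> 0 \<le> Im (coord z p) \<or> Im (coord z p) \<le> 0 \<and> 0 \<le> Im (coord z y)"
      by linarith
    then have "\<exists>a\<in>C. \<exists>b\<in>C. Im (coord z a) \<le> 0 \<and> 0 \<le> Im (coord z b)" using assms(4,5) by blast
    then have "0 \<in> (\<lambda>p. Im (coord z p)) ` C" using connectedD_interval[OF conn] by blast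
    then show False using nz by force
  qed
  then show ?thesis by (simp add: cross_def)
qed

lemma sheet_const:
  assumes "(V, \<sigma>) \<in> Sheets" "connected C" "C \<subseteq> slit_plane \<inter> V" "y \<in> C" "p \<in> C"
  shows "\<sigma> y = \<sigma> p"
proof -
  consider k where "\<sigma> = (\<lambda>_. k)" | z k where "z \<in> Z" "V = wedge z" "\<sigma> = cross z k"
    using assms(1) by (auto simp: Sheets_def)
  then show ?thesis
  proof cases
    case 2
    then show ?thesis using cross_const[OF assms(2) _ _ assms(4,5)] assms(3) by simp
  qed simp
qed

sublocale local_system Sheets "- Z" reduced_words
proof
  show "open V" if "(V, \<sigma>) \<in> Sheets" for V \<sigma>
    using that open_slit_plane open_wedge by (auto simp: Sheets_def)
  show "\<sigma> z \<in> reduced_words" if "(V, \<sigma>) \<in> Sheets" "z \<in> V" for V \<sigma> z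
    using that cross_words by (auto simp: Sheets_def)
  show "\<exists>V. open V \<and> p \<in> V \<and> (\<forall>z'\<in>V. \<forall>m\<in>reduced_words. \<exists>\<sigma>. (V, \<sigma>) \<in> Sheets \<and> \<sigma> z' = m)" if p: "p \<in> - Z" for p
  proof (cases "p \<in> slit_plane")
    case True
    show ?thesis
      by (rule exI[of _ slit_plane]) (use True open_slit_plane in \<open>auto simp: Sheets_def\<close>)
  next
    case False
    then obtain z where z: "z \<in> Z" "p \<in> ray z" by (auto simp: slit_plane_def)
    have "\<exists>\<sigma>. (wedge z, \<sigma>) \<in> Sheets \<and> \<sigma> q = m" if m: "m \<in> reduced_words" for q m
    proof (cases "Im (coord z q) \<ge> 0")
      case True
      then show ?thesis using z m by (intro exI[of _ "cross z m"]) (auto simp: Sheets_def cross_def)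
    next
      \<comment> \<open>Below the cut \<open>cross\<close> prepends the generator, so its inverse is
        prepended beforehand.\<close>
      case False
      then show ?thesis
        using z m reduced_Cons_cancel_words[OF m, of z True] reduced_Cons_words[OF z(1) m, of False]
        by (intro exI[of _ "cross z (reduced_Cons (z, False) m)"]) (auto simp: Sheets_def cross_def)
    qed
    then show ?thesis
      using ray_wedge[OF z] p open_wedge by (intro exI[of _ "wedge z"]) auto
  qed
  show "\<sigma> z = \<sigma>' z" if V: "(V, \<sigma>) \<in> Sheets" "(V', \<sigma>') \<in> Sheets" and C: "connected C" "C \<subseteq> V \<inter> V'"
    and yz: "y \<in> C" "z \<in> C" "\<sigma> y = \<sigma>' y" for V \<sigma> V' \<sigma>' C y z
  \<comment> \<open>Inside the slit plane every sheet is constant on \<open>C\<close>. A point of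
    \<open>C\<close> on a cut lies in only one wedge, so then both sheets belong to that wedge and
    \<open>cross_inj\<close> identifies them.\<close>
  proof (cases "C \<subseteq> slit_plane")
    case True
    then show ?thesis using sheet_const[OF V(1) C(1)] sheet_const[OF V(2) C(1)] C yz by (metis le_inf_iff)
  next
    case False
    then obtain p where p: "p \<in> C" "p \<notin> slit_plane" by blast
    then obtain w k w' k' where wk: "V = wedge w" "\<sigma> = cross w k" "w \<in> Z" "k \<in> reduced_words"
        "V' = wedge w'" "\<sigma>' = cross w' k'" "w' \<in> Z" "k' \<in> reduced_words"
      using V C by (auto simp: Sheets_def)
    obtain v where "v \<in> Z" "p \<in> ray v" using p by (auto simp: slit_plane_def)
    then have "w = v" "w' = v" using wedge_Int_ray[of _ v] p C wk by blast+
    then show ?thesis using wk yz cross_inj by metis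
  qed
qed

text \<open>The numbers \<open>2 \<plusminus> \<i> * slope / 2\<close> lie in the cone that defines a wedge, on either side of the ray.\<close>

definition upper_point :: "complex \<Rightarrow> complex" where
  "upper_point z = c + (z - c) * Complex 2 (slope / 2)"

definition lower_point :: "complex \<Rightarrow> complex" where
  "lower_point z = c + (z - c) * Complex 2 (- slope / 2)"

lemma coord_points:
  assumes "z \<in> Z"
  shows "coord z (upper_point z) = Complex 2 (slope / 2)" "coord z (lower_point z) = Complex 2 (- slope / 2)"
  using assms centre by (auto simp: coord_def upper_point_def lower_point_def)

lemma points_wedge: "z \<in> Z \<Longrightarrow> upper_point z \<in> wedge z" "z \<in> Z \<Longrightarrow> lower_point z \<in> wedge z"
  using slope_pos by (auto simp: wedge_def coord_points)

lemma points_slit_plane: "z \<in> Z \<Longrightarrow> upper_point z \<in> slit_plane" "z \<in> Z \<Longrightarrow> lower_point z \<in> slit_plane"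
  using slope_pos wedge_Int_slit_plane points_wedge by (auto simp: coord_points)

text \<open>For a positive letter the loop leaves the centre below the cut, crosses the cut upwards
  and returns, that is, it runs once counterclockwise around the puncture.\<close>

definition letter_loop :: "complex \<times> bool \<Rightarrow> real \<Rightarrow> complex" where
  "letter_loop a = (let z = fst a;
      p = linepath c (lower_point z) +++ (linepath (lower_point z) (upper_point z) +++ linepath (upper_point z) c)
    in if snd a then p else reversepath p)"

fun word_loop :: "(complex \<times> bool) list \<Rightarrow> real \<Rightarrow> complex" where
  "word_loop [] = linepath c c"
| "word_loop (a # w) = letter_loop a +++ word_loop w"

lemma path_letter_loop [simp]:
  "path (letter_loop a)" "pathstart (letter_loop a) = c" "pathfinish (letter_loop a) = c"
  by (auto simp: letter_loop_def Let_def)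

lemma segment_centre: "p \<in> slit_plane \<Longrightarrow> closed_segment c p \<subseteq> - Z" "p \<in> slit_plane \<Longrightarrow> closed_segment p c \<subseteq> - Z"
  using segment_slit_plane segment_slit_plane' slit_plane_subset by blast+

lemma segment_wedge:
  "p \<in> wedge z \<Longrightarrow> q \<in> wedge z \<Longrightarrow> closed_segment p q \<subseteq> wedge z"
  by (rule closed_segment_subset[OF _ _ convex_wedge])

lemma path_image_letter_loop: "fst a \<in> Z \<Longrightarrow> path_image (letter_loop a) \<subseteq> - Z"
  using segment_centre points_slit_plane
    order_trans[OF segment_wedge[OF points_wedge(2) points_wedge(1)] wedge_subset]
  by (simp add: letter_loop_def Let_def path_image_join)

lemma path_word_loop [simp]:
  "path (word_loop w)" "pathstart (word_loop w) = c" "pathfinish (word_loop w) = c"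
  by (induction w) auto

lemma path_image_word_loop: "set w \<subseteq> Z \<times> UNIV \<Longrightarrow> path_image (word_loop w) \<subseteq> - Z"
proof (induction w)
  case Nil
  then show ?case using centre by simp
next
  case (Cons a w)
  then show ?case using path_image_letter_loop[of a] by (auto simp: path_image_join)
qed

lemma letter_loop_inv_letter: "letter_loop (inv_letter a) = reversepath (letter_loop a)"
  by (simp add: letter_loop_def inv_letter_def Let_def)

lemma word_loop_reduced_Cons:
  assumes "fst a \<in> Z" "set w \<subseteq> Z \<times> UNIV"
  shows "homotopic_paths (- Z) (word_loop (reduced_Cons a w)) (letter_loop a +++ word_loop w)"
proof (cases w)
  case Nil
  then show ?thesis using path_image_word_loop[of "[a]"] assms by (auto simp: mem_Times_iff)
next
  case (Cons b v)
  show ?thesis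
  proof (cases "b = inv_letter a")
    case True
    note imgs = path_image_letter_loop[OF assms(1)]
    have v: "path_image (word_loop v) \<subseteq> - Z" using assms(2) Cons by (intro path_image_word_loop) auto
    have "homotopic_paths (- Z) (letter_loop a +++ (reversepath (letter_loop a) +++ word_loop v)) (linepath c c +++ word_loop v)"
      using homotopic_paths_rinv[of "letter_loop a" "- Z"] imgs v
      by (intro homotopic_join_assoc_left) auto
    also have "homotopic_paths (- Z) \<dots> (word_loop v)"
      using homotopic_paths_lid[of "word_loop v"] v by simp
    finally show ?thesis
      using Cons True by (simp add: letter_loop_inv_letter homotopic_paths_sym)
  next
    case False
    then have "word_loop (reduced_Cons a w) = word_loop (a # w)" using Cons by simp
    moreover have "path_image (word_loop (a # w)) \<subseteq> - Z"
      using assms by (intro path_image_word_loop) (auto simp: mem_Times_iff)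
    ultimately show ?thesis by (simp add: homotopic_paths_refl del: word_loop.simps(1))
  qed
qed

lemma word_loop_mult:
  assumes "set u \<subseteq> Z \<times> UNIV" "set v \<subseteq> Z \<times> UNIV"
  shows "homotopic_paths (- Z) (word_loop (foldr reduced_Cons u v)) (word_loop u +++ word_loop v)"
  using assms(1)
proof (induction u)
  case Nil
  then show ?case
    using homotopic_paths_lid[of "word_loop v" "- Z"] path_image_word_loop[OF assms(2)]
    by (simp add: homotopic_paths_sym)
next
  case (Cons a u)
  have a: "fst a \<in> Z" and u: "set u \<subseteq> Z \<times> UNIV" using Cons by auto
  have "set (foldr reduced_Cons u v) \<subseteq> Z \<times> UNIV" using set_foldr[of u v] assms(2) u by blast
  then have "homotopic_paths (- Z) (word_loop (foldr reduced_Cons (a # u) v)) (letter_loop a +++ word_loop (foldr reduced_Cons u v))"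
    using word_loop_reduced_Cons[OF a] by simp
  also have "homotopic_paths (- Z) \<dots> (letter_loop a +++ (word_loop u +++ word_loop v))"
    using Cons.IH[OF u] path_image_letter_loop[OF a] by (intro homotopic_join_right) auto
  also have "homotopic_paths (- Z) \<dots> ((letter_loop a +++ word_loop u) +++ word_loop v)"
    using path_image_letter_loop[OF a] path_image_word_loop[OF u] path_image_word_loop[OF assms(2)]
    by (intro homotopic_paths_assoc) auto
  finally show ?case by simp
qed

section \<open>Holonomy of the word loops\<close>

lemma holonomy_slit_plane:
  "k \<in> reduced_words \<Longrightarrow> path_image p \<subseteq> slit_plane \<Longrightarrow> holonomy p k k"
  using holonomy_sheet[of slit_plane "\<lambda>_. k" p] by (auto simp: Sheets_def)

text \<open>Only the middle segment crosses the cut. Transport runs from its upper end to its lower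
  end and so prepends the generator; an inverse letter is handled by reversing the path.\<close>

lemma holonomy_letter_loop:
  assumes "fst a \<in> Z" "v \<in> reduced_words"
  shows "holonomy (letter_loop a) v (reduced_Cons a v)"
proof -
  define z where "z = fst a"
  have z: "z \<in> Z" using assms by (simp add: z_def)
  have True: "holonomy (letter_loop (z, True)) k (reduced_Cons (z, True) k)" if k: "k \<in> reduced_words" for k
  proof -
    have "(wedge z, cross z k) \<in> Sheets" using z k by (auto simp: Sheets_def)
    from holonomy_sheet[OF this, of "linepath (lower_point z) (upper_point z)"]
    have 2: "holonomy (linepath (lower_point z) (upper_point z)) k (reduced_Cons (z, True) k)"
      using segment_wedge points_wedge[OF z] slope_pos by (simp add: cross_def coord_points[OF z])
    have 3: "holonomy (linepath (upper_point z) c) k k"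
      using segment_slit_plane' points_slit_plane[OF z] by (intro holonomy_slit_plane k) simp
    have 1: "holonomy (linepath c (lower_point z)) (reduced_Cons (z, True) k) (reduced_Cons (z, True) k)"
      using segment_slit_plane points_slit_plane[OF z]
      by (intro holonomy_slit_plane reduced_Cons_words z k) simp
    show ?thesis
      unfolding letter_loop_def Let_def using 1 2 3
      by simp (intro holonomy_join[where v = "reduced_Cons (z, True) k"] holonomy_join[where v = k and u = "reduced_Cons (z, True) k"]; simp)
  qed
  show ?thesis
  proof (cases "snd a")
    case True
    then have "a = (z, True)" by (simp add: z_def prod_eq_iff)
    then show ?thesis using \<open>\<And>k. _ \<Longrightarrow> holonomy _ _ _\<close> assms by simp
  next
    case False
    then have a: "a = (z, False)" by (simp add: z_def prod_eq_iff)
    have "holonomy (letter_loop (z, True)) (reduced_Cons (z, False) v) v"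
      using True[OF reduced_Cons_words[OF z assms(2), of False]] reduced_Cons_cancel_words[OF assms(2), of z True]
      by simp
    then have "holonomy (reversepath (letter_loop (z, True))) v (reduced_Cons (z, False) v)"
      by (rule holonomy_reversepath)
    then show ?thesis using letter_loop_inv_letter[of "(z, True)"] by (simp add: a inv_letter_def)
  qed
qed

text \<open>For a reduced \<open>w\<close> the right-hand word is \<open>w\<close> itself. The
  homotopy class thus determines the word, which is the injectivity of the isomorphism.\<close>

lemma holonomy_word_loop:
  assumes "set w \<subseteq> Z \<times> UNIV"
  shows "holonomy (word_loop w) [] (foldr reduced_Cons w [])"
  using assms
proof (induction w)
  case Nil
  have "holonomy (linepath c c) [] []"
    using centre_slit_plane by (intro holonomy_slit_plane) (auto simp: reduced_words_iff reduced_def)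
  then show ?case by simp
next
  case (Cons a w)
  have "reduced (foldr reduced_Cons w [])" by (rule reduced_foldr) (simp add: reduced_def)
  then have "foldr reduced_Cons w [] \<in> reduced_words"
    using set_foldr[of w "[]"] Cons.prems unfolding reduced_words_iff by auto
  then show ?case
    using holonomy_letter_loop[of a] Cons by (auto intro!: holonomy_join)
qed

section \<open>Deforming an arbitrary loop into a word loop\<close>

text \<open>A point beyond a puncture on its ray cannot be joined straight to the centre; it is counted with
  the upper side of the ray, in accordance with \<open>cross\<close>.\<close>

definition connector :: "complex \<Rightarrow> real \<Rightarrow> complex" where
  "connector p = (if p \<in> slit_plane then linepath p c
    else let z = SOME z. z \<in> Z \<and> p \<in> ray z in linepath p (upper_point z) +++ linepath (upper_point z) c)"

lemma connector_ray:
  assumes "z \<in> Z" "p \<in> wedge z" "p \<notin> slit_plane"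
  shows "connector p = linepath p (upper_point z) +++ linepath (upper_point z) c"
proof -
  have "\<exists>z. z \<in> Z \<and> p \<in> ray z" using assms by (auto simp: slit_plane_def)
  then have "(SOME z. z \<in> Z \<and> p \<in> ray z) \<in> Z \<and> p \<in> ray (SOME z. z \<in> Z \<and> p \<in> ray z)" by (rule someI_ex)
  \<comment> \<open>The wedge of \<open>z\<close> meets no other ray, so the choice in
    \<open>connector\<close> is forced.\<close>
  then have "(SOME z. z \<in> Z \<and> p \<in> ray z) = z" using wedge_Int_ray[of z] assms by blast
  then show ?thesis using assms by (simp add: connector_def)
qed

lemma path_connector [simp]: "path (connector p)" "pathstart (connector p) = p" "pathfinish (connector p) = c"
  by (auto simp: connector_def Let_def)

lemma path_image_connector:
  assumes "p \<notin> Z"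
  shows "path_image (connector p) \<subseteq> - Z"
proof (cases "p \<in> slit_plane")
  case True
  then show ?thesis using segment_centre by (simp add: connector_def)
next
  case False
  then obtain z where z: "z \<in> Z" "p \<in> ray z" by (auto simp: slit_plane_def)
  have p: "p \<in> wedge z" by (rule ray_wedge[OF z assms])
  show ?thesis
    unfolding connector_ray[OF z(1) p False]
    using segment_wedge[OF p points_wedge(1)[OF z(1)]] wedge_subset[OF z(1)] segment_centre points_slit_plane z
    by (auto simp: path_image_join)
qed

text \<open>Gives one formula for all positions of \<open>p\<close> in the wedge. Below the cut the
  additional letter loop in \<open>cross z k p\<close> makes up for the connector passing on the
  other side of the puncture: \<open>pcL\<close> and \<open>pLU\<close> replace its first two pieces
  by the segment to the upper point.\<close>

lemma connector_wedge:
  assumes z: "z \<in> Z" and k: "k \<in> reduced_words" and p: "p \<in> wedge z"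
  shows "homotopic_paths (- Z) (connector p +++ word_loop (cross z k p))
    (linepath p (upper_point z) +++ (linepath (upper_point z) c +++ word_loop k))"
proof -
  let ?U = "upper_point z" and ?L = "lower_point z"
  note pts = points_wedge[OF z] points_slit_plane[OF z]
  have in_w: "closed_segment x y \<subseteq> - Z" if "x \<in> wedge z" "y \<in> wedge z" for x y
    using segment_wedge[OF that] wedge_subset[OF z] by blast
  have in_s: "closed_segment c ?U \<subseteq> - Z" "closed_segment ?U c \<subseteq> - Z" "closed_segment c ?L \<subseteq> - Z" "closed_segment ?L c \<subseteq> - Z"
    using segment_centre pts by auto
  have wk: "path_image (word_loop k) \<subseteq> - Z"
    using k by (intro path_image_word_loop) (simp add: reduced_words_iff)
  consider "Im (coord z p) = 0" | "Im (coord z p) > 0" | "Im (coord z p) < 0" by linarith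
  then show ?thesis
  proof cases
    case 1
    then have "p \<notin> slit_plane" using wedge_Int_slit_plane z p by blast
    moreover have "cross z k p = k" using 1 by (simp add: cross_def)
    moreover have "homotopic_paths (- Z) (linepath p ?U +++ (linepath ?U c +++ word_loop k))
        ((linepath p ?U +++ linepath ?U c) +++ word_loop k)"
      using in_w[OF p pts(1)] in_s wk by (intro homotopic_paths_assoc) auto
    ultimately show ?thesis by (simp add: connector_ray[OF z p] homotopic_paths_sym)
  next
    case 2
    then have ps: "p \<in> slit_plane" and ck: "cross z k p = k" using wedge_Int_slit_plane z p by (auto simp: cross_def)
    have "closed_segment p ?U \<subseteq> wedge z \<inter> {p. Im (coord z p) > 0}"
      using 2 p pts slope_pos by (intro closed_segment_subset convex_upper) (auto simp: coord_points[OF z])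
    then have "closed_segment p ?U \<subseteq> slit_plane" using wedge_Int_slit_plane[OF z] by fastforce
    then have "homotopic_paths (- Z) (linepath p ?U +++ linepath ?U c) (linepath p c)"
      using ps pts segment_slit_plane segment_slit_plane'
      by (intro simply_connected_homotopic_paths[OF simply_connected_slit_plane slit_plane_subset])
        (auto simp: path_image_join)
    then have "homotopic_paths (- Z) (linepath p ?U +++ (linepath ?U c +++ word_loop k)) (linepath p c +++ word_loop k)"
      using in_w[OF p pts(1)] in_s wk by (intro homotopic_join_assoc_left) auto
    then show ?thesis using ps ck by (simp add: connector_def homotopic_paths_sym)
  next
    case 3
    then have ps: "p \<in> slit_plane" and ck: "cross z k p = reduced_Cons (z, True) k"
      using wedge_Int_slit_plane z p by (auto simp: cross_def)
    have "closed_segment p ?L \<subseteq> wedge z \<inter> {p. Im (coord z p) < 0}"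
      using 3 p pts slope_pos by (intro closed_segment_subset convex_lower) (auto simp: coord_points[OF z])
    then have "closed_segment p ?L \<subseteq> slit_plane" using wedge_Int_slit_plane[OF z] by fastforce
    then have pcL: "homotopic_paths (- Z) (linepath p c +++ linepath c ?L) (linepath p ?L)"
      using ps pts segment_slit_plane segment_slit_plane'
      by (intro simply_connected_homotopic_paths[OF simply_connected_slit_plane slit_plane_subset])
        (auto simp: path_image_join)
    have pLU: "homotopic_paths (- Z) (linepath p ?L +++ linepath ?L ?U) (linepath p ?U)"
      using segment_wedge p pts
      by (intro simply_connected_homotopic_paths[OF simply_connected_wedge wedge_subset[OF z]])
        (auto simp: path_image_join)
    have pc: "closed_segment p c \<subseteq> - Z" using segment_centre ps by blast
    note imgs = pc in_w[OF p pts(1)] in_w[OF p pts(2)] in_w[OF pts(2) pts(1)] in_s wk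
    have Uc: "path_image (linepath ?U c +++ word_loop k) \<subseteq> - Z" using imgs by (simp add: path_image_join)
    have ll: "path_image (letter_loop (z, True)) \<subseteq> - Z" using z by (intro path_image_letter_loop) simp
    have "homotopic_paths (- Z) (word_loop (cross z k p)) (letter_loop (z, True) +++ word_loop k)"
      using word_loop_reduced_Cons[of "(z, True)" k] z k by (simp add: ck reduced_words_iff)
    also have "homotopic_paths (- Z) \<dots> (linepath c ?L +++ (linepath ?L ?U +++ linepath ?U c) +++ word_loop k)"
      unfolding letter_loop_def Let_def using imgs
      by simp (intro homotopic_paths_sym[OF homotopic_paths_assoc]; simp add: path_image_join)
    also have "homotopic_paths (- Z) \<dots> (linepath c ?L +++ linepath ?L ?U +++ linepath ?U c +++ word_loop k)"
      using imgs by (intro homotopic_join_right homotopic_paths_sym[OF homotopic_paths_assoc]) (auto simp: path_image_join)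
    finally have "homotopic_paths (- Z) (linepath p c +++ word_loop (cross z k p))
        (linepath p c +++ (linepath c ?L +++ (linepath ?L ?U +++ linepath ?U c +++ word_loop k)))"
      using imgs by (intro homotopic_join_right) auto
    also have "homotopic_paths (- Z) \<dots> (linepath p ?L +++ (linepath ?L ?U +++ (linepath ?U c +++ word_loop k)))"
      using imgs Uc by (intro homotopic_join_assoc_left pcL) (auto simp: path_image_join)
    also have "homotopic_paths (- Z) \<dots> (linepath p ?U +++ (linepath ?U c +++ word_loop k))"
      using imgs Uc by (intro homotopic_join_assoc_left pLU) auto
    finally show ?thesis using ps by (simp add: connector_def)
  qed
qed

text \<open>Local form of the deformation. Over the slit plane it holds because that set is simply
  connected; over a wedge, because \<open>connector_wedge\<close> reduces both sides to segments
  inside the wedge.\<close>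

lemma sheet_connector:
  assumes V: "(V, \<sigma>) \<in> Sheets" and \<gamma>: "path \<gamma>" "path_image \<gamma> \<subseteq> V" and pq: "pathstart \<gamma> = p" "pathfinish \<gamma> = q"
  shows "homotopic_paths (- Z) (\<gamma> +++ (connector q +++ word_loop (\<sigma> q))) (connector p +++ word_loop (\<sigma> p))"
proof -
  have V_in: "p \<in> V" "q \<in> V" using \<gamma> pq by auto
  consider k where "V = slit_plane" "\<sigma> = (\<lambda>_. k)" "k \<in> reduced_words"
    | z k where "V = wedge z" "\<sigma> = cross z k" "z \<in> Z" "k \<in> reduced_words"
    using V by (auto simp: Sheets_def)
  then show ?thesis
  proof cases
    case 1
    have "path_image (word_loop k) \<subseteq> - Z" using 1 by (intro path_image_word_loop) (simp add: reduced_words_iff)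
    moreover have "homotopic_paths (- Z) (\<gamma> +++ linepath q c) (linepath p c)"
      using 1 V_in \<gamma> pq segment_slit_plane segment_slit_plane'
      by (intro simply_connected_homotopic_paths[OF simply_connected_slit_plane slit_plane_subset])
        (auto simp: path_image_join)
    ultimately have "homotopic_paths (- Z) (\<gamma> +++ (linepath q c +++ word_loop k)) (linepath p c +++ word_loop k)"
      using 1 V_in \<gamma> pq segment_centre slit_plane_subset by (intro homotopic_join_assoc_left) auto
    then show ?thesis using 1 V_in by (simp add: connector_def)
  next
    case 2
    let ?U = "upper_point z"
    note pts = points_wedge[OF 2(3)] points_slit_plane[OF 2(3)]
    have wk: "path_image (linepath ?U c +++ word_loop k) \<subseteq> - Z"
      using 2 segment_centre pts by (auto simp: path_image_join reduced_words_iff dest!: path_image_word_loop)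
    have \<gamma>Z: "path_image \<gamma> \<subseteq> - Z" using 2 \<gamma> wedge_subset by blast
    have "homotopic_paths (- Z) (\<gamma> +++ (connector q +++ word_loop (\<sigma> q)))
        (\<gamma> +++ (linepath q ?U +++ (linepath ?U c +++ word_loop k)))"
      using 2 \<gamma> pq \<gamma>Z V_in connector_wedge[of z k q] by (intro homotopic_join_right) auto
    also have "homotopic_paths (- Z) \<dots> (linepath p ?U +++ (linepath ?U c +++ word_loop k))"
    proof (rule homotopic_join_assoc_left)
      show "homotopic_paths (- Z) (\<gamma> +++ linepath q ?U) (linepath p ?U)"
        using 2 V_in \<gamma> pq segment_wedge pts
        by (intro simply_connected_homotopic_paths[OF simply_connected_wedge wedge_subset[OF 2(3)]])
          (auto simp: path_image_join)
      show "path_image (linepath q ?U) \<subseteq> - Z"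
        using segment_wedge[OF _ pts(1)] V_in 2 wedge_subset[OF 2(3)] by auto
    qed (use \<gamma> pq \<gamma>Z wk in auto)
    also have "homotopic_paths (- Z) \<dots> (connector p +++ word_loop (\<sigma> p))"
      using 2 V_in connector_wedge[of z k p] by (simp add: homotopic_paths_sym)
    finally show ?thesis .
  qed
qed

text \<open>The claim for an interval follows from the claims for two adjacent halves, and for short
  intervals it is \<open>sheet_connector\<close>, so bisection yields it for the whole path.\<close>

lemma lift_connector:
  assumes p: "path p" "path_image p \<subseteq> - Z" and g: "lift p {0..1} g" and ab: "0 \<le> a" "a \<le> b" "b \<le> 1"
  shows "homotopic_paths (- Z) (subpath a b p +++ (connector (p b) +++ word_loop (g b))) (connector (p a) +++ word_loop (g a))"
proof -
  define P where "P = (\<lambda>a b. 0 \<le> a \<and> b \<le> 1 \<longrightarrow>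
    homotopic_paths (- Z) (subpath a b p +++ (connector (p b) +++ word_loop (g b))) (connector (p a) +++ word_loop (g a)))"
  have imgs: "path_image (connector (p t) +++ word_loop (g t)) \<subseteq> - Z" if "t \<in> {0..1}" for t
  proof -
    have "p t \<notin> Z" using p that unfolding path_image_def by blast
    moreover have "set (g t) \<subseteq> Z \<times> UNIV" using lift_value[OF g that] by (simp add: reduced_words_iff)
    ultimately show ?thesis using path_image_connector path_image_word_loop by (simp add: path_image_join)
  qed
  have sub: "path (subpath u v p)" "path_image (subpath u v p) \<subseteq> - Z" if "u \<in> {0..1}" "v \<in> {0..1}" for u v
    using p that path_image_subpath_subset[of u v p] by auto
  have "P a b"
    using ab(2)
  proof (induct rule: Bolzano)
    case (trans u v w)
    show ?case unfolding P_def
    proof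
      assume uw: "0 \<le> u \<and> w \<le> 1"
      then have uvw: "u \<in> {0..1}" "v \<in> {0..1}" "w \<in> {0..1}" using trans by auto
      let ?E = "\<lambda>t. connector (p t) +++ word_loop (g t)"
      have "homotopic_paths (- Z) (subpath u w p +++ ?E w) ((subpath u v p +++ subpath v w p) +++ ?E w)"
        using uvw imgs p by (intro homotopic_join_left homotopic_paths_sym[OF homotopic_join_subpaths]) auto
      also have "homotopic_paths (- Z) \<dots> (subpath u v p +++ (subpath v w p +++ ?E w))"
        using uvw imgs sub by (intro homotopic_paths_sym[OF homotopic_paths_assoc]) auto
      also have "homotopic_paths (- Z) \<dots> (subpath u v p +++ ?E v)"
        using trans uvw sub unfolding P_def by (intro homotopic_join_right) auto
      also have "homotopic_paths (- Z) \<dots> (?E u)" using trans uvw unfolding P_def by auto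
      finally show "homotopic_paths (- Z) (subpath u w p +++ ?E w) (?E u)" .
    qed
  next
    case (local x)
    then have "x \<in> {0..1}" using ab by auto
    then obtain V \<sigma> e where V: "(V, \<sigma>) \<in> Sheets" "e > 0" "\<And>s. s \<in> {0..1} \<inter> ball x e \<Longrightarrow> p s \<in> V \<and> g s = \<sigma> (p s)"
      using g unfolding lift_def by meson
    show ?case
    proof (intro exI[of _ e] conjI allI impI)
      fix u v assume uv: "u \<le> x \<and> x \<le> v \<and> v - u < e"
      show "P u v" unfolding P_def
      proof
        assume 01: "0 \<le> u \<and> v \<le> 1"
        have near: "s \<in> {0..1} \<inter> ball x e" if "s \<in> {u..v}" for s using that uv 01 by (auto simp: dist_real_def)
        have "path_image (subpath u v p) \<subseteq> V"
          using V(3)[OF near] uv by (auto simp: path_image_subpath)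
        moreover have "path (subpath u v p)" using sub 01 uv by auto
        ultimately show "homotopic_paths (- Z) (subpath u v p +++ (connector (p v) +++ word_loop (g v))) (connector (p u) +++ word_loop (g u))"
          using sheet_connector[OF V(1), of "subpath u v p" "p u" "p v"] V(3)[OF near, of u] V(3)[OF near, of v] uv by auto
      qed
    qed (use V in auto)
  qed
  then show ?thesis using ab unfolding P_def by simp
qed

text \<open>The loop is lifted with final value \<open>[]\<close>, and \<open>w\<close> is the
  initial value. In \<open>lift_connector\<close> over the full interval both connectors are
  constant, leaving the loop itself and the loop of \<open>w\<close>.\<close>

lemma loop_homotopic_word_loop:
  assumes p: "p \<in> loops_at (- Z) c"
  obtains w where "w \<in> reduced_words" "homotopic_paths (- Z) p (word_loop w)"
proof -
  have p': "path p" "path_image p \<subseteq> - Z" "p 0 = c" "p 1 = c"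
    using p by (auto simp: loops_at_def pathstart_def pathfinish_def)
  have Nil: "[] \<in> reduced_words" by (simp add: reduced_words_iff reduced_def)
  obtain g where g: "lift p {0..1} g" "g 1 = []" using path_lift[OF p'(1,2) Nil] .
  have w: "g 0 \<in> reduced_words" using lift_value[OF g(1)] by simp
  then have img: "path_image (word_loop (g 0)) \<subseteq> - Z" by (intro path_image_word_loop) (simp add: reduced_words_iff)
  have cc: "connector c = linepath c c" using centre_slit_plane by (simp add: connector_def)
  have "homotopic_paths (- Z) (p +++ (linepath c c +++ linepath c c)) (linepath c c +++ word_loop (g 0))"
    using lift_connector[OF p'(1,2) g(1), of 0 1] p' g(2) by (simp add: cc)
  moreover have "homotopic_paths (- Z) (linepath c c +++ linepath c c) (linepath c c)"
    using homotopic_paths_rid[of "linepath c c" "- Z"] centre by simp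
  then have "homotopic_paths (- Z) (p +++ (linepath c c +++ linepath c c)) (p +++ linepath c c)"
    using p' by (intro homotopic_join_right) (auto simp: pathfinish_def)
  moreover have "homotopic_paths (- Z) (p +++ linepath c c) p"
    using homotopic_paths_rid[of p] p' by (simp add: pathfinish_def)
  moreover have "homotopic_paths (- Z) (linepath c c +++ word_loop (g 0)) (word_loop (g 0))"
    using homotopic_paths_lid[of "word_loop (g 0)"] img by simp
  ultimately have "homotopic_paths (- Z) p (word_loop (g 0))"
    by (meson homotopic_paths_sym homotopic_paths_trans)
  then show thesis using that w by blast
qed

theorem fundamental_group_iso: "free_group Z \<cong> fundamental_group (- Z) c"
proof (rule is_isoI)
  let ?h = "\<lambda>w. loop_homotopy (- Z) c `` {word_loop w}"
  have loops: "word_loop w \<in> loops_at (- Z) c" if "w \<in> reduced_words" for w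
    using that path_image_word_loop by (simp add: loops_at_def reduced_words_iff)
  have class_eq: "?h w = loop_homotopy (- Z) c `` {p}" if "w \<in> reduced_words" "p \<in> loops_at (- Z) c" "homotopic_paths (- Z) (word_loop w) p" for w p
    using that loops by (intro equiv_class_eq[OF equiv_loop_homotopy]) (simp add: loop_homotopy_def)
  show "?h \<in> iso (free_group Z) (fundamental_group (- Z) c)"
    unfolding iso_def
  proof (intro CollectI conjI homI bij_betw_imageI inj_onI)
    show "?h w \<in> carrier (fundamental_group (- Z) c)" if "w \<in> reduced_words" for w
      using loops[OF that] by (auto simp: fundamental_group_def quotient_def)
    show "?h (u \<otimes>\<^bsub>free_group Z\<^esub> v) = ?h u \<otimes>\<^bsub>fundamental_group (- Z) c\<^esub> ?h v" if uv: "u \<in> reduced_words" "v \<in> reduced_words" for u v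
    proof -
      have "u \<otimes>\<^bsub>free_group Z\<^esub> v \<in> reduced_words"
        using uv by (simp add: group.is_monoid[OF group_free_group] monoid.m_closed)
      moreover have "homotopic_paths (- Z) (word_loop (u \<otimes>\<^bsub>free_group Z\<^esub> v)) (word_loop u +++ word_loop v)"
        using word_loop_mult uv unfolding reduced_words_iff by (simp add: free_group_def)
      ultimately show ?thesis
        using uv by (simp add: fundamental_group_mult loops class_eq join_loops)
    qed
    show "u = v" if uv: "u \<in> reduced_words" "v \<in> reduced_words" and eq: "?h u = ?h v" for u v
    proof -
      have "(word_loop u, word_loop v) \<in> loop_homotopy (- Z) c"
        using eq_equiv_class[OF eq equiv_loop_homotopy] loops uv by blast
      then have "homotopic_paths (- Z) (word_loop u) (word_loop v)" by (simp add: loop_homotopy_def)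
      moreover have hol: "holonomy (word_loop w) [] w" if "w \<in> reduced_words" for w
        using holonomy_word_loop[of w] that by (simp add: reduced_words_iff foldr_reduced_Cons_Nil)
      ultimately show "u = v"
        using holonomy_unique[OF path_word_loop(1) _ hol[OF uv(2)]] holonomy_homotopic hol[OF uv(1)] by blast
    qed
    show "?h ` reduced_words = carrier (fundamental_group (- Z) c)"
    proof
      show "?h ` reduced_words \<subseteq> carrier (fundamental_group (- Z) c)"
        using loops by (auto simp: fundamental_group_def quotient_def)
      show "carrier (fundamental_group (- Z) c) \<subseteq> ?h ` reduced_words"
      proof
        fix A assume "A \<in> carrier (fundamental_group (- Z) c)"
        then obtain p where p: "p \<in> loops_at (- Z) c" "A = loop_homotopy (- Z) c `` {p}"
          by (auto simp: fundamental_group_def quotient_def)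
        obtain w where "w \<in> reduced_words" "homotopic_paths (- Z) p (word_loop w)"
          using loop_homotopic_word_loop[OF p(1)] .
        then show "A \<in> ?h ` reduced_words" using class_eq p homotopic_paths_sym by blast
      qed
    qed
  qed
qed

end

text \<open>If two punctures lie in the same direction from \<open>c\<close>, then \<open>c\<close>
  is on the line through them. Finitely many lines and points cannot fill the plane.\<close>

lemma punctured_plane_exists:
  assumes "finite Z"
  obtains c where "punctured_plane Z c"
proof -
  \<comment> \<open>The vector \<open>\<i> * (w - z)\<close> is normal to the line through
    \<open>z\<close> and \<open>w\<close>.\<close>
  define B where "B = (\<Union>(z, w)\<in>{(z, w) \<in> Z \<times> Z. z \<noteq> w}. {p. (\<i> * (w - z)) \<bullet> p = (\<i> * (w - z)) \<bullet> z})"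
  have "finite {(z, w) \<in> Z \<times> Z. z \<noteq> w}" by (rule finite_subset[of _ "Z \<times> Z"]) (use assms in auto)
  then have "negligible B"
    unfolding B_def by (intro negligible_Union) (auto intro!: negligible_hyperplane)
  then have "negligible (B \<union> Z)" using negligible_finite[OF assms] by (rule negligible_Un)
  then have "B \<union> Z \<noteq> UNIV" using non_negligible_UNIV by metis
  then obtain c where c: "c \<notin> B" "c \<notin> Z" by blast
  have "punctured_plane Z c"
  proof
    show "finite Z" by fact
    show "c \<notin> Z" by fact
    fix z w :: complex and t :: real
    assume zw: "z \<in> Z" "w \<in> Z" "t > 0" "w - c = of_real t * (z - c)"
    show "w = z"
    proof (rule ccontr)
      assume "w \<noteq> z"
      have wz: "w - z = of_real (t - 1) * (z - c)" using zw(4) by (simp add: algebra_simps)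
      have "(\<i> * (w - z)) \<bullet> (c - z) = 0"
        unfolding wz by (simp add: inner_complex_def algebra_simps)
      then show False using c(1) zw \<open>w \<noteq> z\<close> unfolding B_def by (auto simp: inner_diff_right)
    qed
  qed
  then show thesis by (rule that)
qed

section \<open>Complements of hyperplane arrangements\<close>

definition linear_form :: "(complex ^ 'k::finite \<Rightarrow> complex) \<Rightarrow> bool" where
  "linear_form f \<longleftrightarrow> (\<forall>v w. f (v + w) = f v + f w) \<and> (\<forall>c v. f (c *s v) = c * f v)"

lemma linear_form_add: "linear_form f \<Longrightarrow> f (v + w) = f v + f w"
  and linear_form_scale: "linear_form f \<Longrightarrow> f (c *s v) = c * f v"
  by (simp_all add: linear_form_def)

lemma linear_form_zero: "linear_form f \<Longrightarrow> f 0 = 0"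
  using linear_form_scale[of f 0 0] by simp

lemma linear_form_diff: "linear_form f \<Longrightarrow> f (v - w) = f v - f w"
  using linear_form_add[of f "v - w" w] by simp

lemma linear_form_sum: "linear_form f \<Longrightarrow> f (\<Sum>i\<in>I. c i *s b i) = (\<Sum>i\<in>I. c i * f (b i))"
  by (induction I rule: infinite_finite_induct) (simp_all add: linear_form_zero linear_form_add linear_form_scale)

lemma continuous_on_linear_form:
  assumes "linear_form f" "continuous_on T h"
  shows "continuous_on T (\<lambda>x. f (h x))"
proof -
  have "f (h x) = (\<Sum>i\<in>UNIV. h x $ i * f (axis i 1))" for x
    using linear_form_sum[OF assms(1), of "\<lambda>i. h x $ i" "\<lambda>i. axis i 1" UNIV] by (simp add: basis_expansion)
  then show ?thesis by (simp only:) (intro continuous_intros assms(2))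
qed

lemma continuous_on_scale_vec:
  fixes h :: "'a::topological_space \<Rightarrow> complex ^ 'k::finite"
  assumes "continuous_on T c" "continuous_on T h"
  shows "continuous_on T (\<lambda>x. c x *s h x)"
  unfolding vector_scalar_mult_def by (intro continuous_intros assms)

lemma subspace_kernel: "linear_form f \<Longrightarrow> vec.subspace {v. f v = 0}"
  by (rule vec.subspaceI) (simp_all add: linear_form_zero linear_form_add linear_form_scale)

lemma linear_form_span: "linear_form f \<Longrightarrow> (\<And>v. v \<in> B \<Longrightarrow> f v = 0) \<Longrightarrow> v \<in> vec.span B \<Longrightarrow> f v = 0"
  using vec.span_minimal[OF _ subspace_kernel, of B f] by blast

lemma linear_form_representation:
  assumes "vec.independent B" "vec.span B = UNIV"
  shows "linear_form (\<lambda>v. vec.representation B v b)"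
  unfolding linear_form_def using vec.representation_add[OF assms(1)] vec.representation_scale[OF assms(1)]
  by (simp add: assms(2))

lemma representation_sum:
  assumes "vec.independent B" "vec.span B = (UNIV :: (complex ^ 'k::finite) set)"
  shows "(\<Sum>b\<in>B. vec.representation B v b *s b) = v"
  by (rule vec.sum_representation_eq) (use assms vec.finiteI_independent in auto)

lemma independent_span_UNIV:
  fixes B :: "(complex ^ 'k::finite) set"
  assumes "vec.independent B" "card B = CARD('k)"
  shows "vec.span B = UNIV"
proof -
  have "UNIV \<subseteq> vec.span B"
  proof (rule vec.card_ge_dim_independent)
    show "vec.dim (UNIV :: (complex ^ 'k) set) \<le> card B" unfolding vec_dim_card assms(2) ..
  qed (use assms in auto)
  then show ?thesis by blast
qed

text \<open>A basis of \<open>W\<close> becomes a basis of the whole space after adding one vector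
  \<open>e\<close> outside \<open>W\<close>; the form is the coordinate along
  \<open>e\<close>.\<close>

lemma hyperplane_linear_form:
  fixes W :: "(complex ^ 'k::finite) set"
  assumes W: "vec.subspace W" "vec.dim W + 1 = CARD('k)"
  obtains f where "linear_form f" "\<And>v. f v = 0 \<longleftrightarrow> v \<in> W"
proof -
  obtain B where B: "B \<subseteq> W" "vec.independent B" "W \<subseteq> vec.span B" "card B = vec.dim W"
    using vec.basis_exists by blast
  have span: "vec.span B = W" using B W(1) vec.span_minimal by blast
  have "W \<noteq> UNIV" using W(2) vec_dim_card by (metis Suc_eq_plus1 n_not_Suc_n)
  then obtain e where e: "e \<notin> W" by blast
  let ?B = "insert e B"
  have ind: "vec.independent ?B" using e B span by (simp add: vec.independent_insertI)
  have eB: "e \<notin> B" using e B by blast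
  have "card ?B = CARD('k)" using eB B W vec.finiteI_independent[OF B(2)] by simp
  then have spanning: "vec.span ?B = UNIV" by (rule independent_span_UNIV[OF ind])
  show thesis
  proof (rule that)
    show f: "linear_form (\<lambda>v. vec.representation ?B v e)" by (rule linear_form_representation[OF ind spanning])
    fix v
    have "vec.representation ?B v e = 0" if "v \<in> W"
      by (rule linear_form_span[OF f, of B v])
         (use vec.representation_basis[OF ind] eB that span in auto)
    moreover have "v \<in> W" if "vec.representation ?B v e = 0"
    proof -
      have "v = (\<Sum>b\<in>?B. vec.representation ?B v b *s b)" using representation_sum[OF ind spanning] by simp
      also have "\<dots> = (\<Sum>b\<in>B. vec.representation ?B v b *s b)"
        using eB that vec.finiteI_independent[OF B(2)] by simp
      also have "\<dots> \<in> W"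
        using B W by (intro vec.subspace_sum vec.subspace_scale) auto
      finally show ?thesis .
    qed
    ultimately show "vec.representation ?B v e = 0 \<longleftrightarrow> v \<in> W" by blast
  qed
qed

text \<open>If \<open>f\<close> does not vanish on \<open>V\<close>, a basis of its kernel in
  \<open>V\<close> together with one vector \<open>w\<close> where \<open>f w \<noteq> 0\<close>
  spans \<open>V\<close>: a suitable multiple of \<open>w\<close> moves any vector into the
  kernel.\<close>

lemma dim_Int_kernel:
  fixes V :: "(complex ^ 'k::finite) set"
  assumes V: "vec.subspace V" and f: "linear_form f"
  shows "vec.dim V \<le> vec.dim (V \<inter> {v. f v = 0}) + 1"
proof (cases "\<exists>w\<in>V. f w \<noteq> 0")
  case True
  then obtain w where w: "w \<in> V" "f w \<noteq> 0" by blast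
  obtain B where B: "B \<subseteq> V \<inter> {v. f v = 0}" "vec.independent B" "V \<inter> {v. f v = 0} \<subseteq> vec.span B"
      "card B = vec.dim (V \<inter> {v. f v = 0})"
    using vec.basis_exists by blast
  have "V \<subseteq> vec.span (insert w B)"
  proof
    fix v assume v: "v \<in> V"
    let ?u = "v - (f v / f w) *s w"
    have "?u \<in> V" using v w V by (intro vec.subspace_diff vec.subspace_scale)
    moreover have "f ?u = 0" using w by (simp add: linear_form_diff[OF f] linear_form_scale[OF f])
    ultimately have "?u \<in> vec.span (insert w B)" using B(3) vec.span_mono[of B "insert w B"] by blast
    then have "?u + (f v / f w) *s w \<in> vec.span (insert w B)"
      by (intro vec.span_add vec.span_scale) (auto intro: vec.span_base)
    then show "v \<in> vec.span (insert w B)" by simp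
  qed
  then have "vec.dim V \<le> card (insert w B)"
    using vec.finiteI_independent[OF B(2)] by (intro vec.dim_le_card) auto
  also have "\<dots> \<le> card B + 1" using card_insert_le_m1 vec.finiteI_independent[OF B(2)] by (simp add: card_insert_if)
  finally show ?thesis using B by simp
next
  case False
  then have "V \<inter> {v. f v = 0} = V" by blast
  then show ?thesis by simp
qed

text \<open>When a form is added, the vector \<open>p\<close> found so far is moved along a vector
  \<open>q\<close> on which the new form is nonzero. Each form rules out at most one multiple of
  \<open>q\<close>, and the field is infinite.\<close>

lemma common_nonzero_vector:
  assumes V: "vec.subspace V" and "finite G"
    and G: "\<And>g. g \<in> G \<Longrightarrow> linear_form g \<and> (\<exists>q\<in>V. g q \<noteq> 0)"
  shows "\<exists>p\<in>V. \<forall>g\<in>G. g p \<noteq> 0"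
  using \<open>finite G\<close> G
proof (induction G)
  case empty
  then show ?case using vec.subspace_0[OF V] by blast
next
  case (insert g G)
  have "\<exists>p\<in>V. \<forall>h\<in>G. h p \<noteq> 0" by (rule insert.IH) (rule insert.prems, simp)
  then obtain p where p: "p \<in> V" "\<And>h. h \<in> G \<Longrightarrow> h p \<noteq> 0" by blast
  obtain q where q: "q \<in> V" "g q \<noteq> 0" using insert.prems[of g] by blast
  \<comment> \<open>A form with \<open>h q = 0\<close> contributes the quotient \<open>0\<close> by
    the convention for division; this just excludes one further scalar.\<close>
  let ?bad = "(\<lambda>h. - h p / h q) ` insert g G"
  obtain c where c: "c \<notin> ?bad"
    using ex_new_if_finite[OF infinite_UNIV_char_0, of ?bad] insert.hyps by blast
  have "h (p + c *s q) \<noteq> 0" if h: "h \<in> insert g G" for h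
  proof
    assume "h (p + c *s q) = 0"
    then have *: "h p + c * h q = 0"
      using insert.prems[of h] h by (simp add: linear_form_add linear_form_scale)
    have "h q \<noteq> 0"
    proof
      assume "h q = 0"
      then show False using * p(2) q(2) h by auto
    qed
    then have "c = - h p / h q" using * by (simp add: field_simps add_eq_0_iff)
    then show False using c h by blast
  qed
  moreover have "p + c *s q \<in> V" using p q V by (intro vec.subspace_add vec.subspace_scale)
  ultimately show ?case by blast
qed

lemma small_multiplier:
  fixes u k :: "'f \<Rightarrow> real"
  assumes "finite A" "\<And>f. f \<in> A \<Longrightarrow> 0 < u f" "\<And>f. f \<in> A \<Longrightarrow> 0 \<le> k f"
  obtains d where "d > 0" "\<And>f. f \<in> A \<Longrightarrow> d * k f < u f"
proof -
  \<comment> \<open>The summand \<open>1\<close> in the denominator keeps it positive and makes the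
    final inequality strict; the inserted \<open>1\<close> covers an empty \<open>A\<close>.\<close>
  define d where "d = Min (insert 1 ((\<lambda>f. u f / (k f + 1)) ` A))"
  have pos: "d > 0" unfolding d_def using assms by (subst Min_gr_iff) (auto intro!: divide_pos_pos add_nonneg_pos)
  moreover have "d * k f < u f" if f: "f \<in> A" for f
  proof -
    have "d \<le> u f / (k f + 1)" unfolding d_def using assms f by (intro Min_le) auto
    then have "d * (k f + 1) \<le> u f" using assms(3)[OF f] by (simp add: pos_le_divide_eq)
    then show ?thesis using pos by (simp add: distrib_left)
  qed
  ultimately show thesis by (rule that)
qed

section \<open>Topology of the complement in projective space\<close>

definition arrangement_complement :: "(complex ^ 'k::finite \<Rightarrow> complex) set \<Rightarrow> 'k cproj set" where
  "arrangement_complement F = {abs_cproj v |v. v \<noteq> 0 \<and> (\<forall>f\<in>F. f v \<noteq> 0)}"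

text \<open>The representative of a point on which the linear form \<open>f\<close> takes the value \<open>1\<close>.\<close>

definition normalise :: "(complex ^ 'k::finite \<Rightarrow> complex) \<Rightarrow> 'k cproj \<Rightarrow> complex ^ 'k" where
  "normalise f p = inverse (f (rep_cproj p)) *s rep_cproj p"

lemma open_cproj_iff: "open U \<longleftrightarrow> open {v. v \<noteq> 0 \<and> abs_cproj v \<in> U}"
  by (fact open_cproj_def)

lemma continuous_on_abs_cproj: "continuous_on (- {0}) (abs_cproj :: complex ^ 'k::finite \<Rightarrow> _)"
proof -
  have "open (- {0 :: complex ^ 'k})" by auto
  show ?thesis
    unfolding continuous_on_open_vimage[OF \<open>open (- {0})\<close>]
  proof (intro allI impI)
    fix U :: "'k cproj set" assume "open U"
    then have "open {v. v \<noteq> 0 \<and> abs_cproj v \<in> U}" by (simp only: open_cproj_iff)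
    moreover have "abs_cproj -` U \<inter> - {0 :: complex ^ 'k} = {v. v \<noteq> 0 \<and> abs_cproj v \<in> U}" by blast
    ultimately show "open (abs_cproj -` U \<inter> - {0 :: complex ^ 'k})" by simp
  qed
qed

lemma continuous_on_abs_cproj_compose:
  "continuous_on T h \<Longrightarrow> (\<And>t. t \<in> T \<Longrightarrow> h t \<noteq> 0) \<Longrightarrow> continuous_on T (\<lambda>t. abs_cproj (h t))"
  by (rule continuous_on_compose2[OF continuous_on_abs_cproj]) auto

lemma abs_cproj_scale:
  fixes v :: "complex ^ 'k::finite"
  assumes "v \<noteq> 0" "c \<noteq> 0"
  shows "abs_cproj (c *s v) = abs_cproj v"
  using assms by (subst eq_commute, subst abs_cproj_eq_iff) auto

lemma normalise_abs_cproj: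
  assumes "linear_form f" "f v \<noteq> 0"
  shows "normalise f (abs_cproj v) = inverse (f v) *s v"
proof -
  have v: "v \<noteq> 0" using assms linear_form_zero by blast
  have "rep_cproj (abs_cproj v) \<noteq> 0" "abs_cproj (rep_cproj (abs_cproj v)) = abs_cproj v"
    using Quotient3_rep_reflp[OF Quotient3_cproj, of "abs_cproj v"] Quotient3_abs_rep[OF Quotient3_cproj]
    by (auto simp: proportional_def)
  then obtain c where c: "rep_cproj (abs_cproj v) = c *s v" "rep_cproj (abs_cproj v) \<noteq> 0"
    using abs_cproj_eq_iff v by metis
  then have "c \<noteq> 0" by auto
  then show ?thesis using assms c(1) by (simp add: normalise_def linear_form_scale vec.scale_scale)
qed

context
  fixes F :: "(complex ^ 'k::finite \<Rightarrow> complex) set"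
  assumes finite_F: "finite F" and forms: "\<And>f. f \<in> F \<Longrightarrow> linear_form f"
begin

lemma abs_cproj_in_complement:
  assumes "v \<noteq> 0"
  shows "abs_cproj v \<in> arrangement_complement F \<longleftrightarrow> (\<forall>f\<in>F. f v \<noteq> 0)"
proof
  assume "abs_cproj v \<in> arrangement_complement F"
  then obtain w where w: "w \<noteq> 0" "abs_cproj v = abs_cproj w" "\<forall>f\<in>F. f w \<noteq> 0"
    unfolding arrangement_complement_def by blast
  then obtain c where c: "w = c *s v" using abs_cproj_eq_iff[OF assms w(1)] by blast
  then show "\<forall>f\<in>F. f v \<noteq> 0" using w(3) forms by (auto simp: linear_form_scale)
qed (use assms in \<open>auto simp: arrangement_complement_def\<close>)

lemma complement_memI: "f \<in> F \<Longrightarrow> (\<And>g. g \<in> F \<Longrightarrow> g v \<noteq> 0) \<Longrightarrow> abs_cproj v \<in> arrangement_complement F"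
  using abs_cproj_in_complement[of v] linear_form_zero[OF forms] by fastforce

lemma normalise_complement:
  assumes "f \<in> F" "p \<in> arrangement_complement F"
  shows "abs_cproj (normalise f p) = p" "f (normalise f p) = 1" "g \<in> F \<Longrightarrow> g (normalise f p) \<noteq> 0"
proof -
  obtain v where v: "v \<noteq> 0" "p = abs_cproj v" "\<forall>f\<in>F. f v \<noteq> 0"
    using assms(2) unfolding arrangement_complement_def by blast
  have n: "normalise f p = inverse (f v) *s v" using v assms forms by (simp add: normalise_abs_cproj)
  show "abs_cproj (normalise f p) = p" using v assms n by (simp add: abs_cproj_scale)
  show "f (normalise f p) = 1" "g \<in> F \<Longrightarrow> g (normalise f p) \<noteq> 0"
    unfolding n using v(3) assms(1) forms by (auto simp: linear_form_scale)
qed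

text \<open>Openness in the quotient is tested on vectors. There the preimage is that of the
  continuous map \<open>v \<mapsto> inverse (f v) *s v\<close> on the open set where no form of
  \<open>F\<close> vanishes.\<close>

lemma continuous_on_normalise:
  assumes f: "f \<in> F"
  shows "continuous_on (arrangement_complement F) (normalise f)"
proof -
  have lf: "continuous_on UNIV g" if "g \<in> F" for g
    using continuous_on_linear_form[OF forms[OF that] continuous_on_id] by simp
  have op: "open {v. \<forall>g\<in>F. g v \<noteq> 0}"
  proof -
    have "{v. \<forall>g\<in>F. g v \<noteq> 0} = (\<Inter>g\<in>F. {v. g v \<noteq> 0})" by blast
    then show ?thesis by (simp only:) (intro open_INT finite_F ballI open_Collect_neq lf continuous_on_const)
  qed
  have complement: "v \<noteq> 0 \<and> abs_cproj v \<in> arrangement_complement F \<longleftrightarrow> (\<forall>g\<in>F. g v \<noteq> 0)" for v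
    using abs_cproj_in_complement[of v] f linear_form_zero[OF forms[OF f]] by blast
  have "open (normalise f -` B \<inter> arrangement_complement F)" if "open B" for B
  proof -
    have cont: "continuous_on {v. \<forall>g\<in>F. g v \<noteq> 0} (\<lambda>v. inverse (f v) *s v)"
      using f continuous_on_subset[OF lf[OF f]] by (intro continuous_on_scale_vec continuous_intros) auto
    have "{v. v \<noteq> 0 \<and> abs_cproj v \<in> normalise f -` B \<inter> arrangement_complement F} =
        (\<lambda>v. inverse (f v) *s v) -` B \<inter> {v. \<forall>g\<in>F. g v \<noteq> 0}"
    proof (rule Set.set_eqI)
      fix v
      have "normalise f (abs_cproj v) = inverse (f v) *s v" if "\<forall>g\<in>F. g v \<noteq> 0"
        using that f by (intro normalise_abs_cproj[OF forms[OF f]]) blast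
      then show "v \<in> {v. v \<noteq> 0 \<and> abs_cproj v \<in> normalise f -` B \<inter> arrangement_complement F} \<longleftrightarrow>
          v \<in> (\<lambda>v. inverse (f v) *s v) -` B \<inter> {v. \<forall>g\<in>F. g v \<noteq> 0}"
        using complement[of v] by auto
    qed
    then show ?thesis
      unfolding open_cproj_iff using cont \<open>open B\<close> by (simp only: continuous_on_open_vimage[OF op])
  qed
  moreover have "open (arrangement_complement F)" unfolding open_cproj_iff complement by (rule op)
  ultimately show ?thesis by (simp add: continuous_on_open_vimage)
qed

text \<open>A complex line through two points of the complement meets the arrangement in finitely many points.\<close>

lemma path_connected_complement:
  assumes "F \<noteq> {}"
  shows "path_connected (arrangement_complement F)"
  unfolding path_connected_def
proof (intro ballI)
  fix x y assume "x \<in> arrangement_complement F" "y \<in> arrangement_complement F"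
  then obtain v w where v: "x = abs_cproj v" "\<forall>f\<in>F. f v \<noteq> 0" and w: "y = abs_cproj w" "\<forall>f\<in>F. f w \<noteq> 0"
    unfolding arrangement_complement_def by blast
  obtain f0 where f0: "f0 \<in> F" using assms by blast
  define L where "L = (\<lambda>z. v + z *s (w - v))"
  have fL: "f (L z) = f v + z * (f w - f v)" if "f \<in> F" for f z
    using forms[OF that] by (simp add: L_def linear_form_add linear_form_scale linear_form_diff algebra_simps)
  \<comment> \<open>Along the line a form is an affine function of \<open>z\<close>, and these are
    the roots. A form with \<open>f w = f v\<close> is a nonzero constant there and has
    none.\<close>
  define N where "N = (\<lambda>f. f v / (f v - f w)) ` {f \<in> F. f w \<noteq> f v}"
  have nz: "f (L z) \<noteq> 0" if "f \<in> F" "z \<in> - N" for f z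
  proof
    assume "f (L z) = 0"
    then have *: "f v + z * (f w - f v) = 0" using fL that by simp
    then have "f w - f v \<noteq> 0" using v(2) that by force
    then have "z = f v / (f v - f w)" "f w \<noteq> f v" using * by (simp_all add: eq_divide_eq algebra_simps)
    then show False using that by (auto simp: N_def)
  qed
  have "0 \<in> - N" using v(2) by (auto simp: N_def)
  moreover have "1 \<in> - N" using w(2) by (auto simp: N_def eq_divide_eq)
  moreover have "path_connected (- N)"
    using finite_F by (intro path_connected_complement_countable) (auto simp: N_def countable_finite)
  ultimately obtain p where p: "path p" "path_image p \<subseteq> - N" "pathstart p = 0" "pathfinish p = 1"
    unfolding path_connected_def by blast
  have "continuous_on (- N) (\<lambda>z. abs_cproj (L z))"
  proof (rule continuous_on_abs_cproj_compose)
    show "continuous_on (- N) L" unfolding L_def by (intro continuous_intros continuous_on_scale_vec)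
    show "L z \<noteq> 0" if "z \<in> - N" for z using nz[OF f0 that] linear_form_zero[OF forms[OF f0]] by auto
  qed
  then have "path ((\<lambda>z. abs_cproj (L z)) \<circ> p)"
    using p by (intro path_continuous_image) (auto intro: continuous_on_subset)
  moreover have "path_image ((\<lambda>z. abs_cproj (L z)) \<circ> p) \<subseteq> arrangement_complement F"
    using p nz complement_memI[OF f0] by (auto simp: path_image_compose)
  ultimately show "\<exists>g. path g \<and> path_image g \<subseteq> arrangement_complement F \<and> pathstart g = x \<and> pathfinish g = y"
    using p v w by (intro exI[of _ "(\<lambda>z. abs_cproj (L z)) \<circ> p"]) (simp add: pathstart_compose pathfinish_compose L_def)
qed

lemma fundamental_group_complement_base:
  assumes "F \<noteq> {}" "x \<in> arrangement_complement F" "y \<in> arrangement_complement F"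
  shows "fundamental_group (arrangement_complement F) x \<cong> fundamental_group (arrangement_complement F) y"
  using path_connected_complement[OF assms(1)] assms(2,3) fundamental_group_change_base
  unfolding path_connected_def by metis

text \<open>On representatives with \<open>c1 = 1\<close> the value of every form depends on
  \<open>c2\<close> alone. The straight homotopy \<open>H\<close> to the plane of \<open>b1\<close>
  and \<open>b2\<close> preserves both \<open>c1\<close> and \<open>c2\<close>, so it never meets a
  hyperplane.\<close>

lemma pencil_free:
  assumes c1: "c1 \<in> F" and c2: "linear_form c2"
    and dual: "c1 b1 = 1" "c1 b2 = 0" "c2 b1 = 0" "c2 b2 = 1"
    and pencil: "\<And>f v. f \<in> F \<Longrightarrow> f v = c1 v * f b1 + c2 v * f b2"
    and x: "x \<in> arrangement_complement F"
  shows "is_free_group (fundamental_group (arrangement_complement F) x)"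
proof -
  let ?S = "arrangement_complement F"
  \<comment> \<open>The punctures are the roots of \<open>z \<mapsto> f b1 + z * f b2\<close>. A
    form with \<open>f b2 = 0\<close> is a multiple of \<open>c1\<close>, whose hyperplane has been
    moved to infinity.\<close>
  define Z where "Z = (\<lambda>f. - f b1 / f b2) ` {f \<in> F. f b2 \<noteq> 0}"
  have "finite Z" using finite_F by (simp add: Z_def)
  obtain c where "punctured_plane Z c" using punctured_plane_exists[OF \<open>finite Z\<close>] .
  then interpret punctured_plane Z c .
  have lc1: "linear_form c1" using c1 forms by blast
  have iff: "(\<forall>f\<in>F. f v \<noteq> 0) \<longleftrightarrow> c2 v \<notin> Z" if "c1 v = 1" for v
  proof -
    have "f v = 0 \<longleftrightarrow> f b2 \<noteq> 0 \<and> c2 v = - f b1 / f b2" if f: "f \<in> F" for f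
    proof (cases "f b2 = 0")
      case True
      \<comment> \<open>The form \<open>f\<close> is not identically zero, since the complement
        contains \<open>x\<close>.\<close>
      obtain w where "f w \<noteq> 0"
        using x f unfolding arrangement_complement_def by blast
      then have "f b1 \<noteq> 0" using pencil[OF f, of w] True by auto
      then show ?thesis using pencil[OF f, of v] True \<open>c1 v = 1\<close> by simp
    next
      case False
      have "f v = f b1 + c2 v * f b2" using pencil[OF f, of v] \<open>c1 v = 1\<close> by simp
      then show ?thesis using False by (simp only: nonzero_eq_divide_eq[OF False] add_eq_0_iff) simp
    qed
    then show ?thesis unfolding Z_def by blast
  qed
  define r where "r = (\<lambda>p. c2 (normalise c1 p))"
  define s where "s = (\<lambda>z. abs_cproj (b1 + z *s b2))"
  define H where "H = (\<lambda>(t::real, p). abs_cproj (complex_of_real (1 - t) *s normalise c1 p + complex_of_real t *s (b1 + r p *s b2)))"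
  note lin = linear_form_add[OF lc1] linear_form_scale[OF lc1] linear_form_add[OF c2] linear_form_scale[OF c2]
  have in_S: "abs_cproj v \<in> ?S" if "c1 v = 1" "c2 v \<notin> Z" for v
    using that iff complement_memI[OF c1] by blast
  have norm_s: "normalise c1 (s z) = b1 + z *s b2" for z
    unfolding s_def using normalise_abs_cproj[OF lc1, of "b1 + z *s b2"] dual by (simp add: lin)
  have "fundamental_group ?S (s c) \<cong> fundamental_group (- Z) c"
  proof (rule fundamental_group_deformation_retract[where r = r and H = H])
    show "continuous_on ?S r"
      unfolding r_def by (intro continuous_on_linear_form[OF c2] continuous_on_normalise c1)
    show r: "r ` ?S \<subseteq> - Z"
      unfolding r_def using iff normalise_complement[OF c1] by fastforce
    show "continuous_on (- Z) s"
      unfolding s_def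
    proof (rule continuous_on_abs_cproj_compose)
      show "continuous_on (- Z) (\<lambda>z. b1 + z *s b2)" by (intro continuous_intros continuous_on_scale_vec)
      show "b1 + z *s b2 \<noteq> 0" for z
      proof
        assume "b1 + z *s b2 = 0"
        then have "c1 (b1 + z *s b2) = 0" using linear_form_zero[OF lc1] by simp
        then show False using dual by (simp add: lin)
      qed
    qed
    show "s ` (- Z) \<subseteq> ?S" unfolding s_def using in_S dual by (auto simp: lin)
    show rs: "r (s y) = y" for y
      unfolding r_def norm_s using dual by (simp add: lin)
    let ?h = "\<lambda>t p. complex_of_real (1 - t) *s normalise c1 p + complex_of_real t *s (b1 + r p *s b2)"
    have h: "c1 (?h t p) = 1" "c2 (?h t p) = r p" if "p \<in> ?S" for t p
    proof -
      have "c1 (?h t p) = of_real (1 - t) * c1 (normalise c1 p) + of_real t * (c1 b1 + r p * c1 b2)"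
        "c2 (?h t p) = of_real (1 - t) * c2 (normalise c1 p) + of_real t * (c2 b1 + r p * c2 b2)"
        by (simp_all only: lin)
      then show "c1 (?h t p) = 1" "c2 (?h t p) = r p"
        using normalise_complement(2)[OF c1 that] dual by (simp_all add: r_def algebra_simps)
    qed
    show "continuous_on ({0..1} \<times> ?S) H"
      unfolding H_def case_prod_unfold
    proof (rule continuous_on_abs_cproj_compose)
      show "continuous_on ({0..1} \<times> ?S) (\<lambda>z. ?h (fst z) (snd z))"
        unfolding r_def
        by (intro continuous_intros continuous_on_scale_vec continuous_on_linear_form[OF c2]
            continuous_on_compose2[OF continuous_on_normalise[OF c1] continuous_on_snd[OF continuous_on_id]]) auto
      show "?h (fst z) (snd z) \<noteq> 0" if "z \<in> {0..1} \<times> ?S" for z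
        using h(1)[of "snd z" "fst z"] that linear_form_zero[OF lc1] by auto
    qed
    show "H ` ({0..1} \<times> ?S) \<subseteq> ?S"
      unfolding H_def using in_S h r by fastforce
    show "H (0, p) = p" "H (1, p) = s (r p)" if "p \<in> ?S" for p
      using normalise_complement(1)[OF c1 that] by (simp_all add: H_def s_def)
    show "H (t, s y) = s y" for t y
    proof -
      have "?h t (s y) = (complex_of_real (1 - t) + complex_of_real t) *s (b1 + y *s b2)"
        unfolding norm_s rs by (simp only: vec.scale_left_distrib)
      then show ?thesis by (simp add: H_def s_def)
    qed
    show "c \<in> - Z" using centre by simp
  qed
  moreover have sc: "s c \<in> ?S" unfolding s_def by (rule in_S) (use dual centre in \<open>simp_all add: lin\<close>)
  moreover have "fundamental_group ?S x \<cong> fundamental_group ?S (s c)"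
    by (rule fundamental_group_complement_base) (use c1 x sc in auto)
  ultimately have "fundamental_group ?S x \<cong> fundamental_group (- Z) c" by (metis iso_trans)
  moreover have "group (fundamental_group (- Z) c)" "group (fundamental_group ?S x)"
    using centre x by (auto intro!: group_fundamental_group)
  ultimately have "free_group Z \<cong> fundamental_group ?S x"
    using fundamental_group_iso group.iso_sym iso_trans by blast
  then show ?thesis by (rule is_free_groupI[OF \<open>group (fundamental_group ?S x)\<close>])
qed

text \<open>Around a generic point \<open>p\<close> of the intersection of two hyperplanes the complement contains a torus;
  its two generating loops commute, but their winding numbers with respect to \<open>f1 / f3\<close> and \<open>f2 / f3\<close>
  are linearly independent.\<close>

lemma torus_not_free:
  assumes f123: "f1 \<in> F" "f2 \<in> F" "f3 \<in> F"
    and vals: "f1 a = 0" "f2 a = 1" "f3 a = 0" "f1 b = 1" "f2 b = 0" "f3 b = 0" "f1 p = 0" "f2 p = 0" "f3 p = 1"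
    and generic: "\<And>f. f \<in> F \<Longrightarrow> f p = 0 \<Longrightarrow> f a \<noteq> 0 \<or> f b \<noteq> 0"
    and x: "x \<in> arrangement_complement F"
  shows "\<not> is_free_group (fundamental_group (arrangement_complement F) x)"
proof
  let ?S = "arrangement_complement F"
  assume free: "is_free_group (fundamental_group ?S x)"
  \<comment> \<open>The radii are chosen from the inside out: \<open>\<delta>\<close> makes
    \<open>f a\<close> dominate the term with \<open>f b\<close>, and then \<open>\<epsilon>\<close>
    makes \<open>f p\<close> dominate the whole displacement. Hence the first nonzero one of
    \<open>f p\<close>, \<open>f a\<close>, \<open>f b\<close> decides that \<open>f\<close> is
    nonzero on the torus.\<close>
  obtain \<delta> where \<delta>: "\<delta> > 0" "\<And>f. f \<in> {f \<in> F. f a \<noteq> 0} \<Longrightarrow> \<delta> * norm (f b) < norm (f a)"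
    using small_multiplier[of "{f \<in> F. f a \<noteq> 0}" "\<lambda>f. norm (f a)" "\<lambda>f. norm (f b)"] finite_F by auto
  obtain \<epsilon> where \<epsilon>: "\<epsilon> > 0" "\<And>f. f \<in> {f \<in> F. f p \<noteq> 0} \<Longrightarrow> \<epsilon> * (norm (f a) + \<delta> * norm (f b)) < norm (f p)"
    using small_multiplier[of "{f \<in> F. f p \<noteq> 0}" "\<lambda>f. norm (f p)" "\<lambda>f. norm (f a) + \<delta> * norm (f b)"] finite_F \<delta>(1) by auto
  define E where "E = (\<lambda>t::real. exp (2 * of_real pi * \<i> * of_real t))"
  have E: "norm (E t) = 1" "E t \<noteq> 0" "E 0 = 1" "E 1 = 1" for t
    by (simp_all add: E_def norm_exp_eq_Re)
  have cont_E: "continuous_on A (\<lambda>z. E (h z))" if "continuous_on A h" for A and h :: "real \<times> real \<Rightarrow> real"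
    unfolding E_def by (intro continuous_intros that)
  define T where "T = (\<lambda>z. p + (of_real \<epsilon> * E (fst z)) *s (a + (of_real \<delta> * E (snd z)) *s b))"
  have fT: "f (T z) = f p + of_real \<epsilon> * E (fst z) * (f a + of_real \<delta> * E (snd z) * f b)" if "f \<in> F" for f z
    using forms[OF that] by (simp add: T_def linear_form_add linear_form_scale algebra_simps)
  have nz: "f (T z) \<noteq> 0" if f: "f \<in> F" for f z
  proof (cases "f p = 0")
    case True
    have "f a + of_real \<delta> * E (snd z) * f b \<noteq> 0"
    proof (cases "f a = 0")
      case True
      then show ?thesis using generic[OF f \<open>f p = 0\<close>] \<delta>(1) E by simp
    next
      case False
      have "norm (of_real \<delta> * E (snd z) * f b) < norm (f a)"
        using \<delta> False f E by (simp add: norm_mult)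
      then show ?thesis by (metis add_eq_0_iff2 norm_minus_cancel order_less_irrefl)
    qed
    then show ?thesis using True \<epsilon>(1) E by (simp add: fT[OF f])
  next
    case False
    have "norm (f a + of_real \<delta> * E (snd z) * f b) \<le> norm (f a) + \<delta> * norm (f b)"
      by (rule order_trans[OF norm_triangle_ineq]) (use \<delta>(1) E in \<open>simp add: norm_mult\<close>)
    then have "norm (of_real \<epsilon> * E (fst z) * (f a + of_real \<delta> * E (snd z) * f b)) \<le> \<epsilon> * (norm (f a) + \<delta> * norm (f b))"
      using \<epsilon>(1) E by (simp add: norm_mult)
    also have "\<dots> < norm (f p)" using \<epsilon>(2) f False by simp
    finally show ?thesis unfolding fT[OF f] by (metis add_eq_0_iff2 norm_minus_cancel order_less_irrefl)
  qed
  have T3: "f3 (T z) = 1" for z using fT[OF f123(3)] vals by simp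
  define P where "P = (\<lambda>z. abs_cproj (T z))"
  have norm_P: "normalise f3 (P z) = T z" for z
    unfolding P_def using normalise_abs_cproj[OF forms[OF f123(3)], of "T z"] T3 by simp
  have P: "continuous_on A P" for A
    unfolding P_def
  proof (rule continuous_on_abs_cproj_compose)
    show "continuous_on A T" unfolding T_def by (intro continuous_intros continuous_on_scale_vec cont_E)
    show "T z \<noteq> 0" for z using T3[of z] linear_form_zero[OF forms[OF f123(3)]] by auto
  qed
  have P_S: "P z \<in> ?S" for z
    unfolding P_def using complement_memI[OF f123(3)] nz by blast
  have per: "P (1, t) = P (0, t)" "P (t, 1) = P (t, 0)" for t by (simp_all add: P_def T_def E)
  define \<alpha> \<beta> where "\<alpha> = (\<lambda>t. P (t, 0))" and "\<beta> = (\<lambda>t. P (0, t))"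
  have \<alpha>\<beta>: "\<alpha> \<in> loops_at ?S (P (0, 0))" "\<beta> \<in> loops_at ?S (P (0, 0))"
    using per P_S unfolding loops_at_def path_def \<alpha>_def \<beta>_def
    by (auto simp: path_image_def pathstart_def pathfinish_def intro!: continuous_on_compose2[OF P] continuous_intros)
  let ?G = "fundamental_group ?S (P (0, 0))" and ?c = "\<lambda>q. loop_homotopy ?S (P (0, 0)) `` {q}"
  have free': "is_free_group ?G"
    using is_free_group_iso[OF free fundamental_group_complement_base group_fundamental_group] f123 x P_S by blast
  have "homotopic_paths ?S (\<alpha> +++ \<beta>) (\<beta> +++ \<alpha>)"
    unfolding \<alpha>_def \<beta>_def by (rule torus_loops_commute[OF P]) (use P_S per in auto)
  then have comm: "?c \<alpha> \<otimes>\<^bsub>?G\<^esub> ?c \<beta> = ?c \<beta> \<otimes>\<^bsub>?G\<^esub> ?c \<alpha>"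
    using \<alpha>\<beta> by (simp add: fundamental_group_mult loop_class_eq_iff join_loops)
  define g1 g2 where "g1 = (\<lambda>q. f1 (normalise f3 q))" and "g2 = (\<lambda>q. f2 (normalise f3 q))"
  have g: "continuous_on ?S g1" "0 \<notin> g1 ` ?S" "continuous_on ?S g2" "0 \<notin> g2 ` ?S"
    unfolding g1_def g2_def
    using continuous_on_linear_form[OF forms continuous_on_normalise] normalise_complement(3)[OF f123(3)] f123
    by (auto simp: image_iff)
  \<comment> \<open>On the torus the quotients are \<open>\<epsilon> * \<delta> * E s * E t\<close>
    and \<open>\<epsilon> * E s\<close>. The winding numbers along \<open>\<alpha>\<close> and
    \<open>\<beta>\<close> are therefore \<open>1, 1\<close> for \<open>g1\<close> and
    \<open>1, 0\<close> for \<open>g2\<close>, with determinant \<open>-1\<close>.\<close>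
  have "g1 \<circ> \<alpha> = circlepath 0 (\<epsilon> * \<delta>)" "g1 \<circ> \<beta> = circlepath 0 (\<epsilon> * \<delta>)" "g2 \<circ> \<alpha> = circlepath 0 \<epsilon>" "g2 \<circ> \<beta> = (\<lambda>_. of_real \<epsilon>)"
    using vals f123 by (auto simp: g1_def g2_def \<alpha>_def \<beta>_def norm_P fT E circlepath E_def)
  then have w: "winding_number (g1 \<circ> \<alpha>) 0 = 1" "winding_number (g1 \<circ> \<beta>) 0 = 1"
    "winding_number (g2 \<circ> \<alpha>) 0 = 1" "winding_number (g2 \<circ> \<beta>) 0 = 0"
    using \<epsilon>(1) \<delta>(1) by (simp_all add: winding_number_circlepath_centre winding_number_zero_const)
  have "winding_hom g1 (?c \<alpha>) * winding_hom g2 (?c \<beta>) = winding_hom g1 (?c \<beta>) * winding_hom g2 (?c \<alpha>)"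
    using \<alpha>\<beta> comm fundamental_group_carrier
    by (intro is_free_group_commuting[OF free'] winding_hom_mult g) blast+
  then show False
    using w winding_hom_class[OF g(1,2) \<alpha>\<beta>(1)] winding_hom_class[OF g(1,2) \<alpha>\<beta>(2)]
      winding_hom_class[OF g(3,4) \<alpha>\<beta>(1)] winding_hom_class[OF g(3,4) \<alpha>\<beta>(2)] by simp
qed

text \<open>A basis of the space is built from \<open>CARD('k) - 2\<close> vectors of the common
  kernel and two further vectors \<open>b1\<close>, \<open>b2\<close>. Every form vanishes on the
  former, so only its values on \<open>b1\<close> and \<open>b2\<close> matter, which is the
  situation of \<open>pencil_free\<close>.\<close>

lemma free_if_large_intersection:
  assumes F: "F \<noteq> {}" and x: "x \<in> arrangement_complement F"
    and dim: "CARD('k) \<le> vec.dim {v. \<forall>f\<in>F. f v = 0} + 2" and card: "CARD('k) \<ge> 2"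
  shows "is_free_group (fundamental_group (arrangement_complement F) x)"
proof -
  obtain c1 where c1: "c1 \<in> F" using F by blast
  note l1 = forms[OF c1]
  obtain v where "\<forall>f\<in>F. f v \<noteq> 0" using x unfolding arrangement_complement_def by auto
  then have "c1 (inverse (c1 v) *s v) = 1" using c1 by (simp add: linear_form_scale[OF l1])
  then obtain b1 where b1: "c1 b1 = 1" ..
  obtain B' where B': "B' \<subseteq> {v. \<forall>f\<in>F. f v = 0}" "vec.independent B'"
      "{v. \<forall>f\<in>F. f v = 0} \<subseteq> vec.span B'" "card B' = vec.dim {v. \<forall>f\<in>F. f v = 0}"
    by (rule vec.basis_exists)
  have "CARD('k) - 2 \<le> card B'" using dim B' by simp
  \<comment> \<open>The common kernel may itself be a hyperplane, so exactly
    \<open>CARD('k) - 2\<close> of its basis vectors are kept and two places remain in either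
    case.\<close>
  then obtain B where B: "B \<subseteq> B'" "card B = CARD('k) - 2"
    using obtain_subset_with_card_n by metis
  have ind: "vec.independent B" using B' B vec.independent_mono by blast
  have fin: "finite B" using vec.finiteI_independent[OF ind] .
  have vanish: "f v = 0" if "f \<in> F" "v \<in> B" for f v using that B B' by blast
  have "b1 \<notin> vec.span B" using linear_form_span[OF l1 vanish[OF c1]] b1 by force
  then have ind1: "vec.independent (insert b1 B)" by (rule vec.independent_insertI[OF _ ind])
  have "b1 \<notin> B" using vanish[OF c1] b1 by force
  then have card1: "card (insert b1 B) = CARD('k) - 1" using fin B card by simp
  have "vec.span (insert b1 B) \<noteq> UNIV"
  proof
    assume "vec.span (insert b1 B) = UNIV"
    then have "vec.dim (UNIV :: (complex ^ 'k) set) \<le> card (insert b1 B)"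
      using fin by (intro vec.dim_le_card) auto
    then show False using card1 card unfolding vec_dim_card by linarith
  qed
  then obtain w where w: "w \<notin> vec.span (insert b1 B)" by blast
  \<comment> \<open>Removing the \<open>c1\<close>-part makes \<open>c1\<close> and the coordinate
    along \<open>b2\<close> dual to \<open>b1\<close> and \<open>b2\<close>.\<close>
  define b2 where "b2 = w - c1 w *s b1"
  have b2: "c1 b2 = 0" by (simp add: b2_def linear_form_diff[OF l1] linear_form_scale[OF l1] b1)
  have b2_span: "b2 \<notin> vec.span (insert b1 B)"
  proof
    assume "b2 \<in> vec.span (insert b1 B)"
    then have "b2 + c1 w *s b1 \<in> vec.span (insert b1 B)"
      by (intro vec.span_add vec.span_scale) (auto intro: vec.span_base)
    then show False using w by (simp add: b2_def)
  qed
  let ?B = "insert b2 (insert b1 B)"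
  have ind2: "vec.independent ?B" by (rule vec.independent_insertI[OF b2_span ind1])
  have b2_B: "b2 \<notin> insert b1 B" using b2_span vec.span_base by blast
  then have "card ?B = CARD('k)" using fin card1 card by simp
  then have span: "vec.span ?B = UNIV" by (rule independent_span_UNIV[OF ind2])
  let ?r = "vec.representation ?B"
  have expand: "f v = ?r v b2 * f b2 + ?r v b1 * f b1" if f: "f \<in> F" for f v
  proof -
    have "f v = (\<Sum>b\<in>?B. ?r v b * f b)"
      using linear_form_sum[OF forms[OF f], of "?r v" "\<lambda>b. b" ?B] representation_sum[OF ind2 span] by simp
    also have "\<dots> = ?r v b2 * f b2 + (?r v b1 * f b1 + (\<Sum>b\<in>B. ?r v b * f b))"
      using fin b2_B \<open>b1 \<notin> B\<close> by simp
    also have "(\<Sum>b\<in>B. ?r v b * f b) = 0" using vanish[OF f] by simp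
    finally show ?thesis by simp
  qed
  show ?thesis
  proof (rule pencil_free[OF c1 linear_form_representation[OF ind2 span, of b2]])
    show "c1 b1 = 1" "c1 b2 = 0" by fact+
    show "?r b1 b2 = 0" "?r b2 b2 = 1"
      using vec.representation_basis[OF ind2, of b1] vec.representation_basis[OF ind2, of b2] b2_B by auto
    show "f v = c1 v * f b1 + ?r v b2 * f b2" if "f \<in> F" for f v
      using expand[OF that, of v] expand[OF c1, of v] b1 b2 by simp
  qed (rule x)
qed

text \<open>Each kernel taken so far is larger than the common kernel, so another form of
  \<open>F\<close> is nonzero somewhere on it. Two such steps after \<open>f1\<close> provide
  \<open>f2\<close> and \<open>f3\<close>, and the rest constructs vectors as in
  \<open>torus_not_free\<close>.\<close>

lemma not_free_if_small_intersection:
  assumes F: "F \<noteq> {}" and x: "x \<in> arrangement_complement F"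
    and dim: "vec.dim {v. \<forall>f\<in>F. f v = 0} + 2 < CARD('k)"
  shows "\<not> is_free_group (fundamental_group (arrangement_complement F) x)"
proof -
  have nonzero: "\<exists>v. f v \<noteq> 0" if "f \<in> F" for f using x that unfolding arrangement_complement_def by blast
  obtain f1 where f1: "f1 \<in> F" using F by blast
  note l1 = forms[OF f1]
  let ?W = "\<lambda>f. {v. f v = 0}"
  have d1: "CARD('k) \<le> vec.dim (?W f1) + 1"
    using dim_Int_kernel[OF vec.subspace_UNIV l1] by (simp only: vec_dim_card Int_UNIV_left)
  have ex: "\<exists>f\<in>F. \<exists>v\<in>V. f v \<noteq> 0" if "vec.dim {v. \<forall>f\<in>F. f v = 0} < vec.dim V" for V
    using vec.dim_subset[of V "{v. \<forall>f\<in>F. f v = 0}"] that by force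
  obtain f2 a0 where f2: "f2 \<in> F" "f1 a0 = 0" "f2 a0 \<noteq> 0" using ex[of "?W f1"] d1 dim by auto
  note l2 = forms[OF f2(1)]
  let ?V = "?W f1 \<inter> ?W f2"
  have "vec.dim (?W f1) \<le> vec.dim ?V + 1" by (rule dim_Int_kernel[OF subspace_kernel[OF l1] l2])
  then obtain f3 where f3: "f3 \<in> F" "\<exists>q\<in>?V. f3 q \<noteq> 0" using ex[of ?V] d1 dim by auto
  note l3 = forms[OF f3(1)]
  have V: "vec.subspace ?V" by (intro vec.subspace_inter subspace_kernel l1 l2)
  \<comment> \<open>A generic point of \<open>?V\<close> lies only on those hyperplanes of the
    arrangement that contain all of \<open>?V\<close>.\<close>
  have "\<exists>p\<in>?V. \<forall>g\<in>{f \<in> F. \<exists>q\<in>?V. f q \<noteq> 0}. g p \<noteq> 0"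
    by (rule common_nonzero_vector[OF V]) (use finite_F forms in auto)
  then obtain p0 where p0: "f1 p0 = 0" "f2 p0 = 0" "\<And>f. f \<in> F \<Longrightarrow> \<exists>q\<in>?V. f q \<noteq> 0 \<Longrightarrow> f p0 \<noteq> 0" by auto
  have f3p0: "f3 p0 \<noteq> 0" using p0(3) f3 by blast
  \<comment> \<open>Rescaling and subtracting turn the chosen vectors into \<open>b\<close>,
    \<open>a\<close>, \<open>p\<close>, dual to \<open>f1\<close>, \<open>f2\<close>,
    \<open>f3\<close> in this order.\<close>
  define p where "p = inverse (f3 p0) *s p0"
  define a1 where "a1 = inverse (f2 a0) *s a0"
  obtain w0 where w0: "f1 w0 \<noteq> 0" using nonzero[OF f1] by blast
  define w where "w = inverse (f1 w0) *s w0"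
  define b0 where "b0 = w - f2 w *s a1"
  define a where "a = a1 - f3 a1 *s p"
  define b where "b = b0 - f3 b0 *s p"
  note lin = linear_form_diff[OF l1] linear_form_diff[OF l2] linear_form_diff[OF l3]
    linear_form_scale[OF l1] linear_form_scale[OF l2] linear_form_scale[OF l3]
  have p: "f1 p = 0" "f2 p = 0" "f3 p = 1" using p0 f3p0 by (simp_all add: p_def lin)
  have a1: "f1 a1 = 0" "f2 a1 = 1" using f2 by (simp_all add: a1_def lin)
  have w: "f1 w = 1" using w0 by (simp add: w_def lin)
  have b0: "f1 b0 = 1" "f2 b0 = 0" using a1 w by (simp_all add: b0_def lin)
  have a: "f1 a = 0" "f2 a = 1" "f3 a = 0" using a1 p by (simp_all add: a_def lin)
  have b: "f1 b = 1" "f2 b = 0" "f3 b = 0" using b0 p by (simp_all add: b_def lin)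
  show ?thesis
  proof (rule torus_not_free[OF f1 f2(1) f3(1) a b p _ x])
    fix f assume f: "f \<in> F" "f p = 0"
    note lf = forms[OF f(1)]
    have "f p0 = 0" using f(2) f3p0 by (simp add: p_def linear_form_scale[OF lf])
    then have vanish: "f q = 0" if "q \<in> ?V" for q using p0(3)[OF f(1)] that by blast
    obtain v where v: "f v \<noteq> 0" using nonzero[OF f(1)] by blast
    \<comment> \<open>A form vanishing at the generic point vanishes on \<open>?V\<close>, so it is
      a combination of \<open>f1\<close> and \<open>f2\<close> with coefficients \<open>f b\<close>
      and \<open>f a\<close>; being nonzero, it has a nonzero coefficient.\<close>
    have "v - f2 v *s a - f1 v *s b \<in> ?V" using a b by (simp add: lin)
    from vanish[OF this] have "f v = f2 v * f a + f1 v * f b"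
      by (simp add: linear_form_diff[OF lf] linear_form_scale[OF lf] diff_eq_eq add.commute)
    then show "f a \<noteq> 0 \<or> f b \<noteq> 0" using v by auto
  qed
qed

end

theorem theorem4:
  fixes m n :: nat
    and H :: "nat \<Rightarrow> 'k::finite cproj set"
    and x :: "'k cproj"
  assumes "CARD('k) = m + 3"
    and "n \<ge> 1"
    and "\<And>i. i \<in> {1..n} \<Longrightarrow> projective_subspace (H i) \<and> proj_dim (H i) = m + 1"
    and "x \<notin> (\<Union>i\<in>{1..n}. H i)"
  shows "is_free_group (fundamental_group (- (\<Union>i\<in>{1..n}. H i)) x) \<longleftrightarrow>
           (\<Inter>i\<in>{1..n}. H i) \<noteq> {} \<and> proj_dim (\<Inter>i\<in>{1..n}. H i) \<ge> m"
proof -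
  have "\<exists>f. linear_form f \<and> (\<forall>v. f v = 0 \<longleftrightarrow> v \<in> proj_cone (H i))" if "i \<in> {1..n}" for i
  proof -
    \<comment> \<open>Since \<open>m + 1\<close> is positive, the truncated subtraction in
      \<open>proj_dim\<close> is exact here, and the cone has dimension
      \<open>m + 2\<close>.\<close>
    have "vec.subspace (proj_cone (H i))" "vec.dim (proj_cone (H i)) + 1 = CARD('k)"
      using assms(1) assms(3)[OF that] by (auto simp: projective_subspace_def proj_dim_def)
    then show ?thesis using hyperplane_linear_form by metis
  qed
  then obtain f where f: "\<And>i. i \<in> {1..n} \<Longrightarrow> linear_form (f i)"
      "\<And>i v. i \<in> {1..n} \<Longrightarrow> f i v = 0 \<longleftrightarrow> v \<in> proj_cone (H i)" by metis
  define F where "F = f ` {1..n}"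
  have F: "finite F" "\<And>g. g \<in> F \<Longrightarrow> linear_form g" "F \<noteq> {}" using f assms(2) by (auto simp: F_def)
  have in_H: "abs_cproj v \<in> H i \<longleftrightarrow> f i v = 0" if "v \<noteq> 0" "i \<in> {1..n}" for v i
    using that f(2) by (simp add: proj_cone_def)
  have complement: "- (\<Union>i\<in>{1..n}. H i) = arrangement_complement F"
  proof (rule Set.set_eqI)
    fix y :: "'k cproj"
    obtain v where v: "v \<noteq> 0" "y = abs_cproj v" by (rule abs_cproj_cases)
    show "y \<in> - (\<Union>i\<in>{1..n}. H i) \<longleftrightarrow> y \<in> arrangement_complement F"
      using abs_cproj_in_complement[OF F(1,2) v(1)] in_H[OF v(1)] v(2) by (auto simp: F_def)
  qed
  then have x: "x \<in> arrangement_complement F" using assms(4) by blast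
  let ?I = "\<Inter>i\<in>{1..n}. H i" and ?K = "{v. \<forall>g\<in>F. g v = 0}"
  have "1 \<in> {1..n}" using assms(2) by simp
  have cone: "proj_cone ?I = ?K"
  proof (rule Set.set_eqI)
    fix v show "v \<in> proj_cone ?I \<longleftrightarrow> v \<in> ?K"
    proof (cases "v = 0")
      case True
      then show ?thesis using F(2) linear_form_zero by (auto simp: proj_cone_def)
    next
      case False
      then show ?thesis using in_H[OF False] by (auto simp: proj_cone_def F_def)
    qed
  qed
  have nonempty: "?I \<noteq> {} \<longleftrightarrow> vec.dim ?K \<noteq> 0"
  proof -
    have "?I \<noteq> {} \<longleftrightarrow> (\<exists>v. v \<noteq> 0 \<and> v \<in> ?K)"
      unfolding cone[symmetric] proj_cone_def using abs_cproj_cases by (metis (mono_tags, lifting) equals0I empty_iff mem_Collect_eq)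
    also have "\<dots> \<longleftrightarrow> vec.dim ?K \<noteq> 0" by (auto simp: vec.dim_eq_0)
    finally show ?thesis .
  qed
  \<comment> \<open>Because of truncated subtraction \<open>proj_dim\<close> is \<open>0\<close> for
    the empty set as well as for a point; for \<open>m = 0\<close> it is the nonemptiness clause
    that tells them apart.\<close>
  have rhs: "?I \<noteq> {} \<and> proj_dim ?I \<ge> m \<longleftrightarrow> m + 1 \<le> vec.dim ?K"
  proof -
    have "d \<noteq> 0 \<and> m \<le> d - 1 \<longleftrightarrow> m + 1 \<le> d" for d by auto
    with nonempty show ?thesis by (simp only: proj_dim_def cone)
  qed
  show ?thesis
  proof (cases "m + 1 \<le> vec.dim ?K")
    case True
    then show ?thesis
      unfolding complement rhs using free_if_large_intersection[OF F(1,2,3) x] assms(1) by simp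
  next
    case False
    then show ?thesis
      unfolding complement rhs using not_free_if_small_intersection[OF F(1,2,3) x] assms(1) by simp
  qed
qed

end
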